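(* Suppose that, as $n\to\infty$, $W_n\to W$ in distribution for some random variable $W$, $\mathbf{E}[W_n]\to\mathbf{E}[W]\in(0,\infty)$ and $\mathbf{E}[W_n^2]\to\mathbf{E}[W^2]<\infty$. Then $(\mathrm{BGRG}_n(\mathbf{w}),V_n^b)$ converges locally in probability to $(\mathrm{BP}_\gamma,0)$. Consequently, $(\mathrm{DRIG}_n(\mathbf{w}),o_n)$ converges locally in probability to $(\mathrm{CP},o)$.
   Context: Notation. $[n]=\{1,\dots,n\}$; $[n]_k$ is the set of $k$-element subsets of $[n]$; elements $a\in\bigcup_{k\ge 2}[n]_k$ are called groups and $|a|$ is the size of $a$. For each $n$, $\mathbf{w}=(w_i)_{i\in[n]}$ are deterministic nonnegative vertex weights (possibly depending on $n$), $\ell_n=\sum_{i\in[n]}w_i>0$, and $W_n=w_{o_n}$ is the weight of a uniformly chosen vertex $o_n\in[n]$. $(p_k)_{k\ge2}$ is a probability mass function with $\mu=\sum_{k\ge2}kp_k<\infty$ and $\mu_{(2)}=\sum_{k\ge2}k^2p_k<\infty$; $f(k)=k!\,p_k$. Static model. Independently over groups, group $a$ is ON with probability $\pi^a_{\mathrm{ON}}=\dfrac{f(|a|)\prod_{i\in a}w_i}{\ell_n^{|a|-1}+f(|a|)\prod_{i\in a}w_i}$ and OFF otherwise. $\mathrm{BGRG}_n(\mathbf{w})$ is the bipartite graph with left-vertices $[n]$, right-vertices the ON groups, each ON group $a$ being joined to exactly the left-vertices $i\in a$. $\mathrm{DRIG}_n(\mathbf{w})$ is the multigraph on $[n]$ in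 which the number of edges between $i\ne j$ is the number of ON groups containing both $i$ and $j$ (the "community projection" of $\mathrm{BGRG}_n(\mathbf{w})$). Given the graph, $V_n^b$ is uniform over all (left and right) vertices of $\mathrm{BGRG}_n(\mathbf{w})$, and $o_n$ is uniform over $[n]$. Local convergence in probability. For a graph $G$ and vertex $o$, $B_r(G,o)$ is the subgraph spanned by vertices at graph distance at most $r$ from $o$, rooted at $o$; $\simeq$ is isomorphism of rooted (multi)graphs preserving roots. For random finite graphs $G_n$ with vertex set $\mathcal V(G_n)$, $|\mathcal V(G_n)|\to\infty$ in probability, and $o_n$ uniform in $\mathcal V(G_n)$ given $G_n$, $(G_n,o_n)$ converges locally in probability to a random rooted graph $(G,o)$ if for every fixed rooted graph $(H,o')$ and $r\in\mathbb N$, $\frac1{|\mathcal V(G_n)|}\sum_{i\in \mathcal V(G_n)}\mathbf 1\{B_r(G_n,i)\simeq(H,o')\}\to\mathbf P(B_r(G,o)\simeq (H,o'))$ in probability. Limit objects. $D^{(l)}$ is mixed Poisson: $\mathbf P(D^{(l)}=j)=\mathbf E[e^{-\mu W}(\mu W)^j/j!]$; $D^{(r)}$ has $\mathbf P(D^{(r)}=k)=p_k$. For an $\mathbb N$-valued $X$ with finite positive mean, $\tilde X$ is defined by $\mathbf P(\tilde X=k)=(k+1)\mathbf P(X=k+1)/\mathbf E[X]$, $k\ge0$. $\mathrm{BP}_l$ is the branching process tree with root $0$ in which individuals in even generations are marked $l$ and in odd generations are marked $r$; all offspring numbers are independent, the root has offspring distribution $D^{(l)}$, every other $l$-individual has offspring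 distribution $\tilde D^{(l)}$ and every $r$-individual has offspring distribution $\tilde D^{(r)}$. $\mathrm{BP}_r$ is defined in the same way with the roles of $l$ and $r$ exchanged. $\gamma$ is a random mark, independent of the trees, with $\mathbf P(\gamma=l)=\frac1{1+\mathbf E[W]}$, $\mathbf P(\gamma=r)=\frac{\mathbf E[W]}{1+\mathbf E[W]}$, and $(\mathrm{BP}_\gamma,0)$ equals $(\mathrm{BP}_l,0)$ if $\gamma=l$ and $(\mathrm{BP}_r,0)$ if $\gamma=r$ (marks are ignored). $(\mathrm{CP},o)$ is the community projection of $\mathrm{BP}_l$: its vertices are the $l$-individuals, its root $o$ is the root $0$, and two distinct $l$-individuals are joined by an edge if they are adjacent to a common $r$-individual. *)

theory Defs
  imports "HOL-Probability.Probability"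
begin

section \<open>Rooted multigraphs\<close>

text \<open>Undirected loopless multigraphs are given by a vertex set and a symmetric edge-multiplicity
  function; a simple graph has multiplicities 0 and 1.\<close>

record 'v mgraph =
  vertices :: "'v set"
  edge_mult :: "'v \<Rightarrow> 'v \<Rightarrow> nat"

definition mgraph :: "'v mgraph \<Rightarrow> bool" where
  "mgraph G \<longleftrightarrow>
     (\<forall>u v. edge_mult G u v = edge_mult G v u) \<and>
     (\<forall>v. edge_mult G v v = 0) \<and>
     (\<forall>u v. edge_mult G u v > 0 \<longrightarrow> u \<in> vertices G \<and> v \<in> vertices G)"

definition rooted_mgraph :: "'v mgraph \<Rightarrow> 'v \<Rightarrow> bool" where
  "rooted_mgraph G x \<longleftrightarrow> mgraph G \<and> x \<in> vertices G"

definition adj_rel :: "'v mgraph \<Rightarrow> ('v \<times> 'v) set" where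
  "adj_rel G = {(u, v). edge_mult G u v > 0}"

definition graph_dist :: "'v mgraph \<Rightarrow> 'v \<Rightarrow> 'v \<Rightarrow> enat" where
  "graph_dist G u v = (INF k\<in>{k. (u, v) \<in> adj_rel G ^^ k}. enat k)"

definition nbhd :: "'v mgraph \<Rightarrow> 'v \<Rightarrow> nat \<Rightarrow> 'v mgraph" where
  "nbhd G x r =
     (let B = {v \<in> vertices G. graph_dist G x v \<le> enat r}
      in \<lparr>vertices = B, edge_mult = (\<lambda>u v. if u \<in> B \<and> v \<in> B then edge_mult G u v else 0)\<rparr>)"

definition rooted_iso :: "'v mgraph \<Rightarrow> 'v \<Rightarrow> 'u mgraph \<Rightarrow> 'u \<Rightarrow> bool" where
  "rooted_iso G x H y \<longleftrightarrow>
     (\<exists>\<phi>. bij_betw \<phi> (vertices G) (vertices H) \<and> \<phi> x = y \<and>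
          (\<forall>u\<in>vertices G. \<forall>v\<in>vertices G. edge_mult H (\<phi> u) (\<phi> v) = edge_mult G u v))"


section \<open>Local convergence in probability\<close>

definition nbhd_fraction :: "'v mgraph \<Rightarrow> nat \<Rightarrow> 'u mgraph \<Rightarrow> 'u \<Rightarrow> real" where
  "nbhd_fraction G r H y =
     (\<Sum>x\<in>vertices G. of_bool (rooted_iso (nbhd G x r) x H y)) / real (card (vertices G))"

text \<open>\<open>G n\<close> is the law of the \<open>n\<close>-th random finite graph; the limiting random rooted graph is
  \<open>(L \<omega>, x \<omega>)\<close> with \<open>\<omega>\<close> drawn from \<open>N\<close>. The first three conjuncts are the standing requirements
  on these objects. The test graph \<open>H\<close> may be taken on natural numbers: balls in the graphs on the
  left are finite, and those in a locally finite limit graph are finite as well.\<close>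

definition converges_locally_in_probability ::
  "(nat \<Rightarrow> 'v mgraph pmf) \<Rightarrow> 'b measure \<Rightarrow> ('b \<Rightarrow> 'u mgraph) \<Rightarrow> ('b \<Rightarrow> 'u) \<Rightarrow> bool" where
  "converges_locally_in_probability G N L x \<longleftrightarrow>
     (\<forall>n. \<forall>g\<in>set_pmf (G n). mgraph g \<and> finite (vertices g)) \<and>
     (\<forall>K::nat. (\<lambda>n. measure_pmf.prob (G n) {g. card (vertices g) \<le> K}) \<longlonglongrightarrow> 0) \<and>
     prob_space N \<and> (\<forall>\<omega>\<in>space N. rooted_mgraph (L \<omega>) (x \<omega>)) \<and>
     (\<forall>(H :: nat mgraph) y r. rooted_mgraph H y \<longrightarrow>
        {\<omega> \<in> space N. rooted_iso (nbhd (L \<omega>) (x \<omega>) r) (x \<omega>) H y} \<in> sets N \<and>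
        (\<forall>\<epsilon>>0. (\<lambda>n. measure_pmf.prob (G n)
           {g. \<bar>nbhd_fraction g r H y -
                measure N {\<omega> \<in> space N. rooted_iso (nbhd (L \<omega>) (x \<omega>) r) (x \<omega>) H y}\<bar> > \<epsilon>})
           \<longlonglongrightarrow> 0))"


section \<open>The static model\<close>

definition groups :: "nat \<Rightarrow> nat set set" where
  "groups n = {a. a \<subseteq> {1..n} \<and> card a \<ge> 2}"

definition total_weight :: "(nat \<Rightarrow> nat \<Rightarrow> real) \<Rightarrow> nat \<Rightarrow> real" where
  "total_weight w n = (\<Sum>i\<in>{1..n}. w n i)"

definition size_factor :: "nat pmf \<Rightarrow> nat \<Rightarrow> real" where
  "size_factor p k = fact k * pmf p k"

definition on_prob :: "nat pmf \<Rightarrow> (nat \<Rightarrow> nat \<Rightarrow> real) \<Rightarrow> nat \<Rightarrow> nat set \<Rightarrow> real" where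
  "on_prob p w n a =
     size_factor p (card a) * (\<Prod>i\<in>a. w n i) /
     (total_weight w n ^ (card a - 1) + size_factor p (card a) * (\<Prod>i\<in>a. w n i))"

text \<open>The random set of ON groups.\<close>

definition on_groups_pmf :: "nat pmf \<Rightarrow> (nat \<Rightarrow> nat \<Rightarrow> real) \<Rightarrow> nat \<Rightarrow> nat set set pmf" where
  "on_groups_pmf p w n =
     map_pmf (\<lambda>s. {a \<in> groups n. s a})
       (Pi_pmf (groups n) False (\<lambda>a. bernoulli_pmf (on_prob p w n a)))"

definition bgrg_graph :: "nat \<Rightarrow> nat set set \<Rightarrow> (nat + nat set) mgraph" where
  "bgrg_graph n A =
     \<lparr>vertices = Inl ` {1..n} \<union> Inr ` A,
      edge_mult = (\<lambda>u v. of_bool (\<exists>a\<in>A. \<exists>i\<in>a. (u, v) = (Inl i, Inr a) \<or> (u, v) = (Inr a, Inl i)))\<rparr>"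

definition drig_graph :: "nat \<Rightarrow> nat set set \<Rightarrow> nat mgraph" where
  "drig_graph n A =
     \<lparr>vertices = {1..n},
      edge_mult = (\<lambda>i j. if i = j then 0 else card {a \<in> A. i \<in> a \<and> j \<in> a})\<rparr>"

definition BGRG :: "nat pmf \<Rightarrow> (nat \<Rightarrow> nat \<Rightarrow> real) \<Rightarrow> nat \<Rightarrow> (nat + nat set) mgraph pmf" where
  "BGRG p w n = map_pmf (bgrg_graph n) (on_groups_pmf p w n)"

definition DRIG :: "nat pmf \<Rightarrow> (nat \<Rightarrow> nat \<Rightarrow> real) \<Rightarrow> nat \<Rightarrow> nat mgraph pmf" where
  "DRIG p w n = map_pmf (drig_graph n) (on_groups_pmf p w n)"


section \<open>The limit objects\<close>

definition size_mean :: "nat pmf \<Rightarrow> real" where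
  "size_mean p = (\<Sum>k. real k * pmf p k)"

definition mixed_poisson_pmf :: "real \<Rightarrow> 'a measure \<Rightarrow> ('a \<Rightarrow> real) \<Rightarrow> nat pmf" where
  "mixed_poisson_pmf \<mu> M W =
     embed_pmf (\<lambda>j. \<integral>\<omega>. exp (- \<mu> * W \<omega>) * (\<mu> * W \<omega>) ^ j / fact j \<partial>M)"

definition tilde_pmf :: "nat pmf \<Rightarrow> nat pmf" where
  "tilde_pmf X =
     embed_pmf (\<lambda>k. real (k + 1) * pmf X (k + 1) / measure_pmf.expectation X real)"

datatype mark = LMark | RMark

fun other_mark :: "mark \<Rightarrow> mark" where
  "other_mark LMark = RMark"
| "other_mark RMark = LMark"

text \<open>Ulam--Harris labelling: individuals are finite sequences of naturals, the root is \<open>[]\<close>, the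
  children of \<open>v\<close> are \<open>v @ [k]\<close> with \<open>k\<close> smaller than the offspring number \<open>\<xi> v\<close>, and the generation
  of \<open>v\<close> is \<open>length v\<close>. In the tree whose root has mark \<open>t\<close>, even generations have mark \<open>t\<close>.\<close>

definition mark_of :: "mark \<Rightarrow> nat list \<Rightarrow> mark" where
  "mark_of t v = (if even (length v) then t else other_mark t)"

definition offspring_pmf :: "nat pmf \<Rightarrow> nat pmf \<Rightarrow> mark \<Rightarrow> nat list \<Rightarrow> nat pmf" where
  "offspring_pmf Dl Dr t v =
     (let D = (case mark_of t v of LMark \<Rightarrow> Dl | RMark \<Rightarrow> Dr)
      in if v = [] then D else tilde_pmf D)"

definition offspring_measure :: "nat pmf \<Rightarrow> nat pmf \<Rightarrow> mark \<Rightarrow> (nat list \<Rightarrow> nat) measure" where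
  "offspring_measure Dl Dr t = (\<Pi>\<^sub>M v\<in>UNIV. measure_pmf (offspring_pmf Dl Dr t v))"

inductive_set individuals :: "(nat list \<Rightarrow> nat) \<Rightarrow> nat list set" for \<xi> where
  root: "[] \<in> individuals \<xi>"
| child: "v \<in> individuals \<xi> \<Longrightarrow> k < \<xi> v \<Longrightarrow> v @ [k] \<in> individuals \<xi>"

definition bp_tree :: "(nat list \<Rightarrow> nat) \<Rightarrow> nat list mgraph" where
  "bp_tree \<xi> =
     \<lparr>vertices = individuals \<xi>,
      edge_mult = (\<lambda>u v. of_bool (u \<in> individuals \<xi> \<and> v \<in> individuals \<xi> \<and>
                                  (\<exists>k. v = u @ [k] \<or> u = v @ [k])))\<rparr>"

text \<open>Community projection of a tree whose root has mark \<open>l\<close>.\<close>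

definition cp_graph :: "(nat list \<Rightarrow> nat) \<Rightarrow> nat list mgraph" where
  "cp_graph \<xi> =
     (let V = {v \<in> individuals \<xi>. mark_of LMark v = LMark}
      in \<lparr>vertices = V,
          edge_mult = (\<lambda>u v. of_bool (u \<in> V \<and> v \<in> V \<and> u \<noteq> v \<and>
             (\<exists>c\<in>individuals \<xi>. mark_of LMark c = RMark \<and>
                (u, c) \<in> adj_rel (bp_tree \<xi>) \<and> (v, c) \<in> adj_rel (bp_tree \<xi>))))\<rparr>)"

definition gamma_pmf :: "real \<Rightarrow> mark pmf" where
  "gamma_pmf EW = map_pmf (\<lambda>b. if b then LMark else RMark) (bernoulli_pmf (1 / (1 + EW)))"

text \<open>Joint law of the mark and (the offspring numbers of) the two trees.\<close>

definition bp_gamma_measure ::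
  "real \<Rightarrow> nat pmf \<Rightarrow> nat pmf \<Rightarrow> (mark \<times> (nat list \<Rightarrow> nat) \<times> (nat list \<Rightarrow> nat)) measure" where
  "bp_gamma_measure EW Dl Dr =
     measure_pmf (gamma_pmf EW) \<Otimes>\<^sub>M
       (offspring_measure Dl Dr LMark \<Otimes>\<^sub>M offspring_measure Dl Dr RMark)"

definition bp_gamma_tree :: "mark \<times> (nat list \<Rightarrow> nat) \<times> (nat list \<Rightarrow> nat) \<Rightarrow> nat list mgraph" where
  "bp_gamma_tree = (\<lambda>(g, \<xi>l, \<xi>r). case g of LMark \<Rightarrow> bp_tree \<xi>l | RMark \<Rightarrow> bp_tree \<xi>r)"

end

theory Submission
  imports Defs "HOL-Combinatorics.Multiset_Permutations"
begin

text \<open>Apart from two moments of the number of ON groups, only lower bounds have to be proved. Fix a rooted graph \<open>H\<close> and a radius, call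
  a vertex good if the ball around it is isomorphic to \<open>H\<close> and bad otherwise, and let \<open>A\<close> and \<open>B\<close> be
  the numbers of good and of bad vertices, divided by \<open>n\<close>. Suppose that
  \<open>liminf E[A\<^sup>2] \<ge> \<alpha>\<^sup>2\<close>, \<open>liminf E[A B] \<ge> \<alpha> \<beta>\<close>, \<open>liminf E[B\<^sup>2] \<ge> \<beta>\<^sup>2\<close> and
  \<open>limsup E[(A + B)\<^sup>2] \<le> (\<alpha> + \<beta>)\<^sup>2\<close>. Then all four are limits, hence
  \<open>E[(\<beta> A - \<alpha> B)\<^sup>2]\<close> tends to \<open>0\<close>, and since \<open>A + B \<ge> 1\<close> the fraction \<open>A / (A + B)\<close> of good vertices
  tends to \<open>\<alpha> / (\<alpha> + \<beta>)\<close> in probability (\<open>ratio_convergence\<close>). The upper bound only involves the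
  number of ON groups, whose first two moments are easy (\<open>second_moment_groups\<close>). The values of
  \<open>\<alpha>\<close> and \<open>\<beta>\<close> come from the branching trees: the root is good or bad with total probability one,
  so nothing is lost in the lower bounds.

  For the lower bounds, take a finite plane tree \<open>\<xi>\<close> of depth \<open>R\<close> whose last generation has mark \<open>l\<close>,
  and label its \<open>l\<close>-individuals injectively by \<open>\<phi>\<close> with elements of \<open>[n]\<close>. An \<open>r\<close>-individual then
  stands for the group of the labels of its neighbours. The labelled tree is the ball of its root as
  soon as these groups are ON and no other ON group meets the labels of generations before \<open>R\<close>
  (\<open>bgrg_ball_iso\<close>); the balls of the community projection can be read off as well
  (\<open>drig_ball_iso\<close>). Groups are independent, and the odds of all groups through a vertex \<open>i\<close> add up
  to at most \<open>\<mu> w\<^sub>i\<close>, because \<open>k!\<close> times the \<open>k\<close>-th elementary symmetric polynomial of the weights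
  is at most the \<open>k\<close>-th power of their sum. Hence the event has probability at least the product of
  the ON probabilities times \<open>exp (- \<mu> w\<^sub>i)\<close> for every explored \<open>i\<close> (\<open>prob_realized_ge\<close>), without
  any error term. After a truncation of the weights, which is harmless for a lower bound, the sum of
  these products over all \<open>\<phi>\<close> factorizes into averages over the vertices, and those converge by weak
  convergence (\<open>embedding_probability_liminf\<close>). The limit is the probability that the branching tree
  starts with \<open>\<xi>\<close>, times the number \<open>\<Prod>\<^sub>v (\<xi> v)!\<close> of orderings of \<open>\<xi>\<close>, times the density (\<open>1\<close> or \<open>E[W]\<close>)
  of roots of the given mark (\<open>tree_weight\<close>).

  A ball that is a tree is described by one pair \<open>(\<xi>, \<phi>)\<close> for every way of ordering the children
  of its vertices. Counted with weight \<open>1 / \<Prod>\<^sub>v (\<xi> v)!\<close>, the pairs with a given root have total weight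
  at most \<open>1\<close> (\<open>embedded_count_bound\<close>), which cancels the number of orderings. Two trees
  with disjoint label sets form another family of groups to which the same bounds apply, and this
  gives the second moments (\<open>pair_roots_liminf\<close>).\<close>

section \<open>Balls in rooted multigraphs\<close>

lemma graph_dist_le_iff:
  "graph_dist G u v \<le> enat r \<longleftrightarrow> (\<exists>k\<le>r. (u, v) \<in> adj_rel G ^^ k)"
proof
  assume "graph_dist G u v \<le> enat r"
  then have "graph_dist G u v < enat (Suc r)"
    by (metis enat_ord_simps(2) lessI order_le_less_trans)
  then obtain k where "(u, v) \<in> adj_rel G ^^ k" "enat k < enat (Suc r)"
    unfolding graph_dist_def INF_less_iff by blast
  then show "\<exists>k\<le>r. (u, v) \<in> adj_rel G ^^ k" by (intro exI[of _ k]) auto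
next
  assume "\<exists>k\<le>r. (u, v) \<in> adj_rel G ^^ k"
  then obtain k where k: "k \<le> r" "(u, v) \<in> adj_rel G ^^ k" by blast
  then have "graph_dist G u v \<le> enat k"
    unfolding graph_dist_def by (intro INF_lower) auto
  then show "graph_dist G u v \<le> enat r" using k(1)
    by (meson enat_ord_simps(1) order_trans)
qed

lemma vertices_nbhd:
  "vertices (nbhd G x r) = {v \<in> vertices G. \<exists>k\<le>r. (x, v) \<in> adj_rel G ^^ k}"
  by (simp add: nbhd_def Let_def graph_dist_le_iff)

lemma edge_mult_nbhd:
  "edge_mult (nbhd G x r) u v =
     (if u \<in> vertices (nbhd G x r) \<and> v \<in> vertices (nbhd G x r) then edge_mult G u v else 0)"
  by (simp add: nbhd_def Let_def)

lemma rooted_iso_sym: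
  assumes "rooted_iso G x H y" "x \<in> vertices G" shows "rooted_iso H y G x"
proof -
  obtain f where f: "bij_betw f (vertices G) (vertices H)" "f x = y"
    "\<forall>u\<in>vertices G. \<forall>v\<in>vertices G. edge_mult H (f u) (f v) = edge_mult G u v"
    using assms unfolding rooted_iso_def by blast
  let ?g = "the_inv_into (vertices G) f"
  have inj: "inj_on f (vertices G)" using f(1) by (rule bij_betw_imp_inj_on)
  have "bij_betw ?g (vertices H) (vertices G)" using f(1) by (rule bij_betw_the_inv_into)
  moreover have "?g y = x" using the_inv_into_f_f[OF inj assms(2)] f(2) by simp
  moreover have "\<forall>u\<in>vertices H. \<forall>v\<in>vertices H. edge_mult G (?g u) (?g v) = edge_mult H u v"
  proof (intro ballI)
    fix u v assume uv: "u \<in> vertices H" "v \<in> vertices H"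
    then have "?g u \<in> vertices G" "?g v \<in> vertices G" "f (?g u) = u" "f (?g v) = v"
      using f(1) bij_betwE[OF bij_betw_the_inv_into[OF f(1)]]
      by (auto simp: f_the_inv_into_f_bij_betw)
    then show "edge_mult G (?g u) (?g v) = edge_mult H u v" using f(3) by metis
  qed
  ultimately show ?thesis unfolding rooted_iso_def by blast
qed

lemma rooted_iso_trans:
  assumes "rooted_iso G x H y" "rooted_iso H y K z" shows "rooted_iso G x K z"
proof -
  obtain f where f: "bij_betw f (vertices G) (vertices H)" "f x = y"
    "\<forall>u\<in>vertices G. \<forall>v\<in>vertices G. edge_mult H (f u) (f v) = edge_mult G u v"
    using assms(1) unfolding rooted_iso_def by blast
  obtain g where g: "bij_betw g (vertices H) (vertices K)" "g y = z"
    "\<forall>u\<in>vertices H. \<forall>v\<in>vertices H. edge_mult K (g u) (g v) = edge_mult H u v"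
    using assms(2) unfolding rooted_iso_def by blast
  have "bij_betw (g \<circ> f) (vertices G) (vertices K)" using f(1) g(1) by (rule bij_betw_trans)
  moreover have "\<forall>u\<in>vertices G. \<forall>v\<in>vertices G. edge_mult K ((g \<circ> f) u) ((g \<circ> f) v) = edge_mult G u v"
    using f(1,3) g(3) bij_betwE by fastforce
  ultimately show ?thesis using f(2) g(2) unfolding rooted_iso_def by (intro exI[of _ "g \<circ> f"]) auto
qed

lemma rooted_iso_cong:
  assumes "rooted_iso G x G' x'" "x \<in> vertices G"
  shows "rooted_iso G x H y \<longleftrightarrow> rooted_iso G' x' H y"
  using assms rooted_iso_sym rooted_iso_trans by metis

text \<open>A walk of length at most \<open>r\<close> from the root has all its vertices but the last in \<open>B0\<close>, where \<open>f\<close>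
  matches the neighbourhoods in both graphs; so walks can be transported in both directions. Edges
  from \<open>B - B0\<close> to vertices outside of \<open>B\<close> lead out of the ball, so they may differ.\<close>

lemma rooted_iso_nbhd_transfer:
  assumes y: "y \<in> B" and B: "B \<subseteq> vertices H" "f ` B \<subseteq> vertices G" and inj: "inj_on f B"
    and mult: "\<And>u v. u \<in> B \<Longrightarrow> v \<in> B \<Longrightarrow> edge_mult G (f u) (f v) = edge_mult H u v"
    and nbH: "\<And>u v. u \<in> B0 \<Longrightarrow> edge_mult H u v > 0 \<Longrightarrow> v \<in> B"
    and nbG: "\<And>u v. u \<in> B0 \<Longrightarrow> edge_mult G (f u) v > 0 \<Longrightarrow> v \<in> f ` B"
    and B0: "B0 \<subseteq> B" "\<And>k v. k < r \<Longrightarrow> (y, v) \<in> adj_rel H ^^ k \<Longrightarrow> v \<in> B0"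
  shows "rooted_iso (nbhd H y r) y (nbhd G (f y) r) (f y)"
proof -
  have 1: "v \<in> B \<and> (f y, f v) \<in> adj_rel G ^^ k" if "k \<le> r" "(y, v) \<in> adj_rel H ^^ k" for k v
    using that
  proof (induction k arbitrary: v)
    case 0 then show ?case using y by simp
  next
    case (Suc k)
    obtain u where u: "(y, u) \<in> adj_rel H ^^ k" "(u, v) \<in> adj_rel H" using Suc.prems(2) by auto
    have uB: "u \<in> B0" using B0(2)[OF _ u(1)] Suc.prems(1) by simp
    have vB: "v \<in> B" using nbH[OF uB] u(2) by (simp add: adj_rel_def)
    have "(f u, f v) \<in> adj_rel G" using u(2) mult[of u v] uB B0(1) vB by (auto simp: adj_rel_def)
    then show ?case using Suc.IH[OF _ u(1)] Suc.prems(1) vB by auto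
  qed
  have 2: "\<exists>v\<in>B. x = f v \<and> (y, v) \<in> adj_rel H ^^ k" if "k \<le> r" "(f y, x) \<in> adj_rel G ^^ k" for k x
    using that
  proof (induction k arbitrary: x)
    case 0 then show ?case using y by auto
  next
    case (Suc k)
    obtain u where u: "(f y, u) \<in> adj_rel G ^^ k" "(u, x) \<in> adj_rel G" using Suc.prems(2) by auto
    obtain u' where u': "u' \<in> B" "u = f u'" "(y, u') \<in> adj_rel H ^^ k"
      using Suc.IH[OF _ u(1)] Suc.prems(1) by auto
    have uB: "u' \<in> B0" using B0(2)[OF _ u'(3)] Suc.prems(1) by simp
    obtain v where v: "v \<in> B" "x = f v" using nbG[OF uB, of x] u(2) u'(2) by (auto simp: adj_rel_def)
    have "(u', v) \<in> adj_rel H" using u(2) mult[of u' v] u' v by (auto simp: adj_rel_def)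
    then show ?case using u'(3) v by auto
  qed
  have sub: "vertices (nbhd H y r) \<subseteq> B" using 1 by (auto simp: vertices_nbhd)
  have im: "f ` vertices (nbhd H y r) = vertices (nbhd G (f y) r)"
  proof (intro equalityI subsetI)
    fix x assume "x \<in> f ` vertices (nbhd H y r)"
    then obtain v k where "x = f v" "k \<le> r" "(y, v) \<in> adj_rel H ^^ k" by (auto simp: vertices_nbhd)
    then show "x \<in> vertices (nbhd G (f y) r)" using 1[of k v] B(2) by (auto simp: vertices_nbhd)
  next
    fix x assume "x \<in> vertices (nbhd G (f y) r)"
    then obtain k where k: "k \<le> r" "(f y, x) \<in> adj_rel G ^^ k" by (auto simp: vertices_nbhd)
    then obtain v where "v\<in>B" "x = f v" "(y, v) \<in> adj_rel H ^^ k" using 2 by blast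
    then show "x \<in> f ` vertices (nbhd H y r)" using k(1) B(1) by (auto simp: vertices_nbhd)
  qed
  have "bij_betw f (vertices (nbhd H y r)) (vertices (nbhd G (f y) r))"
    using im inj sub by (auto simp: bij_betw_def intro: inj_on_subset)
  moreover have "edge_mult (nbhd G (f y) r) (f u) (f v) = edge_mult (nbhd H y r) u v"
    if "u \<in> vertices (nbhd H y r)" "v \<in> vertices (nbhd H y r)" for u v
    using that mult[of u v] sub im by (auto simp: edge_mult_nbhd)
  ultimately show ?thesis unfolding rooted_iso_def by blast
qed

lemma root_in_nbhd: "x \<in> vertices G \<Longrightarrow> x \<in> vertices (nbhd G x r)"
  by (auto simp: vertices_nbhd intro!: exI[of _ 0])

section \<open>Individuals of a branching tree\<close>

lemma individuals_Nil [simp]: "[] \<in> individuals \<xi>"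
  by (rule individuals.root)

lemma individuals_snoc [simp]: "v @ [k] \<in> individuals \<xi> \<longleftrightarrow> v \<in> individuals \<xi> \<and> k < \<xi> v"
  by (auto elim: individuals.cases intro: individuals.child)

lemma mark_of_snoc [simp]: "mark_of t (v @ [k]) = other_mark (mark_of t v)"
  by (cases t) (auto simp: mark_of_def)

lemma mark_of_Nil [simp]: "mark_of t [] = t"
  by (simp add: mark_of_def)

lemma other_mark_eq [simp]: "other_mark m = LMark \<longleftrightarrow> m = RMark" "other_mark m = RMark \<longleftrightarrow> m = LMark"
  by (cases m; simp)+

lemma mark_neq_iff [simp]: "m \<noteq> LMark \<longleftrightarrow> m = RMark" "m \<noteq> RMark \<longleftrightarrow> m = LMark"
  by (cases m; simp)+

lemma other_mark_idem [simp]: "other_mark (other_mark m) = m" by (cases m) auto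

definition ind_upto :: "(nat list \<Rightarrow> nat) \<Rightarrow> nat \<Rightarrow> nat list set" where
  "ind_upto \<xi> R = {v \<in> individuals \<xi>. length v \<le> R}"

definition ind_below :: "(nat list \<Rightarrow> nat) \<Rightarrow> nat \<Rightarrow> nat list set" where
  "ind_below \<xi> R = {v \<in> individuals \<xi>. length v < R}"

lemma ind_upto_0: "ind_upto \<xi> 0 = {[]}" by (auto simp: ind_upto_def)

lemma ind_upto_Suc:
  "ind_upto \<xi> (Suc R) = insert [] (\<Union>v\<in>ind_upto \<xi> R. (\<lambda>k. v @ [k]) ` {..<\<xi> v})" (is "_ = ?A")
proof (intro equalityI subsetI)
  fix v assume "v \<in> ind_upto \<xi> (Suc R)"
  then show "v \<in> ?A" by (cases v rule: rev_cases) (auto simp: ind_upto_def)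
qed (auto simp: ind_upto_def)

lemma finite_ind_upto [simp, intro]: "finite (ind_upto \<xi> R)"
proof (induction R)
  case (Suc R) then show ?case by (simp add: ind_upto_Suc)
qed (simp add: ind_upto_0)

lemma ind_below_subset: "ind_below \<xi> R \<subseteq> ind_upto \<xi> R" by (auto simp: ind_below_def ind_upto_def)

lemma finite_ind_below [simp, intro]: "finite (ind_below \<xi> R)"
  using finite_subset[OF ind_below_subset] by blast

definition agree :: "nat \<Rightarrow> (nat list \<Rightarrow> nat) \<Rightarrow> (nat list \<Rightarrow> nat) \<Rightarrow> bool" where
  "agree R \<xi> \<xi>' \<longleftrightarrow> (\<forall>v\<in>ind_below \<xi> R. \<xi>' v = \<xi> v)"

lemma agree_individuals:
  assumes "agree R \<xi> \<xi>'" "length v \<le> R"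
  shows "v \<in> individuals \<xi>' \<longleftrightarrow> v \<in> individuals \<xi>"
  using assms(2)
proof (induction v rule: rev_induct)
  case (snoc k v)
  then show ?case using assms(1) by (auto simp: agree_def ind_below_def)
qed simp

lemma agree_ind_upto: "agree R \<xi> \<xi>' \<Longrightarrow> r \<le> R \<Longrightarrow> ind_upto \<xi>' r = ind_upto \<xi> r"
  using agree_individuals by (fastforce simp: ind_upto_def)

lemma agree_ind_below: "agree R \<xi> \<xi>' \<Longrightarrow> r \<le> R \<Longrightarrow> ind_below \<xi>' r = ind_below \<xi> r"
  using agree_individuals by (fastforce simp: ind_below_def)

lemma agree_sym: "agree R \<xi> \<xi>' \<Longrightarrow> agree R \<xi>' \<xi>"
  using agree_ind_below[of R \<xi> \<xi>' R] by (simp add: agree_def)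

definition tree_nbrs :: "(nat list \<Rightarrow> nat) \<Rightarrow> nat list \<Rightarrow> nat list set" where
  "tree_nbrs \<xi> v = (if v = [] then {} else {butlast v}) \<union> (\<lambda>k. v @ [k]) ` {..<\<xi> v}"

lemma in_tree_nbrs_iff:
  assumes "u \<in> individuals \<xi>"
  shows "v \<in> tree_nbrs \<xi> u \<longleftrightarrow> v \<in> individuals \<xi> \<and> (\<exists>k. v = u @ [k] \<or> u = v @ [k])"
proof -
  have "u \<noteq> [] \<and> v = butlast u \<longleftrightarrow> v \<in> individuals \<xi> \<and> (\<exists>k. u = v @ [k])"
    using assms by (cases u rule: rev_cases) auto
  moreover have "v \<in> (\<lambda>k. u @ [k]) ` {..<\<xi> u} \<longleftrightarrow> v \<in> individuals \<xi> \<and> (\<exists>k. v = u @ [k])"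
    using assms by auto
  ultimately show ?thesis by (auto simp: tree_nbrs_def)
qed

lemma tree_nbrs_cases: "v \<in> tree_nbrs \<xi> u \<Longrightarrow> (\<exists>k. u = v @ [k]) \<or> (\<exists>k. v = u @ [k])"
  by (cases u rule: rev_cases) (auto simp: tree_nbrs_def)

lemma tree_nbrs_sym: "u \<in> individuals \<xi> \<Longrightarrow> v \<in> individuals \<xi> \<Longrightarrow> v \<in> tree_nbrs \<xi> u \<longleftrightarrow> u \<in> tree_nbrs \<xi> v"
  by (auto simp: in_tree_nbrs_iff)

lemma tree_nbrs_individuals: "v \<in> tree_nbrs \<xi> u \<Longrightarrow> u \<in> individuals \<xi> \<Longrightarrow> v \<in> individuals \<xi>"
  by (simp add: in_tree_nbrs_iff)

lemma tree_nbrs_length: "v \<in> tree_nbrs \<xi> u \<Longrightarrow> length v \<le> Suc (length u) \<and> length u \<le> Suc (length v)"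
  by (auto simp: tree_nbrs_def split: if_splits)

lemma tree_nbrs_mark: "v \<in> tree_nbrs \<xi> u \<Longrightarrow> mark_of t v = other_mark (mark_of t u)"
  by (drule tree_nbrs_cases) (elim disjE exE; simp)

lemma finite_tree_nbrs [simp, intro]: "finite (tree_nbrs \<xi> v)" by (simp add: tree_nbrs_def)

lemma card_tree_nbrs: "card (tree_nbrs \<xi> v) = \<xi> v + (if v = [] then 0 else 1)"
proof -
  have i: "inj_on (\<lambda>k. v @ [k]) {..<\<xi> v}" by (auto simp: inj_on_def)
  have "butlast v \<notin> (\<lambda>k. v @ [k]) ` {..<\<xi> v}"
  proof
    assume "butlast v \<in> (\<lambda>k. v @ [k]) ` {..<\<xi> v}"
    then obtain k where "butlast v = v @ [k]" by blast
    then have "length (butlast v) = Suc (length v)" by simp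
    then show False by simp
  qed
  then show ?thesis using card_image[OF i] by (auto simp add: tree_nbrs_def)
qed

text \<open>The lengths of \<open>u\<close> and \<open>v\<close> tell whether they are siblings or a grandparent and a grandchild, and
  in both cases \<open>c\<close> is the parent of one of them. This is why different \<open>r\<close>-individuals give different
  groups and why the community projection of a tree has no multiple edges.\<close>

lemma tree_nbrs_common_unique:
  assumes "u \<in> tree_nbrs \<xi> c" "v \<in> tree_nbrs \<xi> c" "u \<in> tree_nbrs \<xi> c'" "v \<in> tree_nbrs \<xi> c'" "u \<noteq> v"
  shows "c = c'"
proof -
  have *: "butlast y = x \<and> length y = Suc (length x) \<or> butlast x = y \<and> length x = Suc (length y)"
    if "x \<in> tree_nbrs \<xi> y" for x y
    using tree_nbrs_cases[OF that] by auto
  show ?thesis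
    using *[OF assms(1)] *[OF assms(2)] *[OF assms(3)] *[OF assms(4)] assms(5)
    by (elim disjE conjE; (linarith | metis))
qed

lemma edge_mult_bp_tree: "edge_mult (bp_tree \<xi>) u v = of_bool (u \<in> individuals \<xi> \<and> v \<in> tree_nbrs \<xi> u)"
  by (auto simp: bp_tree_def in_tree_nbrs_iff)

lemma adj_bp_tree: "(u, v) \<in> adj_rel (bp_tree \<xi>) \<longleftrightarrow> u \<in> individuals \<xi> \<and> v \<in> tree_nbrs \<xi> u"
  by (simp add: adj_rel_def edge_mult_bp_tree)

lemma vertices_bp_tree [simp]: "vertices (bp_tree \<xi>) = individuals \<xi>" by (simp add: bp_tree_def)

lemma bp_tree_walk:
  "([], v) \<in> adj_rel (bp_tree \<xi>) ^^ k \<Longrightarrow> v \<in> individuals \<xi> \<and> length v \<le> k"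
proof (induction k arbitrary: v)
  case (Suc k)
  then obtain u where "([], u) \<in> adj_rel (bp_tree \<xi>) ^^ k" "(u, v) \<in> adj_rel (bp_tree \<xi>)" by auto
  then show ?case using Suc.IH[of u] tree_nbrs_length[of v \<xi> u] tree_nbrs_individuals[of v \<xi> u]
    by (auto simp: adj_bp_tree)
qed simp

lemma vertices_cp_graph: "vertices (cp_graph \<xi>) = {v \<in> individuals \<xi>. mark_of LMark v = LMark}"
  by (simp add: cp_graph_def Let_def)

lemma edge_mult_cp_graph: "edge_mult (cp_graph \<xi>) u v =
  of_bool (u \<in> individuals \<xi> \<and> mark_of LMark u = LMark \<and> v \<in> individuals \<xi> \<and> u \<noteq> v \<and>
    (\<exists>c. c \<in> tree_nbrs \<xi> u \<and> c \<in> tree_nbrs \<xi> v))"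
proof -
  have L: "mark_of LMark v = LMark" if "c \<in> tree_nbrs \<xi> u" "c \<in> tree_nbrs \<xi> v" "mark_of LMark u = LMark" for c
    using tree_nbrs_mark[OF that(1), of LMark] tree_nbrs_mark[OF that(2), of LMark] that(3) by simp
  show ?thesis
    using tree_nbrs_mark[of _ \<xi> u LMark] tree_nbrs_individuals[of _ \<xi> u] L
    by (auto simp: cp_graph_def Let_def adj_bp_tree)
qed

lemma cp_graph_step:
  assumes "edge_mult (cp_graph \<xi>) u v > 0"
  shows "length v \<le> length u + 2 \<and> v \<in> individuals \<xi> \<and> mark_of LMark v = LMark"
proof -
  obtain c where c: "c \<in> tree_nbrs \<xi> u" "c \<in> tree_nbrs \<xi> v" and "v \<in> individuals \<xi>" "mark_of LMark u = LMark"
    using assms by (auto simp: edge_mult_cp_graph)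
  then show ?thesis
    using tree_nbrs_length[OF c(1)] tree_nbrs_length[OF c(2)] tree_nbrs_mark[OF c(1), of LMark] tree_nbrs_mark[OF c(2), of LMark]
    by auto
qed

lemma cp_graph_walk:
  "([], v) \<in> adj_rel (cp_graph \<xi>) ^^ k \<Longrightarrow> v \<in> individuals \<xi> \<and> mark_of LMark v = LMark \<and> length v \<le> 2 * k"
proof (induction k arbitrary: v)
  case (Suc k)
  then obtain u where "([], u) \<in> adj_rel (cp_graph \<xi>) ^^ k" "(u, v) \<in> adj_rel (cp_graph \<xi>)" by auto
  then show ?case using Suc.IH[of u] cp_graph_step[of \<xi> u v]
    by (auto simp: adj_rel_def)
qed simp

lemma bp_tree_ball_agree:
  assumes "agree R \<xi> \<xi>'" "r \<le> R"
  shows "rooted_iso (nbhd (bp_tree \<xi>) [] r) [] (nbhd (bp_tree \<xi>') [] r) []"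
proof -
  have eq: "ind_upto \<xi>' R = ind_upto \<xi> R" using agree_ind_upto[OF assms(1)] by simp
  have nb: "tree_nbrs \<xi>' u = tree_nbrs \<xi> u" if "u \<in> ind_below \<xi> R" for u
    using that assms(1) by (simp add: agree_def tree_nbrs_def)
  have nbin: "v \<in> ind_upto \<xi> R" if "u \<in> ind_below \<xi> R" "v \<in> tree_nbrs \<xi> u" for u v
    using that tree_nbrs_length[of v \<xi> u] tree_nbrs_individuals[of v \<xi> u]
    by (auto simp: ind_upto_def ind_below_def)
  have "rooted_iso (nbhd (bp_tree \<xi>) [] r) [] (nbhd (bp_tree \<xi>') (id []) r) (id [])"
  proof (rule rooted_iso_nbhd_transfer[where B = "ind_upto \<xi> R" and ?B0.0 = "ind_below \<xi> R"])
    show "id ` ind_upto \<xi> R \<subseteq> vertices (bp_tree \<xi>')"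
      unfolding eq[symmetric] by (auto simp: ind_upto_def)
    show "edge_mult (bp_tree \<xi>') (id u) (id v) = edge_mult (bp_tree \<xi>) u v"
      if "u \<in> ind_upto \<xi> R" "v \<in> ind_upto \<xi> R" for u v
    proof -
      have "u \<in> individuals \<xi>" "v \<in> individuals \<xi>" "u \<in> individuals \<xi>'" "v \<in> individuals \<xi>'"
        using that eq by (auto simp: ind_upto_def)
      then show ?thesis by (simp add: edge_mult_bp_tree in_tree_nbrs_iff)
    qed
    show "v \<in> ind_below \<xi> R" if "k < r" "([], v) \<in> adj_rel (bp_tree \<xi>) ^^ k" for k v
      using bp_tree_walk[OF that(2)] that(1) assms(2) by (auto simp: ind_below_def)
  qed (use nb nbin ind_below_subset in \<open>auto simp: ind_upto_def edge_mult_bp_tree\<close>)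
  then show ?thesis by simp
qed

text \<open>A common neighbour of two \<open>l\<close>-individuals of generation at most \<open>2 r\<close> is in generation at most
  \<open>2 r + 1\<close>; this is the depth that the ball of radius \<open>r\<close> in the projection depends on.\<close>

lemma cp_graph_ball_agree:
  assumes "agree R \<xi> \<xi>'" "2 * r + 1 \<le> R"
  shows "rooted_iso (nbhd (cp_graph \<xi>) [] r) [] (nbhd (cp_graph \<xi>') [] r) []"
proof -
  have ind: "v \<in> individuals \<xi>' \<longleftrightarrow> v \<in> individuals \<xi>" if "length v \<le> 2 * r + 1" for v
    using agree_individuals[OF assms(1), of v] that assms(2) by simp
  define B where "B = {v \<in> individuals \<xi>. mark_of LMark v = LMark \<and> length v \<le> 2 * r}"
  define B0 where "B0 = {v \<in> individuals \<xi>. mark_of LMark v = LMark \<and> length v + 2 \<le> 2 * r}"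
  have nb: "tree_nbrs \<xi>' u = tree_nbrs \<xi> u" if "u \<in> B" for u
    using that assms by (auto simp add: agree_def tree_nbrs_def B_def ind_below_def)
  have "rooted_iso (nbhd (cp_graph \<xi>) [] r) [] (nbhd (cp_graph \<xi>') (id []) r) (id [])"
  proof (rule rooted_iso_nbhd_transfer[where B = B and ?B0.0 = B0])
    show "[] \<in> B" by (simp add: B_def)
    show "B \<subseteq> vertices (cp_graph \<xi>)" "id ` B \<subseteq> vertices (cp_graph \<xi>')" "B0 \<subseteq> B"
      by (auto simp: B_def B0_def vertices_cp_graph ind)
    show "edge_mult (cp_graph \<xi>') (id u) (id v) = edge_mult (cp_graph \<xi>) u v" if "u \<in> B" "v \<in> B" for u v
      using nb[OF that(1)] nb[OF that(2)] that by (simp add: edge_mult_cp_graph B_def ind)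
    show "v \<in> B" if "u \<in> B0" "edge_mult (cp_graph \<xi>) u v > 0" for u v
      using cp_graph_step[OF that(2)] that(1) by (auto simp: B_def B0_def)
    show "v \<in> id ` B" if "u \<in> B0" "edge_mult (cp_graph \<xi>') (id u) v > 0" for u v
      using cp_graph_step[OF that(2)] that(1) ind[of v] by (auto simp: B_def B0_def)
    show "v \<in> B0" if "k < r" "([], v) \<in> adj_rel (cp_graph \<xi>) ^^ k" for k v
      using cp_graph_walk[OF that(2)] that(1) by (auto simp: B0_def)
  qed simp
  then show ?thesis by simp
qed

section \<open>Labelled trees inside the group graph\<close>

text \<open>\<open>C\<close> indexes the required groups, \<open>m c\<close> is the set of (abstract) members of the group \<open>c\<close>, \<open>\<phi>\<close> gives
  the labels of the members, and \<open>S\<close> is the set of members whose ON groups are all prescribed. The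
  index sets are arbitrary, so that one tree and a pair of trees are both instances.\<close>

definition realized :: "nat set set \<Rightarrow> 'c set \<Rightarrow> ('c \<Rightarrow> 't set) \<Rightarrow> 't set \<Rightarrow> ('t \<Rightarrow> nat) \<Rightarrow> bool" where
  "realized A C m S \<phi> \<longleftrightarrow> (\<forall>c\<in>C. \<phi> ` m c \<in> A) \<and> (\<forall>a\<in>A. a \<inter> \<phi> ` S \<noteq> {} \<longrightarrow> a \<in> (\<lambda>c. \<phi> ` m c) ` C)"

definition lnodes :: "mark \<Rightarrow> (nat list \<Rightarrow> nat) \<Rightarrow> nat \<Rightarrow> nat list set" where
  "lnodes t \<xi> R = {v \<in> ind_upto \<xi> R. mark_of t v = LMark}"

definition rnodes :: "mark \<Rightarrow> (nat list \<Rightarrow> nat) \<Rightarrow> nat \<Rightarrow> nat list set" where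
  "rnodes t \<xi> R = {v \<in> ind_upto \<xi> R. mark_of t v = RMark}"

definition inner_lnodes :: "mark \<Rightarrow> (nat list \<Rightarrow> nat) \<Rightarrow> nat \<Rightarrow> nat list set" where
  "inner_lnodes t \<xi> R = {v \<in> lnodes t \<xi> R. length v < R}"

text \<open>By the parity condition generation \<open>R\<close> has mark \<open>l\<close>. Hence all neighbours of an \<open>r\<close>-individual
  belong to the truncated tree, and the labels of the \<open>l\<close>-individuals determine every group.\<close>

definition embedded :: "nat \<Rightarrow> nat set set \<Rightarrow> mark \<Rightarrow> (nat list \<Rightarrow> nat) \<Rightarrow> nat \<Rightarrow> (nat list \<Rightarrow> nat) \<Rightarrow> bool" where
  "embedded n A t \<xi> R \<phi> \<longleftrightarrow> A \<subseteq> groups n \<and> even R = (t = LMark) \<and>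
     (\<forall>c\<in>rnodes t \<xi> R. 2 \<le> card (tree_nbrs \<xi> c)) \<and>
     \<phi> \<in> lnodes t \<xi> R \<rightarrow>\<^sub>E {1..n} \<and> inj_on \<phi> (lnodes t \<xi> R) \<and>
     realized A (rnodes t \<xi> R) (tree_nbrs \<xi>) (inner_lnodes t \<xi> R) \<phi>"

definition node_map :: "mark \<Rightarrow> (nat list \<Rightarrow> nat) \<Rightarrow> (nat list \<Rightarrow> nat) \<Rightarrow> nat list \<Rightarrow> nat + nat set" where
  "node_map t \<xi> \<phi> v = (if mark_of t v = LMark then Inl (\<phi> v) else Inr (\<phi> ` tree_nbrs \<xi> v))"

lemma finite_nodes [simp, intro]: "finite (lnodes t \<xi> R)" "finite (rnodes t \<xi> R)" "finite (inner_lnodes t \<xi> R)"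
  by (auto simp: lnodes_def rnodes_def inner_lnodes_def)

lemma rnodes_length:
  assumes "even R = (t = LMark)" "c \<in> rnodes t \<xi> R" shows "length c < R"
proof -
  have "length c \<noteq> R" using assms by (cases t) (auto simp: rnodes_def mark_of_def)
  then show ?thesis using assms(2) by (auto simp: rnodes_def ind_upto_def)
qed

lemma tree_nbrs_rnodes:
  assumes "even R = (t = LMark)" "c \<in> rnodes t \<xi> R" shows "tree_nbrs \<xi> c \<subseteq> lnodes t \<xi> R"
proof
  fix v assume v: "v \<in> tree_nbrs \<xi> c"
  then show "v \<in> lnodes t \<xi> R"
    using rnodes_length[OF assms] tree_nbrs_length[OF v] tree_nbrs_mark[OF v, of t] tree_nbrs_individuals[OF v] assms(2)
    by (auto simp: rnodes_def lnodes_def ind_upto_def)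
qed

lemma tree_nbrs_inner_lnodes:
  assumes "v \<in> inner_lnodes t \<xi> R" shows "tree_nbrs \<xi> v \<subseteq> rnodes t \<xi> R"
proof
  fix c assume c: "c \<in> tree_nbrs \<xi> v"
  then show "c \<in> rnodes t \<xi> R"
    using tree_nbrs_length[OF c] tree_nbrs_mark[OF c, of t] tree_nbrs_individuals[OF c] assms
    by (auto simp: rnodes_def lnodes_def ind_upto_def inner_lnodes_def)
qed

text \<open>Two members of a group already determine the \<open>r\<close>-individual between them.\<close>

lemma inj_on_tree_nbrs: "inj_on (tree_nbrs \<xi>) {c. 2 \<le> card (tree_nbrs \<xi> c)}"
proof (rule inj_onI)
  fix c c' assume c: "c \<in> {c. 2 \<le> card (tree_nbrs \<xi> c)}" "tree_nbrs \<xi> c = tree_nbrs \<xi> c'"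
  then have "\<not> card (tree_nbrs \<xi> c) \<le> Suc 0" by simp
  then obtain u v where "u \<in> tree_nbrs \<xi> c" "v \<in> tree_nbrs \<xi> c" "u \<noteq> v"
    using card_le_Suc0_iff_eq[of "tree_nbrs \<xi> c"] by auto
  then show "c = c'" using tree_nbrs_common_unique c(2) by metis
qed

context
  fixes n A t \<xi> R \<phi>
  assumes emb: "embedded n A t \<xi> R \<phi>"
begin

private lemma parity: "even R = (t = LMark)" and A: "A \<subseteq> groups n"
  and inj: "inj_on \<phi> (lnodes t \<xi> R)" and card2: "\<And>c. c \<in> rnodes t \<xi> R \<Longrightarrow> 2 \<le> card (tree_nbrs \<xi> c)"
  and range: "\<And>v. v \<in> lnodes t \<xi> R \<Longrightarrow> \<phi> v \<in> {1..n}"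
  and real1: "\<And>c. c \<in> rnodes t \<xi> R \<Longrightarrow> \<phi> ` tree_nbrs \<xi> c \<in> A"
  and real2: "\<And>a v. a \<in> A \<Longrightarrow> v \<in> inner_lnodes t \<xi> R \<Longrightarrow> \<phi> v \<in> a \<Longrightarrow> \<exists>c\<in>rnodes t \<xi> R. a = \<phi> ` tree_nbrs \<xi> c"
  using emb unfolding embedded_def realized_def by blast+

lemma embedded_mem_iff:
  assumes "v \<in> lnodes t \<xi> R" "c \<in> rnodes t \<xi> R"
  shows "\<phi> v \<in> \<phi> ` tree_nbrs \<xi> c \<longleftrightarrow> v \<in> tree_nbrs \<xi> c"
  using inj_on_image_mem_iff[OF inj assms(1) tree_nbrs_rnodes[OF parity assms(2)]] .

lemma node_map_inj: "inj_on (node_map t \<xi> \<phi>) (ind_upto \<xi> R)"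
proof (rule inj_onI)
  fix u v assume uv: "u \<in> ind_upto \<xi> R" "v \<in> ind_upto \<xi> R" "node_map t \<xi> \<phi> u = node_map t \<xi> \<phi> v"
  show "u = v"
  proof (cases "mark_of t u = LMark")
    case True
    then show ?thesis using uv inj by (auto simp: node_map_def lnodes_def inj_on_def split: if_splits)
  next
    case False
    then have r: "u \<in> rnodes t \<xi> R" "v \<in> rnodes t \<xi> R" "\<phi> ` tree_nbrs \<xi> u = \<phi> ` tree_nbrs \<xi> v"
      using uv by (auto simp: node_map_def rnodes_def split: if_splits)
    then have "tree_nbrs \<xi> u = tree_nbrs \<xi> v"
      using inj_on_image_eq_iff[OF inj tree_nbrs_rnodes[OF parity r(1)] tree_nbrs_rnodes[OF parity r(2)]] by simp
    then show ?thesis using inj_on_tree_nbrs[of \<xi>] card2 r by (auto simp: inj_on_def)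
  qed
qed

lemma node_map_vertices: "node_map t \<xi> \<phi> ` ind_upto \<xi> R \<subseteq> vertices (bgrg_graph n A)"
  using range real1 by (auto simp: node_map_def bgrg_graph_def lnodes_def rnodes_def)

lemma node_map_edge_mult:
  assumes uv: "u \<in> ind_upto \<xi> R" "v \<in> ind_upto \<xi> R"
  shows "edge_mult (bgrg_graph n A) (node_map t \<xi> \<phi> u) (node_map t \<xi> \<phi> v) = edge_mult (bp_tree \<xi>) u v"
proof -
  have ind: "u \<in> individuals \<xi>" "v \<in> individuals \<xi>" using uv by (auto simp: ind_upto_def)
  consider "mark_of t u = mark_of t v" | "u \<in> lnodes t \<xi> R" "v \<in> rnodes t \<xi> R" | "u \<in> rnodes t \<xi> R" "v \<in> lnodes t \<xi> R"
    using uv by (cases "mark_of t u"; cases "mark_of t v") (auto simp: lnodes_def rnodes_def)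
  then show ?thesis
  proof cases
    case 1
    then have "v \<notin> tree_nbrs \<xi> u" using tree_nbrs_mark[of v \<xi> u t] by (cases "mark_of t u") auto
    then show ?thesis using 1 by (auto simp: edge_mult_bp_tree bgrg_graph_def node_map_def)
  next
    case 2
    then have "edge_mult (bgrg_graph n A) (node_map t \<xi> \<phi> u) (node_map t \<xi> \<phi> v) = of_bool (\<phi> u \<in> \<phi> ` tree_nbrs \<xi> v)"
      using real1[of v] by (auto simp: bgrg_graph_def node_map_def lnodes_def rnodes_def)
    then show ?thesis using embedded_mem_iff[OF 2] tree_nbrs_sym[OF ind] ind by (simp add: edge_mult_bp_tree)
  next
    case 3
    then have "edge_mult (bgrg_graph n A) (node_map t \<xi> \<phi> u) (node_map t \<xi> \<phi> v) = of_bool (\<phi> v \<in> \<phi> ` tree_nbrs \<xi> u)"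
      using real1[of u] by (auto simp: bgrg_graph_def node_map_def lnodes_def rnodes_def)
    then show ?thesis using embedded_mem_iff[OF 3(2,1)] ind by (simp add: edge_mult_bp_tree)
  qed
qed

text \<open>At an \<open>l\<close>-individual this uses that no ON group other than those of the tree contains its label;
  at an \<open>r\<close>-individual the neighbours of a group are its elements.\<close>

lemma node_map_nbrs:
  assumes u: "u \<in> ind_below \<xi> R"
  shows "{x. edge_mult (bgrg_graph n A) (node_map t \<xi> \<phi> u) x > 0} = node_map t \<xi> \<phi> ` tree_nbrs \<xi> u"
proof (cases "mark_of t u = LMark")
  case True
  then have uS: "u \<in> inner_lnodes t \<xi> R" and uT: "u \<in> lnodes t \<xi> R"
    using u by (auto simp: inner_lnodes_def lnodes_def ind_below_def ind_upto_def)
  have ui: "u \<in> individuals \<xi>" using u by (auto simp: ind_below_def)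
  have nb: "c \<in> tree_nbrs \<xi> u \<longleftrightarrow> c \<in> rnodes t \<xi> R \<and> u \<in> tree_nbrs \<xi> c" for c
    using tree_nbrs_inner_lnodes[OF uS] tree_nbrs_sym[OF ui, of c] tree_nbrs_individuals[of c \<xi> u] ui
    by (auto simp: rnodes_def ind_upto_def)
  have "{x. edge_mult (bgrg_graph n A) (node_map t \<xi> \<phi> u) x > 0} = Inr ` {a \<in> A. \<phi> u \<in> a}"
    using True by (auto simp: bgrg_graph_def node_map_def)
  also have "{a \<in> A. \<phi> u \<in> a} = (\<lambda>c. \<phi> ` tree_nbrs \<xi> c) ` tree_nbrs \<xi> u"
    using real2[OF _ uS] real1 embedded_mem_iff[OF uT] nb by blast
  also have "Inr ` \<dots> = node_map t \<xi> \<phi> ` tree_nbrs \<xi> u"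
    using tree_nbrs_mark[of _ \<xi> u t] True by (auto simp: node_map_def image_image intro!: image_cong)
  finally show ?thesis .
next
  case False
  then have uC: "u \<in> rnodes t \<xi> R"
    using u by (auto simp: rnodes_def ind_below_def ind_upto_def)
  have "{x. edge_mult (bgrg_graph n A) (node_map t \<xi> \<phi> u) x > 0} = Inl ` \<phi> ` tree_nbrs \<xi> u"
    using False real1[OF uC] by (auto simp: bgrg_graph_def node_map_def)
  also have "\<dots> = node_map t \<xi> \<phi> ` tree_nbrs \<xi> u"
    using tree_nbrs_mark[of _ \<xi> u t] False by (auto simp: node_map_def image_image intro!: image_cong)
  finally show ?thesis .
qed

lemma tree_nbrs_ind_below: "u \<in> ind_below \<xi> R \<Longrightarrow> tree_nbrs \<xi> u \<subseteq> ind_upto \<xi> R"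
  using tree_nbrs_length tree_nbrs_individuals by (fastforce simp: ind_below_def ind_upto_def)

lemma bgrg_ball_iso:
  assumes "r \<le> R"
  shows "rooted_iso (nbhd (bp_tree \<xi>) [] r) [] (nbhd (bgrg_graph n A) (node_map t \<xi> \<phi> []) r) (node_map t \<xi> \<phi> [])"
proof (rule rooted_iso_nbhd_transfer[where B = "ind_upto \<xi> R" and ?B0.0 = "ind_below \<xi> R"])
  show "v \<in> ind_below \<xi> R" if "k < r" "([], v) \<in> adj_rel (bp_tree \<xi>) ^^ k" for k v
    using bp_tree_walk[OF that(2)] that(1) assms by (auto simp: ind_below_def)
  show "v \<in> node_map t \<xi> \<phi> ` ind_upto \<xi> R"
    if "u \<in> ind_below \<xi> R" "edge_mult (bgrg_graph n A) (node_map t \<xi> \<phi> u) v > 0" for u v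
    using node_map_nbrs[OF that(1)] that(2) tree_nbrs_ind_below[OF that(1)] by blast
  show "v \<in> ind_upto \<xi> R" if "u \<in> ind_below \<xi> R" "edge_mult (bp_tree \<xi>) u v > 0" for u v
    using that tree_nbrs_ind_below[OF that(1)] by (auto simp: edge_mult_bp_tree split: if_splits)
qed (use node_map_inj node_map_vertices node_map_edge_mult ind_below_subset in
      \<open>auto simp: ind_upto_def edge_mult_bp_tree split: if_splits\<close>)

text \<open>The hypothesis \<open>2 r + 1 \<le> R\<close> puts the ball strictly before generation \<open>R\<close>. Two labels from
  generation \<open>R\<close> may have a further ON group in common, which would add an edge between them; labels
  from earlier generations cannot.\<close>

lemma drig_ball_iso:
  assumes t: "t = LMark" and R: "2 * r + 1 \<le> R"
  shows "rooted_iso (nbhd (cp_graph \<xi>) [] r) [] (nbhd (drig_graph n A) (\<phi> []) r) (\<phi> [])"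
proof -
  define B where "B = {v \<in> individuals \<xi>. mark_of LMark v = LMark \<and> length v \<le> 2 * r}"
  define B0 where "B0 = {v \<in> individuals \<xi>. mark_of LMark v = LMark \<and> length v + 2 \<le> 2 * r}"
  have BS: "B \<subseteq> inner_lnodes t \<xi> R" using R t by (auto simp: B_def inner_lnodes_def lnodes_def ind_upto_def)
  have BT: "B \<subseteq> lnodes t \<xi> R" using BS by (auto simp: inner_lnodes_def)
  have injB: "inj_on \<phi> B" using inj BT by (rule inj_on_subset)
  show ?thesis
  proof (rule rooted_iso_nbhd_transfer[where B = B and ?B0.0 = B0])
    show "[] \<in> B" by (simp add: B_def)
    show "B \<subseteq> vertices (cp_graph \<xi>)" "B0 \<subseteq> B" by (auto simp: B_def B0_def vertices_cp_graph)
    show "\<phi> ` B \<subseteq> vertices (drig_graph n A)" using range BT by (auto simp: drig_graph_def)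
    show "inj_on \<phi> B" by (rule injB)
    show "v \<in> B" if "u \<in> B0" "edge_mult (cp_graph \<xi>) u v > 0" for u v
      using cp_graph_step[OF that(2)] that(1) by (auto simp: B_def B0_def)
    show "v \<in> B0" if "k < r" "([], v) \<in> adj_rel (cp_graph \<xi>) ^^ k" for k v
      using cp_graph_walk[OF that(2)] that(1) by (auto simp: B0_def)
    show "x \<in> \<phi> ` B" if "u \<in> B0" "edge_mult (drig_graph n A) (\<phi> u) x > 0" for u x
    proof -
      have uB: "u \<in> B" using that(1) by (auto simp: B_def B0_def)
      have "card {a \<in> A. \<phi> u \<in> a \<and> x \<in> a} > 0" using that(2) by (auto simp: drig_graph_def split: if_splits)
      then have "{a \<in> A. \<phi> u \<in> a \<and> x \<in> a} \<noteq> {}" unfolding card_gt_0_iff by blast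
      then obtain a where a: "a \<in> A" "\<phi> u \<in> a" "x \<in> a" by blast
      then obtain c where c: "c \<in> rnodes t \<xi> R" "a = \<phi> ` tree_nbrs \<xi> c" using real2[of a u] uB BS by blast
      then obtain v where v: "x = \<phi> v" "v \<in> tree_nbrs \<xi> c" using a by blast
      have u: "u \<in> tree_nbrs \<xi> c" using embedded_mem_iff[of u c] c a uB BT by blast
      have "v \<in> lnodes t \<xi> R" using tree_nbrs_rnodes[OF parity c(1)] v by blast
      then have "v \<in> B" using tree_nbrs_length[OF u] tree_nbrs_length[OF v(2)] that(1) t
        by (auto simp: B_def B0_def lnodes_def ind_upto_def)
      then show ?thesis using v by blast
    qed
    show "edge_mult (drig_graph n A) (\<phi> u) (\<phi> v) = edge_mult (cp_graph \<xi>) u v" if uv: "u \<in> B" "v \<in> B" for u v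
    proof (cases "u = v")
      case True then show ?thesis by (simp add: drig_graph_def edge_mult_cp_graph)
    next
      case False
      then have ne: "\<phi> u \<noteq> \<phi> v" using injB uv by (auto simp: inj_on_def)
      have ui: "u \<in> individuals \<xi>" "v \<in> individuals \<xi>" "mark_of LMark u = LMark" using uv by (auto simp: B_def)
      let ?X = "{c \<in> rnodes t \<xi> R. u \<in> tree_nbrs \<xi> c \<and> v \<in> tree_nbrs \<xi> c}"
      have cm: "\<phi> w \<in> \<phi> ` tree_nbrs \<xi> c \<longleftrightarrow> w \<in> tree_nbrs \<xi> c" if "w \<in> B" "c \<in> rnodes t \<xi> R" for w c
        using embedded_mem_iff that BT by blast
      have Xeq: "{a \<in> A. \<phi> u \<in> a \<and> \<phi> v \<in> a} = (\<lambda>c. \<phi> ` tree_nbrs \<xi> c) ` ?X"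
      proof (intro equalityI subsetI)
        fix a assume a: "a \<in> {a \<in> A. \<phi> u \<in> a \<and> \<phi> v \<in> a}"
        then obtain c where c: "c \<in> rnodes t \<xi> R" "a = \<phi> ` tree_nbrs \<xi> c" using real2[of a u] uv BS by blast
        then have "c \<in> ?X" using a cm[OF uv(1) c(1)] cm[OF uv(2) c(1)] by simp
        then show "a \<in> (\<lambda>c. \<phi> ` tree_nbrs \<xi> c) ` ?X" using c(2) by simp
      qed (use real1 in auto)
      have ex: "(\<exists>c. c \<in> tree_nbrs \<xi> u \<and> c \<in> tree_nbrs \<xi> v) \<longleftrightarrow> ?X \<noteq> {}"
      proof
        assume "\<exists>c. c \<in> tree_nbrs \<xi> u \<and> c \<in> tree_nbrs \<xi> v"
        then obtain c where c: "c \<in> tree_nbrs \<xi> u" "c \<in> tree_nbrs \<xi> v" by blast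
        then have "c \<in> rnodes t \<xi> R" using tree_nbrs_inner_lnodes[of u t \<xi> R] uv BS by blast
        moreover have "c \<in> individuals \<xi>" using c(1) ui(1) by (rule tree_nbrs_individuals)
        ultimately show "?X \<noteq> {}" using c tree_nbrs_sym ui by blast
      next
        assume "?X \<noteq> {}"
        then obtain c where c: "c \<in> rnodes t \<xi> R" "u \<in> tree_nbrs \<xi> c" "v \<in> tree_nbrs \<xi> c" by blast
        then have "c \<in> individuals \<xi>" by (auto simp: rnodes_def ind_upto_def)
        then show "\<exists>c. c \<in> tree_nbrs \<xi> u \<and> c \<in> tree_nbrs \<xi> v" using c tree_nbrs_sym ui by blast
      qed
      have "card ((\<lambda>c. \<phi> ` tree_nbrs \<xi> c) ` ?X) = of_bool (?X \<noteq> {})"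
      proof (cases "?X = {}")
        case True then show ?thesis by simp
      next
        case False
        then obtain c where c: "c \<in> ?X" by blast
        then have "?X = {c}" using tree_nbrs_common_unique[of u \<xi> _ v] \<open>u \<noteq> v\<close> by blast
        then show ?thesis by simp
      qed
      then show ?thesis using ne False ui ex Xeq by (simp add: drig_graph_def edge_mult_cp_graph)
    qed
  qed
qed

end

section \<open>Counting embedded trees\<close>

definition orderings :: "nat \<Rightarrow> (nat list \<Rightarrow> nat) \<Rightarrow> real" where
  "orderings R \<xi> = (\<Prod>v\<in>ind_below \<xi> R. fact (\<xi> v))"

lemma orderings_pos [simp]: "orderings R \<xi> > 0" by (simp add: orderings_def prod_pos)

text \<open>The normal form among all offspring functions with the same tree up to generation \<open>R\<close>.\<close>

definition truncated :: "nat \<Rightarrow> (nat list \<Rightarrow> nat) \<Rightarrow> bool" where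
  "truncated R \<xi> \<longleftrightarrow> (\<forall>v. v \<notin> ind_below \<xi> R \<longrightarrow> \<xi> v = 0)"

definition neighbours :: "'v mgraph \<Rightarrow> 'v \<Rightarrow> 'v set" where
  "neighbours G x = {y. edge_mult G x y > 0}"

definition parent_set :: "(nat list \<Rightarrow> 'v) \<Rightarrow> nat list \<Rightarrow> 'v set" where
  "parent_set f v = (if v = [] then {} else {f (butlast v)})"

definition children_order :: "(nat list \<Rightarrow> nat) \<Rightarrow> (nat list \<Rightarrow> 'v) \<Rightarrow> nat list \<Rightarrow> 'v list" where
  "children_order \<xi> f v = map (\<lambda>k. f (v @ [k])) [0..<\<xi> v]"

text \<open>Independent uniform orderings, one for each vertex \<open>x\<close> and each set \<open>P\<close> of vertices to be left out.
  When the tree is explored from the root, \<open>P\<close> contains the vertex from which \<open>x\<close> was reached, and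
  \<open>P\<close> is empty at the root.\<close>

definition order_pmf :: "'v mgraph \<Rightarrow> ('v \<times> 'v set \<Rightarrow> 'v list) pmf" where
  "order_pmf G = Pi_pmf (vertices G \<times> Pow (vertices G)) []
     (\<lambda>(x, P). pmf_of_set (permutations_of_set (neighbours G x - P)))"

definition consistent :: "nat \<Rightarrow> (nat list \<Rightarrow> nat) \<Rightarrow> (nat list \<Rightarrow> 'v) \<Rightarrow> ('v \<times> 'v set \<Rightarrow> 'v list) set" where
  "consistent R \<xi> f = {\<sigma>. \<forall>v\<in>ind_below \<xi> R. \<sigma> (f v, parent_set f v) = children_order \<xi> f v}"

text \<open>As \<open>f\<close> is injective, different individuals ask for different entries of the random ordering, and
  the entry asked for by \<open>v\<close> is uniform among the \<open>(\<xi> v)!\<close> orderings of the images of the children.\<close>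

lemma prob_consistent:
  assumes fin: "finite (vertices G)" and inj: "inj_on f (ind_upto \<xi> R)" and V: "f ` ind_upto \<xi> R \<subseteq> vertices G"
    and nb: "\<And>v. v \<in> ind_below \<xi> R \<Longrightarrow> neighbours G (f v) = f ` tree_nbrs \<xi> v"
  shows "measure_pmf.prob (order_pmf G) (consistent R \<xi> f) = 1 / orderings R \<xi>"
proof -
  let ?D = "vertices G \<times> Pow (vertices G)"
  let ?p = "\<lambda>(x, P). pmf_of_set (permutations_of_set (neighbours G x - P))"
  let ?g = "\<lambda>v. (f v, parent_set f v)"
  define B where "B d = {l. \<forall>v\<in>ind_below \<xi> R. d = ?g v \<longrightarrow> l = children_order \<xi> f v}" for d
  have bl: "butlast v \<in> ind_upto \<xi> R" if "v \<in> ind_below \<xi> R" for v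
    using that by (cases v rule: rev_cases) (auto simp: ind_below_def ind_upto_def)
  have ch: "v @ [k] \<in> ind_upto \<xi> R" if "v \<in> ind_below \<xi> R" "k < \<xi> v" for v k
    using that by (auto simp: ind_below_def ind_upto_def)
  have injg: "inj_on ?g (ind_below \<xi> R)"
    using inj_on_subset[OF inj ind_below_subset] by (auto simp: inj_on_def)
  have gD: "?g v \<in> ?D" if "v \<in> ind_below \<xi> R" for v
    using V bl[OF that] subsetD[OF ind_below_subset that] by (auto simp: parent_set_def)
  have fD: "finite ?D" using fin by simp
  have eq: "consistent R \<xi> f = Pi ?D B"
  proof (intro equalityI subsetI)
    fix \<sigma> assume \<sigma>: "\<sigma> \<in> Pi ?D B"
    have "\<sigma> (?g v) = children_order \<xi> f v" if "v \<in> ind_below \<xi> R" for v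
      using Pi_mem[OF \<sigma> gD[OF that]] that unfolding B_def by blast
    then show "\<sigma> \<in> consistent R \<xi> f" by (simp add: consistent_def)
  qed (auto simp: consistent_def B_def)
  have single: "measure_pmf.prob (?p (?g v)) (B (?g v)) = 1 / fact (\<xi> v)" if v: "v \<in> ind_below \<xi> R" for v
  proof -
    have Bv: "B (?g v) = {children_order \<xi> f v}" using v injg by (auto simp: B_def inj_on_def)
    have ich: "inj_on (\<lambda>k. f (v @ [k])) {..<\<xi> v}"
      using inj ch[OF v] by (auto simp: inj_on_def)
    have "neighbours G (f v) - parent_set f v = (\<lambda>k. f (v @ [k])) ` {..<\<xi> v}"
    proof -
      have "f (butlast v) \<notin> (\<lambda>k. f (v @ [k])) ` {..<\<xi> v}"
      proof
        assume "f (butlast v) \<in> (\<lambda>k. f (v @ [k])) ` {..<\<xi> v}"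
        then obtain k where k: "k < \<xi> v" "f (butlast v) = f (v @ [k])" by auto
        then have "butlast v = v @ [k]" using inj bl[OF v] ch[OF v k(1)] by (auto simp: inj_on_def)
        then have "length (butlast v) = Suc (length v)" by simp
        then show False by simp
      qed
      then show ?thesis by (simp add: nb[OF v] tree_nbrs_def parent_set_def image_Un image_image)
    qed
    then have N: "finite (neighbours G (f v) - parent_set f v)" "card (neighbours G (f v) - parent_set f v) = \<xi> v"
      "set (children_order \<xi> f v) = neighbours G (f v) - parent_set f v" "distinct (children_order \<xi> f v)"
      using card_image[OF ich] ich by (auto simp: children_order_def distinct_map atLeast0LessThan)
    then have mem: "children_order \<xi> f v \<in> permutations_of_set (neighbours G (f v) - parent_set f v)"
      by (simp add: permutations_of_set_def)
    have "measure_pmf.prob (?p (?g v)) (B (?g v)) =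
        pmf (pmf_of_set (permutations_of_set (neighbours G (f v) - parent_set f v))) (children_order \<xi> f v)"
      by (simp add: Bv measure_pmf_single)
    also have "\<dots> = 1 / fact (\<xi> v)"
      using N mem by (subst pmf_of_set) (auto simp: card_permutations_of_set)
    finally show ?thesis .
  qed
  have "measure_pmf.prob (order_pmf G) (consistent R \<xi> f) = (\<Prod>d\<in>?D. measure_pmf.prob (?p d) (B d))"
    unfolding eq order_pmf_def by (rule measure_Pi_pmf_Pi[OF fD])
  also have "\<dots> = (\<Prod>d\<in>?g ` ind_below \<xi> R. measure_pmf.prob (?p d) (B d))"
  proof (rule prod.mono_neutral_right[OF fD])
    show "\<forall>d\<in>?D - ?g ` ind_below \<xi> R. measure_pmf.prob (?p d) (B d) = 1"
    proof
      fix d assume "d \<in> ?D - ?g ` ind_below \<xi> R"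
      then have "B d = UNIV" by (auto simp: B_def)
      then show "measure_pmf.prob (?p d) (B d) = 1" by simp
    qed
  qed (use gD in auto)
  also have "\<dots> = (\<Prod>v\<in>ind_below \<xi> R. 1 / fact (\<xi> v))"
    by (subst prod.reindex[OF injg]) (use single in simp)
  also have "\<dots> = 1 / orderings R \<xi>" by (simp add: orderings_def prod_dividef)
  finally show ?thesis .
qed

text \<open>Given all orderings, the exploration from the root leaves no choice.\<close>

lemma consistent_determines:
  assumes \<sigma>: "\<sigma> \<in> consistent R \<xi> f" "\<sigma> \<in> consistent R \<xi>' f'" and root: "f [] = f' []"
    and v: "v \<in> ind_upto \<xi> R"
  shows "v \<in> ind_upto \<xi>' R \<and> f v = f' v \<and> parent_set f v = parent_set f' v"
  using v
proof (induction v rule: rev_induct)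
  case Nil then show ?case using root by (simp add: ind_upto_def parent_set_def)
next
  case (snoc k v)
  then have v: "v \<in> ind_below \<xi> R" "k < \<xi> v" "v \<in> ind_upto \<xi> R"
    by (auto simp: ind_upto_def ind_below_def)
  note IH = snoc.IH[OF v(3)]
  have v': "v \<in> ind_below \<xi>' R" using IH v(1) by (auto simp: ind_upto_def ind_below_def)
  have "children_order \<xi> f v = children_order \<xi>' f' v"
    using \<sigma> v(1) v' IH by (auto simp: consistent_def)
  then have "\<xi> v = \<xi>' v" "\<And>j. j < \<xi> v \<Longrightarrow> f (v @ [j]) = f' (v @ [j])"
    by (auto simp: children_order_def list_eq_iff_nth_eq)
  then show ?case using v v' IH by (auto simp: parent_set_def ind_upto_def ind_below_def)
qed

lemma consistent_offspring:
  assumes \<sigma>: "\<sigma> \<in> consistent R \<xi> f" "\<sigma> \<in> consistent R \<xi>' f'" and root: "f [] = f' []"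
    and tr: "truncated R \<xi>" "truncated R \<xi>'"
  shows "\<xi> = \<xi>'"
proof
  fix v
  have up: "v \<in> ind_upto \<xi> R \<longleftrightarrow> v \<in> ind_upto \<xi>' R"
    using consistent_determines[OF \<sigma> root] consistent_determines[OF \<sigma>(2,1) root[symmetric]] by blast
  then have bel: "v \<in> ind_below \<xi> R \<longleftrightarrow> v \<in> ind_below \<xi>' R" by (auto simp: ind_upto_def ind_below_def)
  show "\<xi> v = \<xi>' v"
  proof (cases "v \<in> ind_below \<xi> R")
    case True
    then have "f v = f' v" "parent_set f v = parent_set f' v"
      using consistent_determines[OF \<sigma> root, of v] ind_below_subset by blast+
    then have "children_order \<xi> f v = children_order \<xi>' f' v"
      using \<sigma> True bel by (auto simp: consistent_def)
    then show ?thesis by (auto simp: children_order_def list_eq_iff_nth_eq)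
  next
    case False then show ?thesis using tr bel by (simp add: truncated_def)
  qed
qed

lemma finite_groups [simp, intro]: "finite (groups n)" by (simp add: groups_def)

lemma finite_vertices_bgrg: "A \<subseteq> groups n \<Longrightarrow> finite (vertices (bgrg_graph n A))"
  using finite_subset[OF _ finite_groups] by (auto simp: bgrg_graph_def)

lemma finite_embedded [simp, intro]: "finite {\<phi>. embedded n A t \<xi> R \<phi> \<and> P \<phi>}"
  by (rule finite_subset[of _ "lnodes t \<xi> R \<rightarrow>\<^sub>E {1..n}"]) (auto simp: embedded_def intro: finite_PiE)

lemma finite_embedded' [simp, intro]: "finite {\<phi>. embedded n A t \<xi> R \<phi>}"
  using finite_embedded[of n A t \<xi> R "\<lambda>_. True"] by simp

text \<open>Different embedded trees with the same root are consistent with disjoint sets of orderings, and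
  their weights are the probabilities of these sets.\<close>

lemma embedded_at_root_bound:
  assumes A: "A \<subseteq> groups n" and F: "finite F" "\<And>\<xi>. \<xi> \<in> F \<Longrightarrow> truncated R \<xi>"
  shows "(\<Sum>(\<xi>, \<phi>)\<in>{z \<in> (SIGMA \<xi>:F. {\<phi>. embedded n A t \<xi> R \<phi>}). node_map t (fst z) (snd z) [] = x}. 1 / orderings R \<xi>) \<le> 1"
proof -
  let ?G = "bgrg_graph n A"
  let ?Z = "{z \<in> (SIGMA \<xi>:F. {\<phi>. embedded n A t \<xi> R \<phi>}). node_map t (fst z) (snd z) [] = x}"
  let ?K = "\<lambda>(\<xi>, \<phi>). consistent R \<xi> (node_map t \<xi> \<phi>)"
  have fin: "finite ?Z" using F(1) by (intro finite_subset[OF _ finite_SigmaI[OF F(1), of "\<lambda>\<xi>. {\<phi>. embedded n A t \<xi> R \<phi>}"]]) auto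
  have disj: "disjoint_family_on ?K ?Z"
  proof (unfold disjoint_family_on_def, intro ballI impI, rule ccontr)
    fix z z' assume z: "z \<in> ?Z" "z' \<in> ?Z" "z \<noteq> z'" "?K z \<inter> ?K z' \<noteq> {}"
    obtain \<xi> \<phi> \<xi>' \<phi>' where zz: "z = (\<xi>, \<phi>)" "z' = (\<xi>', \<phi>')" by fastforce
    obtain \<sigma> where \<sigma>: "\<sigma> \<in> consistent R \<xi> (node_map t \<xi> \<phi>)" "\<sigma> \<in> consistent R \<xi>' (node_map t \<xi>' \<phi>')"
      using z(4) by (auto simp: zz)
    have root: "node_map t \<xi> \<phi> [] = node_map t \<xi>' \<phi>' []" using z by (simp add: zz)
    have tr: "truncated R \<xi>" "truncated R \<xi>'" using z(1,2) F(2) by (auto simp: zz)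
    have 1: "\<xi> = \<xi>'" by (rule consistent_offspring[OF \<sigma> root tr])
    have emb: "embedded n A t \<xi> R \<phi>" "embedded n A t \<xi> R \<phi>'" using z(1,2) 1 by (auto simp: zz)
    have "\<phi> v = \<phi>' v" if "v \<in> lnodes t \<xi> R" for v
      using consistent_determines[OF \<sigma> root, of v] that by (auto simp: lnodes_def node_map_def)
    then have "\<phi> = \<phi>'" using emb unfolding embedded_def by (metis PiE_ext)
    then show False using 1 z(3) by (simp add: zz)
  qed
  have "(\<Sum>(\<xi>, \<phi>)\<in>?Z. 1 / orderings R \<xi>) = (\<Sum>z\<in>?Z. measure_pmf.prob (order_pmf ?G) (?K z))"
  proof (rule sum.cong[OF refl], clarify)
    fix \<xi> \<phi> assume "embedded n A t \<xi> R \<phi>"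
    then show "1 / orderings R \<xi> = measure_pmf.prob (order_pmf ?G) (consistent R \<xi> (node_map t \<xi> \<phi>))"
      using node_map_nbrs node_map_inj node_map_vertices finite_vertices_bgrg[OF A]
      by (intro prob_consistent[symmetric]) (auto simp: neighbours_def)
  qed
  also have "\<dots> = measure_pmf.prob (order_pmf ?G) (\<Union>z\<in>?Z. ?K z)"
    by (rule measure_pmf.finite_measure_finite_Union[symmetric, OF fin _ disj]) auto
  also have "\<dots> \<le> 1" by simp
  finally show ?thesis .
qed

definition roots :: "mark \<Rightarrow> nat \<Rightarrow> nat set set \<Rightarrow> (nat + nat set) set" where
  "roots t n A = (case t of LMark \<Rightarrow> Inl ` {1..n} | RMark \<Rightarrow> Inr ` A)"

lemma node_map_root:
  assumes "embedded n A t \<xi> R \<phi>" shows "node_map t \<xi> \<phi> [] \<in> roots t n A"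
proof -
  have "[] \<in> ind_upto \<xi> R" by (simp add: ind_upto_def)
  then have "node_map t \<xi> \<phi> [] \<in> vertices (bgrg_graph n A)" using node_map_vertices[OF assms] by blast
  then show ?thesis by (cases t) (auto simp: node_map_def roots_def bgrg_graph_def)
qed

lemma embedded_count_bound:
  assumes A: "A \<subseteq> groups n" and F: "finite F" "\<And>\<xi>. \<xi> \<in> F \<Longrightarrow> truncated R \<xi>"
    and P: "\<And>\<xi> \<phi>. \<xi> \<in> F \<Longrightarrow> embedded n A t \<xi> R \<phi> \<Longrightarrow> P (node_map t \<xi> \<phi> [])"
  shows "(\<Sum>\<xi>\<in>F. real (card {\<phi>. embedded n A t \<xi> R \<phi>}) / orderings R \<xi>) \<le> real (card {x \<in> roots t n A. P x})"
proof -
  let ?S = "SIGMA \<xi>:F. {\<phi>. embedded n A t \<xi> R \<phi>}"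
  let ?T = "{x \<in> roots t n A. P x}"
  let ?g = "\<lambda>z. node_map t (fst z) (snd z) []"
  have fT: "finite ?T" using finite_subset[OF A] by (cases t) (auto simp: roots_def)
  have fS: "finite ?S" using F(1) by auto
  have "(\<Sum>\<xi>\<in>F. real (card {\<phi>. embedded n A t \<xi> R \<phi>}) / orderings R \<xi>) =
      (\<Sum>\<xi>\<in>F. \<Sum>\<phi>\<in>{\<phi>. embedded n A t \<xi> R \<phi>}. 1 / orderings R \<xi>)"
    by simp
  also have "\<dots> = (\<Sum>(\<xi>, \<phi>)\<in>?S. 1 / orderings R \<xi>)"
    using F(1) by (subst sum.Sigma) auto
  also have "\<dots> = (\<Sum>x\<in>?T. \<Sum>(\<xi>, \<phi>)\<in>{z \<in> ?S. ?g z = x}. 1 / orderings R \<xi>)"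
    by (rule sum.group[symmetric, OF fS fT]) (use P node_map_root in auto)
  also have "\<dots> \<le> (\<Sum>x\<in>?T. 1)"
    by (intro sum_mono embedded_at_root_bound[OF A F]) auto
  finally show ?thesis by simp
qed

section \<open>Probabilities in the static model\<close>

lemma add_power_ge:
  fixes s x :: real
  assumes "0 \<le> s" "0 \<le> x"
  shows "s ^ Suc k + real (Suc k) * x * s ^ k \<le> (s + x) ^ Suc k"
proof (induction k)
  case (Suc k)
  have "s ^ Suc (Suc k) + real (Suc (Suc k)) * x * s ^ Suc k \<le> (s + x) * (s ^ Suc k + real (Suc k) * x * s ^ k)"
    using assms by (simp add: algebra_simps)
  also have "\<dots> \<le> (s + x) * (s + x) ^ Suc k"
    using Suc assms by (intro mult_left_mono) auto
  finally show ?case by simp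
qed simp

text \<open>The expansion of the power contains every product over a \<open>k\<close>-subset \<open>k!\<close> times. In the induction,
  the subsets with and without the new element \<open>x\<close> give the two terms in \<open>add_power_ge\<close>.\<close>

lemma esym_le_power:
  fixes w :: "'i \<Rightarrow> real"
  assumes "finite X" "\<And>i. i \<in> X \<Longrightarrow> 0 \<le> w i"
  shows "fact k * (\<Sum>a\<in>{a. a \<subseteq> X \<and> card a = k}. \<Prod>i\<in>a. w i) \<le> (\<Sum>i\<in>X. w i) ^ k"
  using assms
proof (induction X arbitrary: k rule: finite_induct)
  case empty
  have "{a::'i set. a \<subseteq> {} \<and> card a = k} = (if k = 0 then {{}} else {})" by auto
  then show ?case by simp
next
  case (insert x X)
  let ?E = "\<lambda>X k. \<Sum>a\<in>{a. a \<subseteq> X \<and> card a = k}. \<Prod>i\<in>a. w i"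
  have pos: "0 \<le> w x" "\<And>i. i \<in> X \<Longrightarrow> 0 \<le> w i" using insert.prems by auto
  show ?case
  proof (cases k)
    case 0
    have "{a. a \<subseteq> insert x X \<and> card a = 0} = {{}}"
      using insert.hyps(1) finite_subset by (fastforce simp: card_eq_0_iff)
    then show ?thesis using 0 by simp
  next
    case (Suc j)
    have fin: "finite {a. a \<subseteq> X \<and> P a}" for P using insert.hyps(1) by simp
    have sets: "{a. a \<subseteq> insert x X \<and> card a = Suc j} =
        {a. a \<subseteq> X \<and> card a = Suc j} \<union> insert x ` {a. a \<subseteq> X \<and> card a = j}"
    proof (intro equalityI subsetI)
      fix a assume a: "a \<in> {a. a \<subseteq> insert x X \<and> card a = Suc j}"
      show "a \<in> {a. a \<subseteq> X \<and> card a = Suc j} \<union> insert x ` {a. a \<subseteq> X \<and> card a = j}"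
      proof (cases "x \<in> a")
        case True
        then have "a = insert x (a - {x})" "card (a - {x}) = j" using a by auto
        then show ?thesis using a by blast
      qed (use a in auto)
    next
      fix a assume "a \<in> {a. a \<subseteq> X \<and> card a = Suc j} \<union> insert x ` {a. a \<subseteq> X \<and> card a = j}"
      then show "a \<in> {a. a \<subseteq> insert x X \<and> card a = Suc j}"
        using insert.hyps finite_subset[of _ X] by (auto simp: card_insert_if)
    qed
    have inj: "inj_on (insert x) {a. a \<subseteq> X \<and> card a = j}"
      using insert.hyps(2) by (auto simp: inj_on_def)
    have "?E (insert x X) (Suc j) = ?E X (Suc j) + (\<Sum>a\<in>insert x ` {a. a \<subseteq> X \<and> card a = j}. \<Prod>i\<in>a. w i)"
      unfolding sets using insert.hyps(2) fin by (intro sum.union_disjoint) auto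
    also have "(\<Sum>a\<in>insert x ` {a. a \<subseteq> X \<and> card a = j}. \<Prod>i\<in>a. w i) =
        (\<Sum>a\<in>{a. a \<subseteq> X \<and> card a = j}. w x * (\<Prod>i\<in>a. w i))"
      by (subst sum.reindex[OF inj], rule sum.cong[OF refl])
        (use insert.hyps in \<open>auto intro!: prod.insert intro: finite_subset\<close>)
    also have "\<dots> = w x * ?E X j" by (simp add: sum_distrib_left)
    finally have "fact (Suc j) * ?E (insert x X) (Suc j) =
        fact (Suc j) * ?E X (Suc j) + real (Suc j) * w x * (fact j * ?E X j)"
      by (simp add: algebra_simps)
    also have "\<dots> \<le> (\<Sum>i\<in>X. w i) ^ Suc j + real (Suc j) * w x * (\<Sum>i\<in>X. w i) ^ j"
      by (intro add_mono mult_left_mono insert.IH mult_nonneg_nonneg) (use pos in auto)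
    also have "\<dots> \<le> ((\<Sum>i\<in>X. w i) + w x) ^ Suc j"
      using pos by (intro add_power_ge sum_nonneg) auto
    finally show ?thesis using Suc insert.hyps by (simp add: add.commute)
  qed
qed

definition odds :: "nat pmf \<Rightarrow> (nat \<Rightarrow> nat \<Rightarrow> real) \<Rightarrow> nat \<Rightarrow> nat set \<Rightarrow> real" where
  "odds p w n a = size_factor p (card a) * (\<Prod>i\<in>a. w n i) / total_weight w n ^ (card a - 1)"

context
  fixes p :: "nat pmf" and w :: "nat \<Rightarrow> nat \<Rightarrow> real" and n :: nat
  assumes w_nonneg: "\<And>i. i \<in> {1..n} \<Longrightarrow> 0 \<le> w n i"
    and tw_pos: "0 < total_weight w n"
begin

lemma odds_nonneg: "a \<subseteq> {1..n} \<Longrightarrow> 0 \<le> odds p w n a"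
  using w_nonneg tw_pos by (auto simp: odds_def size_factor_def intro!: divide_nonneg_pos mult_nonneg_nonneg prod_nonneg)

lemma on_prob_odds: "on_prob p w n a = odds p w n a / (1 + odds p w n a)"
proof -
  let ?x = "size_factor p (card a) * (\<Prod>i\<in>a. w n i)" and ?L = "total_weight w n ^ (card a - 1)"
  have L: "?L > 0" using tw_pos by simp
  have "?x / (?L + ?x) = (?x / ?L) / (1 + ?x / ?L)"
    using L tw_pos by (cases "?L + ?x = 0") (auto simp: field_simps)
  then show ?thesis by (simp add: on_prob_def odds_def)
qed

lemma on_prob_bounds:
  assumes "a \<subseteq> {1..n}"
  shows "0 \<le> on_prob p w n a" "on_prob p w n a \<le> 1" "on_prob p w n a \<le> odds p w n a"
    "exp (- odds p w n a) \<le> 1 - on_prob p w n a"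
proof -
  have o: "0 \<le> odds p w n a" by (rule odds_nonneg[OF assms])
  then show "0 \<le> on_prob p w n a" "on_prob p w n a \<le> 1" by (auto simp: on_prob_odds)
  show "on_prob p w n a \<le> odds p w n a" using o
    by (auto simp: on_prob_odds field_simps)
  have "exp (- odds p w n a) = 1 / exp (odds p w n a)" by (simp add: exp_minus field_simps)
  also have "\<dots> \<le> 1 / (1 + odds p w n a)"
    using o exp_ge_add_one_self[of "odds p w n a"] by (intro divide_left_mono) auto
  also have "\<dots> = 1 - on_prob p w n a" using o by (auto simp: on_prob_odds field_simps)
  finally show "exp (- odds p w n a) \<le> 1 - on_prob p w n a" .
qed

lemma sum_groups_by_size:
  "(\<Sum>a\<in>{a \<in> groups n. Q a}. f a) = (\<Sum>k\<in>{2..n}. \<Sum>a\<in>{a. a \<subseteq> {1..n} \<and> card a = k \<and> Q a}. f a)"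
proof -
  have "card ` {a \<in> groups n. Q a} \<subseteq> {2..n}"
    using card_mono[of "{1..n}"] by (auto simp: groups_def)
  then have "(\<Sum>a\<in>{a \<in> groups n. Q a}. f a) = (\<Sum>k\<in>{2..n}. \<Sum>a\<in>{a \<in> {a \<in> groups n. Q a}. card a = k}. f a)"
    by (intro sum.group[symmetric]) (auto simp: groups_def)
  also have "\<dots> = (\<Sum>k\<in>{2..n}. \<Sum>a\<in>{a. a \<subseteq> {1..n} \<and> card a = k \<and> Q a}. f a)"
    by (intro sum.cong) (auto simp: groups_def)
  finally show ?thesis .
qed

text \<open>Since \<open>odds\<close> dominates the ON probability, this bounds the expected number of ON groups.\<close>

lemma sum_odds_le: "(\<Sum>a\<in>groups n. odds p w n a) \<le> total_weight w n"
proof -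
  let ?L = "total_weight w n"
  have "(\<Sum>a\<in>groups n. odds p w n a) = (\<Sum>k\<in>{2..n}. \<Sum>a\<in>{a. a \<subseteq> {1..n} \<and> card a = k}. odds p w n a)"
    using sum_groups_by_size[where Q = "\<lambda>_. True" and f = "odds p w n"] by simp
  also have "\<dots> = (\<Sum>k\<in>{2..n}. pmf p k / ?L ^ (k - 1) * (fact k * (\<Sum>a\<in>{a. a \<subseteq> {1..n} \<and> card a = k}. \<Prod>i\<in>a. w n i)))"
    by (intro sum.cong refl) (simp add: sum_distrib_left odds_def size_factor_def mult_ac)
  also have "\<dots> \<le> (\<Sum>k\<in>{2..n}. pmf p k / ?L ^ (k - 1) * ?L ^ k)"
    unfolding total_weight_def using tw_pos w_nonneg
    by (intro sum_mono mult_left_mono esym_le_power) (auto simp: total_weight_def)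
  also have "\<dots> = (\<Sum>k\<in>{2..n}. pmf p k * ?L)"
  proof (intro sum.cong refl)
    fix k assume "k \<in> {2..n}"
    then obtain j where "k = Suc j" by (cases k) auto
    then show "pmf p k / ?L ^ (k - 1) * ?L ^ k = pmf p k * ?L" using tw_pos by (simp add: field_simps)
  qed
  also have "\<dots> = (\<Sum>k\<in>{2..n}. pmf p k) * ?L" by (simp add: sum_distrib_right)
  also have "\<dots> \<le> 1 * ?L"
    using tw_pos by (intro mult_right_mono) (auto simp: measure_measure_pmf_finite[symmetric])
  finally show ?thesis by simp
qed

text \<open>The groups of size \<open>k\<close> through \<open>i\<close> correspond to the subsets of size \<open>k - 1\<close> of the other vertices.
  Of the factor \<open>k!\<close> in the odds, \<open>(k - 1)!\<close> is absorbed by the elementary symmetric polynomial, and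
  the remaining \<open>k p\<^sub>k\<close> sums to \<open>\<mu>\<close>.\<close>

lemma sum_odds_at_vertex_le:
  assumes i: "i \<in> {1..n}" and sm: "summable (\<lambda>k. real k * pmf p k)"
  shows "(\<Sum>a\<in>{a \<in> groups n. i \<in> a}. odds p w n a) \<le> size_mean p * w n i"
proof -
  let ?L = "total_weight w n"
  let ?X = "{1..n} - {i}"
  have Lle: "(\<Sum>j\<in>?X. w n j) \<le> ?L"
    unfolding total_weight_def using w_nonneg by (intro sum_mono2) auto
  have L0: "0 \<le> (\<Sum>j\<in>?X. w n j)" using w_nonneg by (intro sum_nonneg) auto
  have inner: "(\<Sum>a\<in>{a. a \<subseteq> {1..n} \<and> card a = k \<and> i \<in> a}. odds p w n a) \<le> real k * pmf p k * w n i"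
    if k: "k \<in> {2..n}" for k
  proof -
    obtain j where j: "k = Suc j" using k by (cases k) auto
    have inj: "inj_on (insert i) {a. a \<subseteq> ?X \<and> card a = j}" by (auto simp: inj_on_def)
    have im: "{a. a \<subseteq> {1..n} \<and> card a = k \<and> i \<in> a} = insert i ` {a. a \<subseteq> ?X \<and> card a = j}"
    proof (intro equalityI subsetI)
      fix a assume a: "a \<in> {a. a \<subseteq> {1..n} \<and> card a = k \<and> i \<in> a}"
      then have "card (a - {i}) = j" using j by simp
      then show "a \<in> insert i ` {a. a \<subseteq> ?X \<and> card a = j}"
        using a by (intro image_eqI[of _ _ "a - {i}"]) auto
    next
      fix a assume "a \<in> insert i ` {a. a \<subseteq> ?X \<and> card a = j}"
      then obtain b where b: "a = insert i b" "b \<subseteq> ?X" "card b = j" by auto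
      then have "finite b" "i \<notin> b" using finite_subset by auto
      then show "a \<in> {a. a \<subseteq> {1..n} \<and> card a = k \<and> i \<in> a}" using b i j by auto
    qed
    have "(\<Sum>a\<in>{a. a \<subseteq> {1..n} \<and> card a = k \<and> i \<in> a}. odds p w n a) =
        (\<Sum>a\<in>{a. a \<subseteq> {1..n} \<and> card a = k \<and> i \<in> a}. size_factor p k / ?L ^ j * (\<Prod>i\<in>a. w n i))"
      by (intro sum.cong refl) (simp add: odds_def j)
    also have "\<dots> = (\<Sum>b\<in>{a. a \<subseteq> ?X \<and> card a = j}. size_factor p k / ?L ^ j * (w n i * (\<Prod>i\<in>b. w n i)))"
      unfolding im
    proof (subst sum.reindex[OF inj], rule sum.cong[OF refl])
      fix b assume "b \<in> {a. a \<subseteq> ?X \<and> card a = j}"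
      then have "finite b" "i \<notin> b" using finite_subset by auto
      then show "((\<lambda>a. size_factor p k / ?L ^ j * (\<Prod>i\<in>a. w n i)) \<circ> insert i) b =
          size_factor p k / ?L ^ j * (w n i * (\<Prod>i\<in>b. w n i))" by simp
    qed
    also have "\<dots> = real k * pmf p k * w n i / ?L ^ j * (fact j * (\<Sum>b\<in>{a. a \<subseteq> ?X \<and> card a = j}. \<Prod>i\<in>b. w n i))"
      by (simp add: sum_distrib_left size_factor_def j mult_ac)
    also have "\<dots> \<le> real k * pmf p k * w n i / ?L ^ j * (\<Sum>j\<in>?X. w n j) ^ j"
      using w_nonneg tw_pos i by (intro mult_left_mono esym_le_power divide_nonneg_pos mult_nonneg_nonneg) auto
    also have "\<dots> \<le> real k * pmf p k * w n i / ?L ^ j * ?L ^ j"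
      using w_nonneg tw_pos i Lle L0 by (intro mult_left_mono power_mono divide_nonneg_pos mult_nonneg_nonneg) auto
    also have "\<dots> = real k * pmf p k * w n i" using tw_pos by simp
    finally show ?thesis .
  qed
  have "(\<Sum>a\<in>{a \<in> groups n. i \<in> a}. odds p w n a) =
      (\<Sum>k\<in>{2..n}. \<Sum>a\<in>{a. a \<subseteq> {1..n} \<and> card a = k \<and> i \<in> a}. odds p w n a)"
    by (rule sum_groups_by_size)
  also have "\<dots> \<le> (\<Sum>k\<in>{2..n}. real k * pmf p k * w n i)" by (intro sum_mono inner)
  also have "\<dots> = (\<Sum>k\<in>{2..n}. real k * pmf p k) * w n i" by (simp add: sum_distrib_right)
  also have "\<dots> \<le> size_mean p * w n i"
    unfolding size_mean_def using w_nonneg i by (intro mult_right_mono sum_le_suminf sm) auto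
  finally show ?thesis .
qed

lemma prob_bernoulli_on:
  assumes "a \<in> groups n"
  shows "measure_pmf.prob (bernoulli_pmf (on_prob p w n a)) {True} = on_prob p w n a"
    "measure_pmf.prob (bernoulli_pmf (on_prob p w n a)) {False} = 1 - on_prob p w n a"
  using on_prob_bounds[of a] assms by (auto simp: groups_def measure_pmf_single)

text \<open>The probability is a product over all groups. A group outside of the tree that meets \<open>\<phi> ` S\<close> has to
  be OFF, which has probability at least \<open>exp (- odds)\<close>. Charging its odds to every element of
  \<open>S\<close> whose label it contains (possibly several times) only lowers the bound, and the charges to a
  single vertex add up to at most \<open>\<mu>\<close> times its weight.\<close>

lemma prob_realized_ge:
  assumes sm: "summable (\<lambda>k. real k * pmf p k)" and fin: "finite C" "finite S"
    and grp: "\<And>c. c \<in> C \<Longrightarrow> \<phi> ` m c \<in> groups n" and inj: "inj_on (\<lambda>c. \<phi> ` m c) C"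
    and S: "\<And>s. s \<in> S \<Longrightarrow> \<phi> s \<in> {1..n}"
  shows "(\<Prod>c\<in>C. on_prob p w n (\<phi> ` m c)) * exp (- size_mean p * (\<Sum>s\<in>S. w n (\<phi> s)))
    \<le> measure_pmf.prob (on_groups_pmf p w n) {A. realized A C m S \<phi>}"
proof -
  define Z where "Z = (\<lambda>c. \<phi> ` m c) ` C"
  have Z: "Z \<subseteq> groups n" using grp by (auto simp: Z_def)
  define B where "B a = (if a \<in> Z then {True} else if a \<inter> \<phi> ` S \<noteq> {} then {False} else UNIV)" for a
  let ?P = "Pi_pmf (groups n) False (\<lambda>a. bernoulli_pmf (on_prob p w n a))"
  define g where "g a = (if a \<in> Z then on_prob p w n a else 1)" for a
  define h where "h a = exp (- (\<Sum>s\<in>S. if \<phi> s \<in> a then odds p w n a else 0))" for a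
  (* g collects the ON probabilities of the prescribed groups, h the charges of all groups. *)
  have gh: "g a * h a \<le> measure_pmf.prob (bernoulli_pmf (on_prob p w n a)) (B a)" if a: "a \<in> groups n" for a
  proof -
    have a': "a \<subseteq> {1..n}" using a by (simp add: groups_def)
    have o: "0 \<le> odds p w n a" by (rule odds_nonneg[OF a'])
    have h1: "h a \<le> 1" using o by (auto simp: h_def intro!: sum_nonneg)
    consider "a \<in> Z" | "a \<notin> Z" "a \<inter> \<phi> ` S \<noteq> {}" | "a \<notin> Z" "a \<inter> \<phi> ` S = {}" by blast
    then show ?thesis
    proof cases
      case 1
      then show ?thesis using h1 on_prob_bounds[OF a'] prob_bernoulli_on(1)[OF a]
        by (simp add: g_def B_def mult_left_le)
    next
      case 2
      then obtain s where s: "s \<in> S" "\<phi> s \<in> a" by blast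
      have "odds p w n a = (\<Sum>s\<in>{s}. if \<phi> s \<in> a then odds p w n a else 0)" using s by simp
      also have "\<dots> \<le> (\<Sum>s\<in>S. if \<phi> s \<in> a then odds p w n a else 0)"
        using s o fin by (intro sum_mono2) auto
      finally have "h a \<le> exp (- odds p w n a)" by (simp add: h_def)
      then show ?thesis using 2 on_prob_bounds(4)[OF a'] prob_bernoulli_on(2)[OF a] by (simp add: g_def B_def)
    next
      case 3
      then show ?thesis using h1 by (simp add: g_def B_def)
    qed
  qed
  have "(\<Prod>c\<in>C. on_prob p w n (\<phi> ` m c)) = (\<Prod>a\<in>Z. on_prob p w n a)"
    unfolding Z_def by (simp add: prod.reindex[OF inj])
  also have "\<dots> = (\<Prod>a\<in>groups n. g a)"
    using Z by (intro prod.mono_neutral_cong_left) (auto simp: g_def groups_def)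
  finally have G: "(\<Prod>c\<in>C. on_prob p w n (\<phi> ` m c)) = (\<Prod>a\<in>groups n. g a)" .
  have "(\<Sum>a\<in>groups n. \<Sum>s\<in>S. if \<phi> s \<in> a then odds p w n a else 0) =
      (\<Sum>s\<in>S. \<Sum>a\<in>{a \<in> groups n. \<phi> s \<in> a}. odds p w n a)"
    by (subst sum.swap, rule sum.cong[OF refl], rule sum.inter_filter[symmetric]) (simp add: groups_def)
  also have "\<dots> \<le> (\<Sum>s\<in>S. size_mean p * w n (\<phi> s))"
    by (intro sum_mono sum_odds_at_vertex_le[OF S sm])
  finally have "(\<Sum>a\<in>groups n. \<Sum>s\<in>S. if \<phi> s \<in> a then odds p w n a else 0) \<le> size_mean p * (\<Sum>s\<in>S. w n (\<phi> s))"
    by (simp only: sum_distrib_left)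
  then have "exp (- size_mean p * (\<Sum>s\<in>S. w n (\<phi> s))) \<le> exp (- (\<Sum>a\<in>groups n. \<Sum>s\<in>S. if \<phi> s \<in> a then odds p w n a else 0))"
    by simp
  also have "\<dots> = (\<Prod>a\<in>groups n. h a)"
    unfolding h_def by (subst exp_sum[symmetric]) (auto simp: groups_def sum_negf)
  finally have H: "exp (- size_mean p * (\<Sum>s\<in>S. w n (\<phi> s))) \<le> (\<Prod>a\<in>groups n. h a)" .
  have gpos: "0 \<le> (\<Prod>a\<in>groups n. g a)"
    using on_prob_bounds(1) by (intro prod_nonneg) (auto simp: g_def groups_def)
  have "(\<Prod>c\<in>C. on_prob p w n (\<phi> ` m c)) * exp (- size_mean p * (\<Sum>s\<in>S. w n (\<phi> s)))
      \<le> (\<Prod>a\<in>groups n. g a) * (\<Prod>a\<in>groups n. h a)"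
    unfolding G by (intro mult_left_mono H gpos)
  also have "\<dots> = (\<Prod>a\<in>groups n. g a * h a)" by (simp add: prod.distrib)
  also have "\<dots> \<le> (\<Prod>a\<in>groups n. measure_pmf.prob (bernoulli_pmf (on_prob p w n a)) (B a))"
    using gh on_prob_bounds(1) by (intro prod_mono) (auto simp: g_def h_def groups_def)
  also have "\<dots> = measure_pmf.prob ?P (Pi (groups n) B)"
    by (rule measure_Pi_pmf_Pi[symmetric]) (simp add: groups_def)
  also have "\<dots> \<le> measure_pmf.prob ?P {s. realized {a \<in> groups n. s a} C m S \<phi>}"
  proof (intro measure_pmf.finite_measure_mono subsetI CollectI)
    fix s assume s: "s \<in> Pi (groups n) B"
    have "s a" if "a \<in> Z" for a using s that Z by (auto simp: B_def Pi_def)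
    moreover have "a \<in> Z" if "a \<in> groups n" "s a" "a \<inter> \<phi> ` S \<noteq> {}" for a
      using s that by (auto simp: B_def Pi_def split: if_splits)
    ultimately show "realized {a \<in> groups n. s a} C m S \<phi>"
      using Z unfolding realized_def Z_def by blast
  qed simp
  also have "\<dots> = measure_pmf.prob (on_groups_pmf p w n) {A. realized A C m S \<phi>}"
    by (simp add: on_groups_pmf_def vimage_def)
  finally show ?thesis .
qed

lemma prob_groups_on:
  assumes Z: "Z \<subseteq> groups n"
  shows "measure_pmf.prob (on_groups_pmf p w n) {A. Z \<subseteq> A} = (\<Prod>a\<in>Z. on_prob p w n a)"
proof -
  let ?P = "Pi_pmf (groups n) False (\<lambda>a. bernoulli_pmf (on_prob p w n a))"
  let ?B = "\<lambda>a. if a \<in> Z then {True} else UNIV"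
  have "measure_pmf.prob (on_groups_pmf p w n) {A. Z \<subseteq> A} = measure_pmf.prob ?P (Pi (groups n) ?B)"
    unfolding on_groups_pmf_def using Z
    by (auto simp: vimage_def Pi_def intro!: arg_cong[where f = "measure_pmf.prob ?P"] split: if_splits)
  also have "\<dots> = (\<Prod>a\<in>groups n. measure_pmf.prob (bernoulli_pmf (on_prob p w n a)) (?B a))"
    by (rule measure_Pi_pmf_Pi) (simp add: groups_def)
  also have "\<dots> = (\<Prod>a\<in>Z. on_prob p w n a)"
    using Z prob_bernoulli_on(1) by (intro prod.mono_neutral_cong_right) (auto simp: groups_def)
  finally show ?thesis .
qed

end

lemma on_groups_subset: "A \<in> set_pmf (on_groups_pmf p w n) \<Longrightarrow> A \<subseteq> groups n"
  by (auto simp: on_groups_pmf_def)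

lemma finite_set_on_groups: "finite (set_pmf (on_groups_pmf p w n))"
proof (rule finite_subset)
  show "set_pmf (on_groups_pmf p w n) \<subseteq> Pow (groups n)" using on_groups_subset by blast
qed (simp add: groups_def)

lemma integrable_on_groups [simp, intro]:
  fixes f :: "nat set set \<Rightarrow> real" shows "integrable (measure_pmf (on_groups_pmf p w n)) f"
  by (rule integrable_measure_pmf_finite[OF finite_set_on_groups])

lemma expectation_of_bool: "measure_pmf.expectation q (\<lambda>x. of_bool (P x) :: real) = measure_pmf.prob q {x. P x}"
proof -
  have "(\<lambda>x. of_bool (P x) :: real) = indicator {x. P x}" by (auto simp: fun_eq_iff)
  then show ?thesis by simp
qed

lemma card_on_groups:
  assumes "A \<subseteq> groups n" shows "real (card A) = (\<Sum>a\<in>groups n. of_bool (a \<in> A))"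
  using assms by (subst sum_of_bool_eq) (auto simp: groups_def Int_absorb1 Collect_conj_eq Int_def[symmetric] intro!: arg_cong[where f = card])

text \<open>Distinct groups are independent, so the second moment differs from the square of the first by at
  most the first moment.\<close>

lemma second_moment_groups:
  assumes w: "\<And>i. i \<in> {1..n} \<Longrightarrow> 0 \<le> w n i" and tw: "0 < total_weight w n"
  shows "measure_pmf.expectation (on_groups_pmf p w n) (\<lambda>A. real (card A)) \<le> total_weight w n"
    "measure_pmf.expectation (on_groups_pmf p w n) (\<lambda>A. (real (card A))\<^sup>2) \<le> (total_weight w n)\<^sup>2 + total_weight w n"
proof -
  let ?q = "on_groups_pmf p w n" and ?L = "total_weight w n" and ?\<pi> = "on_prob p w n"
  have pi: "?\<pi> a \<ge> 0" "?\<pi> a \<le> odds p w n a" if "a \<in> groups n" for a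
    using on_prob_bounds[where p=p and w=w, OF w tw, of a] that by (auto simp: groups_def)
  have sum\<pi>: "(\<Sum>a\<in>groups n. ?\<pi> a) \<le> ?L" "0 \<le> (\<Sum>a\<in>groups n. ?\<pi> a)"
    using sum_mono[of "groups n" ?\<pi> "odds p w n"] pi sum_odds_le[where p=p and w=w, OF w tw]
    by (force intro: sum_nonneg)+
  have one: "measure_pmf.prob ?q {A. a \<in> A} = ?\<pi> a" if "a \<in> groups n" for a
    using prob_groups_on[where p=p and w=w, OF w tw, of "{a}"] that by simp
  have "measure_pmf.expectation ?q (\<lambda>A. real (card A)) = measure_pmf.expectation ?q (\<lambda>A. \<Sum>a\<in>groups n. of_bool (a \<in> A))"
    by (intro integral_cong_AE AE_pmfI card_on_groups on_groups_subset) auto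
  also have "\<dots> = (\<Sum>a\<in>groups n. ?\<pi> a)"
    by (subst Bochner_Integration.integral_sum) (auto simp: expectation_of_bool one intro!: sum.cong)
  finally show "measure_pmf.expectation ?q (\<lambda>A. real (card A)) \<le> ?L" using sum\<pi> by simp
  have two: "measure_pmf.prob ?q {A. a \<in> A \<and> b \<in> A} \<le> ?\<pi> a * ?\<pi> b + (if a = b then ?\<pi> a else 0)"
    if "a \<in> groups n" "b \<in> groups n" for a b
  proof (cases "a = b")
    case True then show ?thesis using one that by simp
  next
    case False
    then show ?thesis using prob_groups_on[where p=p and w=w, OF w tw, of "{a, b}"] that by simp
  qed
  have "measure_pmf.expectation ?q (\<lambda>A. (real (card A))\<^sup>2) =
      measure_pmf.expectation ?q (\<lambda>A. \<Sum>a\<in>groups n. \<Sum>b\<in>groups n. of_bool (a \<in> A \<and> b \<in> A))"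
  proof (intro integral_cong_AE AE_pmfI)
    fix A assume "A \<in> set_pmf ?q"
    then have "real (card A) = (\<Sum>a\<in>groups n. of_bool (a \<in> A))" by (intro card_on_groups on_groups_subset)
    then show "(real (card A))\<^sup>2 = (\<Sum>a\<in>groups n. \<Sum>b\<in>groups n. of_bool (a \<in> A \<and> b \<in> A))"
      by (simp add: power2_eq_square sum_product of_bool_conj del: sum_of_bool_eq)
  qed auto
  also have "\<dots> = (\<Sum>a\<in>groups n. \<Sum>b\<in>groups n. measure_pmf.prob ?q {A. a \<in> A \<and> b \<in> A})"
    by (simp add: Bochner_Integration.integral_sum expectation_of_bool del: sum_of_bool_eq)
  also have "\<dots> \<le> (\<Sum>a\<in>groups n. \<Sum>b\<in>groups n. ?\<pi> a * ?\<pi> b + (if a = b then ?\<pi> a else 0))"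
    by (intro sum_mono two)
  also have "\<dots> = (\<Sum>a\<in>groups n. ?\<pi> a)\<^sup>2 + (\<Sum>a\<in>groups n. ?\<pi> a)"
    by (simp add: sum.distrib power2_eq_square sum_product groups_def)
  also have "\<dots> \<le> ?L\<^sup>2 + ?L" using sum\<pi> by (intro add_mono power_mono) auto
  finally show "measure_pmf.expectation ?q (\<lambda>A. (real (card A))\<^sup>2) \<le> ?L\<^sup>2 + ?L" .
qed

section \<open>Asymptotics of weighted embedding counts\<close>

lemma card_collision_le:
  assumes T: "finite T" "s \<in> T" "t \<in> T" "s \<noteq> t" and X: "finite X"
  shows "card {\<phi> \<in> T \<rightarrow>\<^sub>E X. \<phi> s = \<phi> t} \<le> card X ^ (card T - 1)"
proof -
  let ?r = "\<lambda>\<phi>. restrict \<phi> (T - {t})"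
  have "inj_on ?r {\<phi> \<in> T \<rightarrow>\<^sub>E X. \<phi> s = \<phi> t}"
  proof (rule inj_onI)
    fix \<phi> \<psi> assume a: "\<phi> \<in> {\<phi> \<in> T \<rightarrow>\<^sub>E X. \<phi> s = \<phi> t}" "\<psi> \<in> {\<phi> \<in> T \<rightarrow>\<^sub>E X. \<phi> s = \<phi> t}" "?r \<phi> = ?r \<psi>"
    have eq: "\<phi> v = \<psi> v" if "v \<in> T - {t}" for v using fun_cong[OF a(3), of v] that by simp
    have "\<phi> v = \<psi> v" if "v \<in> T" for v
      using eq[of v] eq[of s] a T that by (cases "v = t") auto
    then show "\<phi> = \<psi>" using a(1,2) by (auto intro: PiE_ext)
  qed
  moreover have "?r ` {\<phi> \<in> T \<rightarrow>\<^sub>E X. \<phi> s = \<phi> t} \<subseteq> (T - {t}) \<rightarrow>\<^sub>E X" by (auto simp: PiE_iff extensional_def split: if_splits)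
  ultimately have "card {\<phi> \<in> T \<rightarrow>\<^sub>E X. \<phi> s = \<phi> t} \<le> card ((T - {t}) \<rightarrow>\<^sub>E X)"
    using T X by (intro card_inj_on_le) (auto intro: finite_PiE)
  also have "\<dots> = card X ^ (card T - 1)" using T by (simp add: card_PiE)
  finally show ?thesis .
qed

lemma card_noninj_le:
  assumes T: "finite T" and X: "finite X"
  shows "card {\<phi> \<in> T \<rightarrow>\<^sub>E X. \<not> inj_on \<phi> T} \<le> (card T)\<^sup>2 * card X ^ (card T - 1)"
proof -
  let ?Z = "{z \<in> T \<times> T. fst z \<noteq> snd z}"
  have fZ: "finite ?Z" using T by simp
  have "{\<phi> \<in> T \<rightarrow>\<^sub>E X. \<not> inj_on \<phi> T} \<subseteq> (\<Union>z\<in>?Z. {\<phi> \<in> T \<rightarrow>\<^sub>E X. \<phi> (fst z) = \<phi> (snd z)})"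
    by (fastforce simp: inj_on_def)
  then have "card {\<phi> \<in> T \<rightarrow>\<^sub>E X. \<not> inj_on \<phi> T} \<le> card (\<Union>z\<in>?Z. {\<phi> \<in> T \<rightarrow>\<^sub>E X. \<phi> (fst z) = \<phi> (snd z)})"
    using T X fZ by (intro card_mono) (auto intro!: finite_PiE)
  also have "\<dots> \<le> (\<Sum>z\<in>?Z. card {\<phi> \<in> T \<rightarrow>\<^sub>E X. \<phi> (fst z) = \<phi> (snd z)})"
    by (rule card_UN_le[OF fZ])
  also have "\<dots> \<le> (\<Sum>z\<in>?Z. card X ^ (card T - 1))"
    using T X by (intro sum_mono card_collision_le) auto
  also have "\<dots> = card ?Z * card X ^ (card T - 1)" by simp
  also have "\<dots> \<le> (card T)\<^sup>2 * card X ^ (card T - 1)"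
    using card_mono[of "T \<times> T" ?Z] T by (intro mult_right_mono) (auto simp: card_cartesian_product power2_eq_square)
  finally show ?thesis .
qed

text \<open>Without injectivity the sum factorizes; the labellings with a collision are fewer by a factor of
  the order of \<open>card X\<close>, and each summand is bounded by the product of the \<open>b t\<close>.\<close>

lemma injective_sum_ge:
  fixes g :: "'t \<Rightarrow> 'i \<Rightarrow> real"
  assumes T: "finite T" and X: "finite X"
    and g: "\<And>t i. t \<in> T \<Longrightarrow> i \<in> X \<Longrightarrow> 0 \<le> g t i" "\<And>t i. t \<in> T \<Longrightarrow> i \<in> X \<Longrightarrow> g t i \<le> b t"
    and b: "\<And>t. t \<in> T \<Longrightarrow> 0 \<le> b t"
  shows "(\<Prod>t\<in>T. \<Sum>i\<in>X. g t i) - (real (card T))\<^sup>2 * real (card X) ^ (card T - 1) * (\<Prod>t\<in>T. b t)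
    \<le> (\<Sum>\<phi>\<in>{\<phi> \<in> T \<rightarrow>\<^sub>E X. inj_on \<phi> T}. \<Prod>t\<in>T. g t (\<phi> t))"
proof -
  let ?I = "{\<phi> \<in> T \<rightarrow>\<^sub>E X. inj_on \<phi> T}" and ?N = "{\<phi> \<in> T \<rightarrow>\<^sub>E X. \<not> inj_on \<phi> T}"
  have fin: "finite (T \<rightarrow>\<^sub>E X)" using T X by (intro finite_PiE) auto
  have "(\<Prod>t\<in>T. \<Sum>i\<in>X. g t i) = (\<Sum>\<phi>\<in>T \<rightarrow>\<^sub>E X. \<Prod>t\<in>T. g t (\<phi> t))"
    using T X by (intro prod_sum_PiE) auto
  also have "T \<rightarrow>\<^sub>E X = ?I \<union> ?N" by auto
  also have "(\<Sum>\<phi>\<in>?I \<union> ?N. \<Prod>t\<in>T. g t (\<phi> t)) = (\<Sum>\<phi>\<in>?I. \<Prod>t\<in>T. g t (\<phi> t)) + (\<Sum>\<phi>\<in>?N. \<Prod>t\<in>T. g t (\<phi> t))"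
    using fin by (intro sum.union_disjoint) auto
  finally have 1: "(\<Prod>t\<in>T. \<Sum>i\<in>X. g t i) = (\<Sum>\<phi>\<in>?I. \<Prod>t\<in>T. g t (\<phi> t)) + (\<Sum>\<phi>\<in>?N. \<Prod>t\<in>T. g t (\<phi> t))" .
  have "(\<Sum>\<phi>\<in>?N. \<Prod>t\<in>T. g t (\<phi> t)) \<le> (\<Sum>\<phi>\<in>?N. \<Prod>t\<in>T. b t)"
    using g by (intro sum_mono prod_mono) (auto dest: PiE_mem)
  also have "\<dots> = real (card ?N) * (\<Prod>t\<in>T. b t)" by simp
  also have "\<dots> \<le> real ((card T)\<^sup>2 * card X ^ (card T - 1)) * (\<Prod>t\<in>T. b t)"
    using card_noninj_le[OF T X] b by (intro mult_right_mono prod_nonneg) (auto simp del: of_nat_mult of_nat_power)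
  finally show ?thesis using 1 by simp
qed

text \<open>A continuous truncation, so that weak convergence applies to the truncated functions.\<close>

definition cutoff :: "nat \<Rightarrow> real \<Rightarrow> real" where
  "cutoff K x = max 0 (min 1 (real K + 1 - x))"

text \<open>The contribution of an \<open>l\<close>-individual of weight \<open>x\<close> that is a member of \<open>d\<close> groups: one factor \<open>x\<close>
  for each group, and the exponential if all its groups are prescribed. Taking \<open>max 0 x\<close> gives a
  continuous and nonnegative function on the whole real line.\<close>

definition vertex_factor :: "real \<Rightarrow> nat \<Rightarrow> bool \<Rightarrow> real \<Rightarrow> real" where
  "vertex_factor \<mu> d s x = (max 0 x) ^ d * (if s then exp (- \<mu> * max 0 x) else 1)"

lemma cutoff_bounds [simp]: "0 \<le> cutoff K x" "cutoff K x \<le> 1" by (auto simp: cutoff_def)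

lemma vertex_factor_nonneg [simp]: "0 \<le> vertex_factor \<mu> d s x" by (simp add: vertex_factor_def)

lemma vertex_factor_cutoff_le:
  assumes "0 \<le> \<mu>" shows "vertex_factor \<mu> d s x * cutoff K x \<le> (real K + 1) ^ d"
proof (cases "x \<le> real K + 1")
  case True
  have "vertex_factor \<mu> d s x \<le> (real K + 1) ^ d * 1"
    unfolding vertex_factor_def using True assms by (intro mult_mono power_mono) auto
  then have "vertex_factor \<mu> d s x * cutoff K x \<le> (real K + 1) ^ d * 1"
    by (intro mult_mono) auto
  then show ?thesis by simp
qed (simp add: cutoff_def)

lemma isCont_vertex_factor_cutoff: "isCont (\<lambda>x. vertex_factor \<mu> d s x * cutoff K x) x"
proof -
  have "continuous_on UNIV (\<lambda>x. vertex_factor \<mu> d s x * cutoff K x)"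
    unfolding vertex_factor_def cutoff_def by (cases s) (auto intro!: continuous_intros)
  then show ?thesis by (simp add: continuous_on_eq_continuous_at)
qed

lemma prod_group_members:
  fixes x :: "'t \<Rightarrow> real"
  assumes "finite T" "finite C" "\<And>c. c \<in> C \<Longrightarrow> m c \<subseteq> T"
  shows "(\<Prod>c\<in>C. \<Prod>t\<in>m c. x t) = (\<Prod>t\<in>T. x t ^ card {c \<in> C. t \<in> m c})"
proof -
  have "(\<Prod>c\<in>C. \<Prod>t\<in>m c. x t) = (\<Prod>c\<in>C. \<Prod>t\<in>T. if t \<in> m c then x t else 1)"
    using assms by (intro prod.cong refl prod.mono_neutral_cong_left) auto
  also have "\<dots> = (\<Prod>t\<in>T. \<Prod>c\<in>C. if t \<in> m c then x t else 1)" by (rule prod.swap)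
  also have "\<dots> = (\<Prod>t\<in>T. x t ^ card {c \<in> C. t \<in> m c})"
  proof (intro prod.cong refl)
    fix t
    show "(\<Prod>c\<in>C. if t \<in> m c then x t else 1) = x t ^ card {c \<in> C. t \<in> m c}"
      by (simp add: prod.inter_filter[OF assms(2), symmetric])
  qed
  finally show ?thesis .
qed

text \<open>On the support of the cutoff all weights are at most \<open>K + 1\<close>, so every prescribed group has odds at
  most \<open>b\<close> divided by the total weight, and its ON probability is the odds up to a factor close to
  \<open>1\<close>. The odds then distribute over the members.\<close>

lemma prob_realized_ge_factors:
  fixes C :: "'c set" and m :: "'c \<Rightarrow> 't set" and K n :: nat and p w
  defines "deg \<equiv> \<lambda>t. card {c \<in> C. t \<in> m c}"
  defines "b \<equiv> (\<Sum>c\<in>C. size_factor p (card (m c)) * (real K + 1) ^ card (m c))"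
  assumes w: "\<And>i. i \<in> {1..n} \<Longrightarrow> 0 \<le> w n i" and tw: "1 \<le> total_weight w n"
    and sm: "summable (\<lambda>k. real k * pmf p k)"
    and T: "finite T" and C: "finite C" and mT: "\<And>c. c \<in> C \<Longrightarrow> m c \<subseteq> T" and m2: "\<And>c. c \<in> C \<Longrightarrow> 2 \<le> card (m c)"
    and minj: "inj_on m C" and S: "S \<subseteq> T" and \<phi>: "\<phi> \<in> T \<rightarrow>\<^sub>E {1..n}" and inj: "inj_on \<phi> T"
  shows "(1 / (1 + b / total_weight w n)) ^ card C * (\<Prod>c\<in>C. size_factor p (card (m c))) /
      total_weight w n ^ (\<Sum>c\<in>C. card (m c) - 1) *
      (\<Prod>t\<in>T. vertex_factor (size_mean p) (deg t) (t \<in> S) (w n (\<phi> t)) * cutoff K (w n (\<phi> t)))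
    \<le> measure_pmf.prob (on_groups_pmf p w n) {A. realized A C m S \<phi>}" (is "?L * ?V \<le> ?P")
proof (cases "\<exists>t\<in>T. real K + 1 < w n (\<phi> t)")
  case True
  then obtain t where "t \<in> T" "cutoff K (w n (\<phi> t)) = 0" by (auto simp: cutoff_def)
  then have "?V = 0" using T by (intro prod_zero) auto
  then show ?thesis by simp
next
  case False
  let ?tw = "total_weight w n"
  let ?x = "\<lambda>t. w n (\<phi> t)"
  have x: "0 \<le> ?x t" "?x t \<le> real K + 1" "\<phi> t \<in> {1..n}" if "t \<in> T" for t
    using that w \<phi> False by (auto simp: PiE_iff not_less)
  have tw0: "0 < ?tw" using tw by simp
  have sf0: "0 \<le> size_factor p k" for k by (simp add: size_factor_def)
  have b0: "0 \<le> b" unfolding b_def by (intro sum_nonneg mult_nonneg_nonneg sf0) auto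
  have injm: "inj_on \<phi> (m c)" if "c \<in> C" for c using inj mT[OF that] by (rule inj_on_subset)
  have cim: "card (\<phi> ` m c) = card (m c)" if "c \<in> C" for c by (rule card_image[OF injm[OF that]])
  have grp: "\<phi> ` m c \<in> groups n" if "c \<in> C" for c
    using that mT[OF that] x(3) m2[OF that] cim[OF that] by (auto simp: groups_def simp del: atLeastAtMost_iff)
  have injg: "inj_on (\<lambda>c. \<phi> ` m c) C"
    using minj inj_on_image_eq_iff[OF inj] mT by (auto simp: inj_on_def)
  have od: "odds p w n (\<phi> ` m c) = size_factor p (card (m c)) * (\<Prod>t\<in>m c. ?x t) / ?tw ^ (card (m c) - 1)"
    if "c \<in> C" for c
    using cim[OF that] by (simp add: odds_def prod.reindex[OF injm[OF that]])
  have od_le: "odds p w n (\<phi> ` m c) \<le> b / ?tw" if c: "c \<in> C" for c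
  proof -
    have "(\<Prod>t\<in>m c. ?x t) \<le> (\<Prod>t\<in>m c. real K + 1)"
      using x mT[OF c] by (intro prod_mono) auto
    then have "size_factor p (card (m c)) * (\<Prod>t\<in>m c. ?x t) \<le> size_factor p (card (m c)) * (real K + 1) ^ card (m c)"
      using sf0 by (intro mult_left_mono) auto
    also have "\<dots> \<le> b" unfolding b_def
      using C c sf0 by (intro member_le_sum) auto
    finally have 1: "size_factor p (card (m c)) * (\<Prod>t\<in>m c. ?x t) \<le> b" .
    have "?tw ^ 1 \<le> ?tw ^ (card (m c) - 1)" using tw m2[OF c] by (intro power_increasing) auto
    then show ?thesis unfolding od[OF c] using 1 b0 tw0 by (intro frac_le) auto
  qed
  have od0: "0 \<le> odds p w n (\<phi> ` m c)" if "c \<in> C" for c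
    using odds_nonneg[where p=p and w=w, OF w tw0, of "\<phi> ` m c"] grp[OF that] by (auto simp: groups_def)
  have on_ge: "1 / (1 + b / ?tw) * odds p w n (\<phi> ` m c) \<le> on_prob p w n (\<phi> ` m c)" if c: "c \<in> C" for c
  proof -
    have "odds p w n (\<phi> ` m c) / (1 + b / ?tw) \<le> odds p w n (\<phi> ` m c) / (1 + odds p w n (\<phi> ` m c))"
      using od0[OF c] od_le[OF c] b0 tw0 by (intro divide_left_mono) (auto intro!: mult_pos_pos add_pos_nonneg)
    then show ?thesis using on_prob_odds[where p=p and w=w and a="\<phi> ` m c", OF w tw0] by simp
  qed
  have "(\<Prod>c\<in>C. 1 / (1 + b / ?tw) * odds p w n (\<phi> ` m c)) \<le> (\<Prod>c\<in>C. on_prob p w n (\<phi> ` m c))"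
    using on_ge od0 b0 tw0 by (intro prod_mono) auto
  moreover have "(\<Prod>c\<in>C. 1 / (1 + b / ?tw) * odds p w n (\<phi> ` m c)) =
      ?L * (\<Prod>t\<in>T. ?x t ^ deg t)"
  proof -
    have "(\<Prod>c\<in>C. 1 / (1 + b / ?tw) * odds p w n (\<phi> ` m c)) =
      (1 / (1 + b / ?tw)) ^ card C * (\<Prod>c\<in>C. size_factor p (card (m c)) * (\<Prod>t\<in>m c. ?x t) / ?tw ^ (card (m c) - 1))"
      by (simp only: prod.distrib prod_constant od cong: prod.cong)
    also have "\<dots> = ?L * (\<Prod>c\<in>C. \<Prod>t\<in>m c. ?x t)"
      by (simp add: prod.distrib prod_dividef power_sum)
    finally show ?thesis by (simp add: prod_group_members[OF T C mT] deg_def)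
  qed
  ultimately have 1: "?L * (\<Prod>t\<in>T. ?x t ^ deg t) \<le> (\<Prod>c\<in>C. on_prob p w n (\<phi> ` m c))" by simp
  have L0: "0 \<le> ?L" using b0 tw0 sf0 by (intro divide_nonneg_pos mult_nonneg_nonneg prod_nonneg) auto
  have fS: "finite S" using S T by (rule finite_subset)
  have V: "?V \<le> (\<Prod>t\<in>T. ?x t ^ deg t) * exp (- size_mean p * (\<Sum>s\<in>S. ?x s))"
  proof -
    have "?V \<le> (\<Prod>t\<in>T. ?x t ^ deg t * (if t \<in> S then exp (- size_mean p * ?x t) else 1))"
    proof (intro prod_mono conjI)
      fix t assume "t \<in> T"
      then have "vertex_factor (size_mean p) (deg t) (t \<in> S) (?x t) = ?x t ^ deg t * (if t \<in> S then exp (- size_mean p * ?x t) else 1)"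
        using x by (simp add: vertex_factor_def)
      then show "vertex_factor (size_mean p) (deg t) (t \<in> S) (?x t) * cutoff K (?x t)
          \<le> ?x t ^ deg t * (if t \<in> S then exp (- size_mean p * ?x t) else 1)"
        by (metis cutoff_bounds mult_left_le vertex_factor_nonneg)
    qed simp
    also have "\<dots> = (\<Prod>t\<in>T. ?x t ^ deg t) * (\<Prod>s\<in>S. exp (- size_mean p * ?x s))"
      using T S by (simp add: prod.distrib prod.If_cases Int_absorb1)
    also have "(\<Prod>s\<in>S. exp (- size_mean p * ?x s)) = exp (- size_mean p * (\<Sum>s\<in>S. ?x s))"
      using fS by (simp add: exp_sum[symmetric] sum_distrib_left sum_negf)
    finally show ?thesis .
  qed
  have "?L * ?V \<le> ?L * ((\<Prod>t\<in>T. ?x t ^ deg t) * exp (- size_mean p * (\<Sum>s\<in>S. ?x s)))"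
    by (intro mult_left_mono V L0)
  also have "\<dots> \<le> (\<Prod>c\<in>C. on_prob p w n (\<phi> ` m c)) * exp (- size_mean p * (\<Sum>s\<in>S. ?x s))"
    using mult_right_mono[OF 1, of "exp (- size_mean p * (\<Sum>s\<in>S. ?x s))"] by (simp add: mult.assoc)
  also have "\<dots> \<le> ?P"
    using S x by (intro prob_realized_ge w tw0 sm C fS grp injg) auto
  finally show ?thesis .
qed

locale converging_weights =
  fixes w :: "nat \<Rightarrow> nat \<Rightarrow> real" and p :: "nat pmf"
    and M :: "'a measure" and W :: "'a \<Rightarrow> real"
  assumes weights_nonneg: "\<And>n i. i \<in> {1..n} \<Longrightarrow> w n i \<ge> 0"
    and total_weight_pos: "\<And>n. n \<ge> 1 \<Longrightarrow> total_weight w n > 0"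
    and sizes: "set_pmf p \<subseteq> {2..}"
    and size_mean_finite: "summable (\<lambda>k. real k * pmf p k)"
    and prob_M: "prob_space M" and W_measurable [measurable]: "W \<in> borel_measurable M"
    and W_integrable: "integrable M W" and EW_pos: "(\<integral>\<omega>. W \<omega> \<partial>M) > 0"
    and Wn_conv_distr:
      "weak_conv_m (\<lambda>n. distr (measure_pmf (pmf_of_set {1..n})) borel (w n)) (distr M borel W)"
    and Wn_first_moment_conv:
      "(\<lambda>n. measure_pmf.expectation (pmf_of_set {1..n}) (w n)) \<longlonglongrightarrow> (\<integral>\<omega>. W \<omega> \<partial>M)"
begin

sublocale M: prob_space M by (rule prob_M)

abbreviation mean_on :: "nat \<Rightarrow> (nat set set \<Rightarrow> real) \<Rightarrow> real" where
  "mean_on n \<equiv> measure_pmf.expectation (on_groups_pmf p w n)"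

abbreviation prob_on :: "nat \<Rightarrow> nat set set set \<Rightarrow> real" where
  "prob_on n \<equiv> measure_pmf.prob (on_groups_pmf p w n)"

abbreviation \<mu> :: real where "\<mu> \<equiv> size_mean p"
abbreviation EW :: real where "EW \<equiv> \<integral>\<omega>. W \<omega> \<partial>M"

lemma mu_nonneg: "0 \<le> \<mu>"
  unfolding size_mean_def by (intro suminf_nonneg size_mean_finite) auto

lemma expectation_uniform:
  "n \<ge> 1 \<Longrightarrow> measure_pmf.expectation (pmf_of_set {1..n}) (f :: nat \<Rightarrow> real) = (\<Sum>i\<in>{1..n}. f i) / real n"
  by (subst integral_pmf_of_set) auto

lemma average_tendsto:
  assumes g: "\<And>x. isCont g x" "\<And>x. norm (g x :: real) \<le> B"
  shows "(\<lambda>n. (\<Sum>i\<in>{1..n}. g (w n i)) / real n) \<longlonglongrightarrow> (\<integral>\<omega>. g (W \<omega>) \<partial>M)"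
proof -
  have gm [measurable]: "g \<in> borel_measurable borel"
    using g(1) by (intro borel_measurable_continuous_onI continuous_at_imp_continuous_on) auto
  have "(\<lambda>n. integral\<^sup>L (distr (measure_pmf (pmf_of_set {1..n})) borel (w n)) g) \<longlonglongrightarrow> integral\<^sup>L (distr M borel W) g"
    by (rule weak_conv_imp_integral_bdd_continuous_conv[OF _ _ Wn_conv_distr g])
      (auto intro!: prob_space.real_distribution_distr measure_pmf.prob_space_axioms M.prob_space_axioms)
  then have "(\<lambda>n. measure_pmf.expectation (pmf_of_set {1..n}) (\<lambda>i. g (w n i))) \<longlonglongrightarrow> (\<integral>\<omega>. g (W \<omega>) \<partial>M)"
    by (simp add: integral_distr)
  then show ?thesis
    by (rule Lim_transform_eventually)
      (use expectation_uniform in \<open>auto intro!: eventually_sequentiallyI[of 1]\<close>)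
qed

text \<open>The bounded continuous function \<open>min 1 (max 0 (- x))\<close> vanishes at all weights, so its mean under
  the limit law vanishes too.\<close>

lemma W_nonneg: "AE \<omega> in M. 0 \<le> W \<omega>"
proof -
  define g where "g x = min 1 (max 0 (- x))" for x :: real
  have g: "isCont g x" for x
  proof -
    have "continuous_on UNIV g" unfolding g_def by (intro continuous_intros)
    then show ?thesis by (simp add: continuous_on_eq_continuous_at)
  qed
  have b: "norm (g x) \<le> 1" for x by (simp add: g_def)
  have "(\<lambda>n. (\<Sum>i\<in>{1..n}. g (w n i)) / real n) \<longlonglongrightarrow> (\<integral>\<omega>. g (W \<omega>) \<partial>M)"
    using g b by (rule average_tendsto)
  moreover have "(\<lambda>n. (\<Sum>i\<in>{1..n}. g (w n i)) / real n) = (\<lambda>n. 0)"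
    using weights_nonneg by (auto simp: g_def fun_eq_iff intro!: sum.neutral)
  ultimately have "(\<integral>\<omega>. g (W \<omega>) \<partial>M) = 0" by (simp add: LIMSEQ_const_iff)
  moreover have gm [measurable]: "g \<in> borel_measurable borel" unfolding g_def by measurable
  moreover have "integrable M (\<lambda>\<omega>. g (W \<omega>))"
    by (rule M.integrable_const_bound[of _ 1]) (use b in auto)
  ultimately have "AE \<omega> in M. g (W \<omega>) = 0"
    by (subst (asm) integral_nonneg_eq_0_iff_AE) (auto simp: g_def)
  then show ?thesis by eventually_elim (auto simp: g_def min_def max_def split: if_splits)
qed

lemma total_weight_ratio: "(\<lambda>n. total_weight w n / real n) \<longlonglongrightarrow> EW"
  using Wn_first_moment_conv
  by (rule Lim_transform_eventually)
    (use expectation_uniform in \<open>auto intro!: eventually_sequentiallyI[of 1] simp: total_weight_def\<close>)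

lemma total_weight_at_top: "filterlim (total_weight w) at_top sequentially"
proof -
  have "filterlim (\<lambda>n. total_weight w n / real n * real n) at_top sequentially"
    by (rule filterlim_tendsto_pos_mult_at_top[OF total_weight_ratio EW_pos filterlim_real_sequentially])
  moreover have "eventually (\<lambda>n. total_weight w n / real n * real n = total_weight w n) sequentially"
    by (rule eventually_sequentiallyI[of 1]) simp
  ultimately show ?thesis by (subst (asm) filterlim_cong[OF refl refl])
qed

text \<open>The number \<open>\<rho>\<close> counts the components of the family of groups: a tree has one member more than the
  sum of the \<open>card (m c) - 1\<close>. Each component contributes one free choice of a vertex, hence the
  normalization by \<open>n ^ \<rho>\<close>, while each of the other members comes with a factor \<open>1 / total_weight\<close>,
  that is about \<open>1 / (n EW)\<close>.\<close>

lemma embedding_probability_liminf: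
  fixes C :: "'c set" and m :: "'c \<Rightarrow> 't set" and T S :: "'t set"
  defines "deg \<equiv> \<lambda>t. card {c \<in> C. t \<in> m c}"
  defines "e \<equiv> (\<Sum>c\<in>C. card (m c) - 1)"
  assumes T: "finite T" and C: "finite C" and mT: "\<And>c. c \<in> C \<Longrightarrow> m c \<subseteq> T" and m2: "\<And>c. c \<in> C \<Longrightarrow> 2 \<le> card (m c)"
    and minj: "inj_on m C" and S: "S \<subseteq> T" and cT: "card T = \<rho> + e"
    and int: "\<And>t. t \<in> T \<Longrightarrow> integrable M (\<lambda>\<omega>. vertex_factor \<mu> (deg t) (t \<in> S) (W \<omega>))"
    and x: "x < (\<Prod>c\<in>C. size_factor p (card (m c))) / EW ^ e * (\<Prod>t\<in>T. \<integral>\<omega>. vertex_factor \<mu> (deg t) (t \<in> S) (W \<omega>) \<partial>M)"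
  shows "eventually (\<lambda>n. x \<le> (\<Sum>\<phi>\<in>{\<phi> \<in> T \<rightarrow>\<^sub>E {1..n}. inj_on \<phi> T}.
      prob_on n {A. realized A C m S \<phi>}) / real n ^ \<rho>) sequentially"
proof -
  let ?\<kappa> = "\<Prod>c\<in>C. size_factor p (card (m c))"
  let ?u = "\<lambda>t. vertex_factor \<mu> (deg t) (t \<in> S)"
  have \<kappa>0: "0 \<le> ?\<kappa>" by (intro prod_nonneg) (simp add: size_factor_def)
  have "(\<lambda>K. \<integral>\<omega>. ?u t (W \<omega>) * cutoff K (W \<omega>) \<partial>M) \<longlonglongrightarrow> (\<integral>\<omega>. ?u t (W \<omega>) \<partial>M)" if t: "t \<in> T" for t
  proof (rule integral_dominated_convergence[where w = "\<lambda>\<omega>. ?u t (W \<omega>)"])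
    show "integrable M (\<lambda>\<omega>. ?u t (W \<omega>))" by (rule int[OF t])
    show "(\<lambda>\<omega>. ?u t (W \<omega>)) \<in> borel_measurable M" using int[OF t] by auto
    show "(\<lambda>\<omega>. ?u t (W \<omega>) * cutoff K (W \<omega>)) \<in> borel_measurable M" for K
      using int[OF t] unfolding cutoff_def by measurable
    have "eventually (\<lambda>K. ?u t y * cutoff K y = ?u t y) sequentially" for y
    proof (rule eventually_sequentiallyI[of "nat \<lceil>y\<rceil>"])
      fix K assume "nat \<lceil>y\<rceil> \<le> K"
      then have "y \<le> real K" by linarith
      then show "?u t y * cutoff K y = ?u t y" by (simp add: cutoff_def)
    qed
    then show "AE \<omega> in M. (\<lambda>K. ?u t (W \<omega>) * cutoff K (W \<omega>)) \<longlonglongrightarrow> ?u t (W \<omega>)"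
      by (intro AE_I2 tendsto_eventually)
    show "AE \<omega> in M. norm (?u t (W \<omega>) * cutoff K (W \<omega>)) \<le> ?u t (W \<omega>)" for K
      by (intro AE_I2) (auto simp: abs_mult intro!: mult_left_le)
  qed
  then have "(\<lambda>K. ?\<kappa> / EW ^ e * (\<Prod>t\<in>T. \<integral>\<omega>. ?u t (W \<omega>) * cutoff K (W \<omega>) \<partial>M)) \<longlonglongrightarrow>
      ?\<kappa> / EW ^ e * (\<Prod>t\<in>T. \<integral>\<omega>. ?u t (W \<omega>) \<partial>M)"
    by (intro tendsto_mult tendsto_const tendsto_prod)
  then have "eventually (\<lambda>K. x < ?\<kappa> / EW ^ e * (\<Prod>t\<in>T. \<integral>\<omega>. ?u t (W \<omega>) * cutoff K (W \<omega>) \<partial>M)) sequentially"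
    using x by (rule order_tendstoD(1))
  (* The truncation level is fixed before n tends to infinity. *)
  then obtain K where K: "x < ?\<kappa> / EW ^ e * (\<Prod>t\<in>T. \<integral>\<omega>. ?u t (W \<omega>) * cutoff K (W \<omega>) \<partial>M)"
    by (meson eventually_sequentially le_refl)
  define g where "g t y = ?u t y * cutoff K y" for t y
  define b where "b = (\<Sum>c\<in>C. size_factor p (card (m c)) * (real K + 1) ^ card (m c))"
  define BB where "BB = (\<Prod>t\<in>T. (real K + 1) ^ deg t)"
  let ?tw = "total_weight w"
  (* The lower bound for the truncated and normalized sum, written in terms of averages over vertices. *)
  define low where "low n = (1 / (1 + b / ?tw n)) ^ card C * ?\<kappa> * (real n / ?tw n) ^ e *
      ((\<Prod>t\<in>T. (\<Sum>i\<in>{1..n}. g t (w n i)) / real n) - (real (card T))\<^sup>2 * BB / real n)" for n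
  have b0: "0 \<le> b" unfolding b_def by (intro sum_nonneg mult_nonneg_nonneg) (auto simp: size_factor_def)
  have gb: "0 \<le> g t y" "g t y \<le> (real K + 1) ^ deg t" for t y
    using vertex_factor_cutoff_le[OF mu_nonneg] by (auto simp: g_def)
  have avg: "(\<lambda>n. (\<Sum>i\<in>{1..n}. g t (w n i)) / real n) \<longlonglongrightarrow> (\<integral>\<omega>. g t (W \<omega>) \<partial>M)" for t
    by (rule average_tendsto[where B = "(real K + 1) ^ deg t"])
      (use gb in \<open>auto simp: g_def[abs_def] abs_of_nonneg intro: isCont_vertex_factor_cutoff\<close>)
  have bt: "(\<lambda>n. b / ?tw n) \<longlonglongrightarrow> 0"
    by (rule tendsto_divide_0[OF tendsto_const filterlim_at_top_imp_at_infinity[OF total_weight_at_top]])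
  have inv: "(\<lambda>n. real n / ?tw n) \<longlonglongrightarrow> 1 / EW"
    using tendsto_inverse[OF total_weight_ratio] EW_pos by (simp add: field_simps)
  have cn: "(\<lambda>n. (real (card T))\<^sup>2 * BB / real n) \<longlonglongrightarrow> 0"
    by (rule tendsto_divide_0[OF tendsto_const filterlim_at_top_imp_at_infinity[OF filterlim_real_sequentially]])
  have "low \<longlonglongrightarrow> (1 / (1 + 0)) ^ card C * ?\<kappa> * (1 / EW) ^ e * ((\<Prod>t\<in>T. \<integral>\<omega>. g t (W \<omega>) \<partial>M) - 0)"
    unfolding low_def by (intro tendsto_intros avg bt inv cn) auto
  then have "low \<longlonglongrightarrow> ?\<kappa> / EW ^ e * (\<Prod>t\<in>T. \<integral>\<omega>. g t (W \<omega>) \<partial>M)"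
    by (simp add: power_divide)
  then have "eventually (\<lambda>n. x < low n) sequentially"
    using K by (intro order_tendstoD(1)) (auto simp: g_def)
  moreover have "eventually (\<lambda>n. 1 \<le> ?tw n) sequentially"
    using total_weight_at_top by (simp add: filterlim_at_top)
  moreover have "eventually (\<lambda>n. 1 \<le> n) sequentially" by (rule eventually_ge_at_top)
  ultimately show ?thesis
  proof eventually_elim
    case (elim n)
    let ?I = "{\<phi> \<in> T \<rightarrow>\<^sub>E {1..n}. inj_on \<phi> T}"
    define D where "D = (1 / (1 + b / ?tw n)) ^ card C * ?\<kappa> / ?tw n ^ e"
    have D0: "0 \<le> D" unfolding D_def using b0 \<kappa>0 elim(2) by (intro divide_nonneg_pos mult_nonneg_nonneg) auto
    have n0: "real n > 0" using elim(3) by simp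
    have tw0: "?tw n > 0" using elim(2) by simp
    have "(\<Prod>t\<in>T. \<Sum>i\<in>{1..n}. g t (w n i)) - (real (card T))\<^sup>2 * real n ^ (card T - 1) * BB
        \<le> (\<Sum>\<phi>\<in>?I. \<Prod>t\<in>T. g t (w n (\<phi> t)))"
      using injective_sum_ge[OF T, of "{1..n}" "\<lambda>t i. g t (w n i)" "\<lambda>t. (real K + 1) ^ deg t"] gb
      by (simp add: BB_def)
    then have "D * ((\<Prod>t\<in>T. \<Sum>i\<in>{1..n}. g t (w n i)) - (real (card T))\<^sup>2 * real n ^ (card T - 1) * BB)
        \<le> D * (\<Sum>\<phi>\<in>?I. \<Prod>t\<in>T. g t (w n (\<phi> t)))" by (rule mult_left_mono[OF _ D0])
    also have "\<dots> = (\<Sum>\<phi>\<in>?I. D * (\<Prod>t\<in>T. g t (w n (\<phi> t))))" by (rule sum_distrib_left)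
    also have "\<dots> \<le> (\<Sum>\<phi>\<in>?I. prob_on n {A. realized A C m S \<phi>})"
    proof (rule sum_mono)
      fix \<phi> assume "\<phi> \<in> ?I"
      then show "D * (\<Prod>t\<in>T. g t (w n (\<phi> t))) \<le> prob_on n {A. realized A C m S \<phi>}"
        using prob_realized_ge_factors[where w=w and p=p and K=K and n=n, OF weights_nonneg elim(2) size_mean_finite T C mT m2 minj S, of \<phi>]
        by (simp add: D_def g_def b_def e_def deg_def)
    qed
    finally have main: "D * ((\<Prod>t\<in>T. \<Sum>i\<in>{1..n}. g t (w n i)) - (real (card T))\<^sup>2 * real n ^ (card T - 1) * BB)
      \<le> (\<Sum>\<phi>\<in>?I. prob_on n {A. realized A C m S \<phi>})" (is "?l \<le> ?r") .
    have "low n = D * (real n ^ e * ((\<Prod>t\<in>T. (\<Sum>i\<in>{1..n}. g t (w n i)) / real n) - (real (card T))\<^sup>2 * BB / real n))"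
      by (simp add: low_def D_def power_divide)
    also have "(\<Prod>t\<in>T. (\<Sum>i\<in>{1..n}. g t (w n i)) / real n) = (\<Prod>t\<in>T. \<Sum>i\<in>{1..n}. g t (w n i)) / real n ^ card T"
      by (simp add: prod_dividef)
    also have "real n ^ e * ((\<Prod>t\<in>T. \<Sum>i\<in>{1..n}. g t (w n i)) / real n ^ card T - (real (card T))\<^sup>2 * BB / real n)
        = ((\<Prod>t\<in>T. \<Sum>i\<in>{1..n}. g t (w n i)) - (real (card T))\<^sup>2 * real n ^ (card T - 1) * BB) / real n ^ \<rho>"
    proof (cases "card T")
      case 0
      then show ?thesis using cT n0 by simp
    next
      case (Suc k)
      then have "real n ^ e * real n ^ \<rho> = real n ^ Suc k" using cT by (metis add.commute power_add)
      moreover have "x * (P / (y * z) - Q / y) = (P - Q * z) / r"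
        if "x * r = y * z" "r \<noteq> 0" "y \<noteq> 0" "z \<noteq> 0" for x y z r P Q :: real
      proof -
        have "x = y * z / r" using that by (simp add: field_simps)
        then show ?thesis using that by (simp add: field_simps)
      qed
      ultimately show ?thesis
        using n0 Suc by (simp add: mult.commute[of _ BB] mult.assoc[symmetric])
    qed
    finally have "low n = ?l / real n ^ \<rho>" by simp
    also have "\<dots> \<le> ?r / real n ^ \<rho>" using main n0 by (intro divide_right_mono) auto
    finally show ?case using elim(1) by simp
  qed
qed

end

section \<open>Offspring laws\<close>

lemma nn_integral_sums:
  assumes "\<And>k::nat. 0 \<le> f k" "f sums s"
  shows "(\<integral>\<^sup>+k. ennreal (f k) \<partial>count_space UNIV) = ennreal s"
  unfolding nn_integral_count_space_nat using assms by (rule suminf_ennreal_eq)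

definition poisson_weight :: "real \<Rightarrow> nat \<Rightarrow> real" where
  "poisson_weight x j = exp (- x) * x ^ j / fact j"

lemma poisson_weight_sums: "poisson_weight x sums 1"
proof -
  have "(\<lambda>j. exp (- x) * (x ^ j /\<^sub>R fact j)) sums (exp (- x) * exp x)"
    by (intro sums_mult exp_converges)
  then show ?thesis by (simp add: poisson_weight_def[abs_def] exp_minus field_simps)
qed

lemma poisson_weight_mean: "(\<lambda>j. real j * poisson_weight x j) sums x"
proof -
  have "(\<lambda>j. real (Suc j) * poisson_weight x (Suc j)) = (\<lambda>j. x * poisson_weight x j)"
    by (auto simp: poisson_weight_def fun_eq_iff divide_simps)
  then have "(\<lambda>j. real (Suc j) * poisson_weight x (Suc j)) sums x"
    using sums_mult[OF poisson_weight_sums, of x x] by simp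
  from sums_Suc[OF this] show ?thesis by simp
qed

lemma poisson_weight_bounds:
  assumes "0 \<le> x" shows "0 \<le> poisson_weight x j" "poisson_weight x j \<le> 1"
proof -
  show nn: "0 \<le> poisson_weight x j" for j using assms by (simp add: poisson_weight_def)
  have "(\<Sum>k\<in>{j}. poisson_weight x k) \<le> suminf (poisson_weight x)"
    using nn by (intro sum_le_suminf sums_summable[OF poisson_weight_sums]) auto
  then show "poisson_weight x j \<le> 1" using sums_unique[OF poisson_weight_sums, of x] by simp
qed

lemma mean_sums:
  assumes "integrable (measure_pmf X) real"
  shows "(\<lambda>k. real k * pmf X k) sums measure_pmf.expectation X real"
proof -
  have "integrable (count_space UNIV) (\<lambda>k. pmf X k * real k)"
    using assms by (simp add: measure_pmf_eq_density integrable_density)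
  from sums_integral_count_space_nat[OF this] show ?thesis
    by (simp add: measure_pmf_eq_density integral_density mult.commute)
qed

lemma integrable_from_mean:
  assumes "summable (\<lambda>k. real k * pmf X k)"
  shows "integrable (measure_pmf X) real"
  using assms by (simp add: measure_pmf_eq_density integrable_density integrable_count_space_nat_iff mult.commute)

lemma pmf_tilde:
  assumes int: "integrable (measure_pmf X) real" and pos: "measure_pmf.expectation X real > 0"
  shows "pmf (tilde_pmf X) k = real (k + 1) * pmf X (k + 1) / measure_pmf.expectation X real"
  unfolding tilde_pmf_def
proof (rule pmf_embed_pmf)
  let ?E = "measure_pmf.expectation X real"
  show "0 \<le> real (k + 1) * pmf X (k + 1) / ?E" for k using pos by simp
  have "(\<lambda>k. real (Suc k) * pmf X (Suc k)) sums ?E"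
    using mean_sums[OF int] by (subst sums_Suc_iff) simp
  then have "(\<lambda>k. real (k + 1) * pmf X (k + 1) / ?E) sums (?E / ?E)" by (intro sums_divide) simp
  then show "(\<integral>\<^sup>+ k. ennreal (real (k + 1) * pmf X (k + 1) / ?E) \<partial>count_space UNIV) = 1"
    using pos by (subst nn_integral_sums) auto
qed

context converging_weights begin

abbreviation Dl :: "nat pmf" where "Dl \<equiv> mixed_poisson_pmf \<mu> M W"

lemma mean_p: "measure_pmf.expectation p real = \<mu>"
  using mean_sums[OF integrable_from_mean[OF size_mean_finite]] sums_unique
  by (fastforce simp: size_mean_def)

lemma mu_pos: "0 < \<mu>"
proof -
  obtain k where k: "k \<in> set_pmf p" using set_pmf_not_empty[of p] by blast
  then have "2 \<le> k" "0 < pmf p k" using sizes by (auto simp: pmf_positive)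
  then have "0 < real k * pmf p k" by simp
  then show ?thesis unfolding size_mean_def
    by (intro suminf_pos2[OF size_mean_finite, of k]) auto
qed

lemma integrable_poisson_weight: "integrable M (\<lambda>\<omega>. poisson_weight (\<mu> * W \<omega>) j)"
proof (rule M.integrable_const_bound[of _ 1])
  show "AE \<omega> in M. norm (poisson_weight (\<mu> * W \<omega>) j) \<le> 1"
    using W_nonneg by eventually_elim (use poisson_weight_bounds mu_nonneg in auto)
qed (simp add: poisson_weight_def)

text \<open>Tonelli for the mixed Poisson law: sums against it are computed conditionally on \<open>W\<close>. The two
  instances below are the total mass and the mean.\<close>

lemma mixture_sum:
  assumes a: "\<And>j. 0 \<le> a j" and h: "\<And>x. (\<lambda>j. a j * poisson_weight x j) sums h x"
    and [measurable]: "h \<in> borel_measurable borel"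
  shows "(\<integral>\<^sup>+j. ennreal (a j * (\<integral>\<omega>. poisson_weight (\<mu> * W \<omega>) j \<partial>M)) \<partial>count_space UNIV)
    = (\<integral>\<^sup>+\<omega>. ennreal (h (\<mu> * W \<omega>)) \<partial>M)"
proof -
  have [measurable]: "(\<lambda>\<omega>. poisson_weight (\<mu> * W \<omega>) j) \<in> borel_measurable M" for j
    by (simp add: poisson_weight_def)
  have pw: "AE \<omega> in M. 0 \<le> poisson_weight (\<mu> * W \<omega>) j" for j
    using W_nonneg by eventually_elim (use poisson_weight_bounds mu_nonneg in auto)
  have "(\<integral>\<^sup>+j. ennreal (a j * (\<integral>\<omega>. poisson_weight (\<mu> * W \<omega>) j \<partial>M)) \<partial>count_space UNIV)
      = (\<Sum>j. ennreal (\<integral>\<omega>. a j * poisson_weight (\<mu> * W \<omega>) j \<partial>M))"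
    by (simp add: nn_integral_count_space_nat)
  also have "\<dots> = (\<Sum>j. \<integral>\<^sup>+\<omega>. ennreal (a j * poisson_weight (\<mu> * W \<omega>) j) \<partial>M)"
  proof (intro suminf_cong nn_integral_eq_integral[symmetric])
    show "integrable M (\<lambda>\<omega>. a j * poisson_weight (\<mu> * W \<omega>) j)" for j
      using integrable_poisson_weight by simp
    show "AE \<omega> in M. 0 \<le> a j * poisson_weight (\<mu> * W \<omega>) j" for j
      using pw[of j] by eventually_elim (use a in simp)
  qed
  also have "\<dots> = (\<integral>\<^sup>+\<omega>. (\<Sum>j. ennreal (a j * poisson_weight (\<mu> * W \<omega>) j)) \<partial>M)"
    by (rule nn_integral_suminf[symmetric]) simp
  also have "\<dots> = (\<integral>\<^sup>+\<omega>. ennreal (h (\<mu> * W \<omega>)) \<partial>M)"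
  proof (rule nn_integral_cong_AE)
    have "AE \<omega> in M. \<forall>j. 0 \<le> poisson_weight (\<mu> * W \<omega>) j" using pw by (simp add: AE_all_countable)
    then show "AE \<omega> in M. (\<Sum>j. ennreal (a j * poisson_weight (\<mu> * W \<omega>) j)) = ennreal (h (\<mu> * W \<omega>))"
    proof eventually_elim
      case (elim \<omega>)
      then show ?case by (intro suminf_ennreal_eq h) (use a in simp)
    qed
  qed
  finally show ?thesis .
qed

lemma pmf_Dl: "pmf Dl j = (\<integral>\<omega>. poisson_weight (\<mu> * W \<omega>) j \<partial>M)"
proof -
  have "Dl = embed_pmf (\<lambda>j. \<integral>\<omega>. poisson_weight (\<mu> * W \<omega>) j \<partial>M)"
    by (simp add: mixed_poisson_pmf_def poisson_weight_def)
  moreover have "pmf (embed_pmf (\<lambda>j. \<integral>\<omega>. poisson_weight (\<mu> * W \<omega>) j \<partial>M)) j = (\<integral>\<omega>. poisson_weight (\<mu> * W \<omega>) j \<partial>M)"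
  proof (rule pmf_embed_pmf)
    show "0 \<le> (\<integral>\<omega>. poisson_weight (\<mu> * W \<omega>) j \<partial>M)" for j
      by (rule integral_nonneg_AE, use W_nonneg in eventually_elim) (use poisson_weight_bounds mu_nonneg in auto)
    show "(\<integral>\<^sup>+ j. ennreal (\<integral>\<omega>. poisson_weight (\<mu> * W \<omega>) j \<partial>M) \<partial>count_space UNIV) = 1"
      using mixture_sum[of "\<lambda>_. 1" "\<lambda>_. 1"] poisson_weight_sums by (simp add: M.emeasure_space_1)
  qed
  ultimately show ?thesis by simp
qed

lemma mean_Dl: "integrable (measure_pmf Dl) real" "measure_pmf.expectation Dl real = \<mu> * EW"
proof -
  have "(\<integral>\<^sup>+ j. ennreal (real j) \<partial>measure_pmf Dl) = (\<integral>\<^sup>+j. ennreal (real j * (\<integral>\<omega>. poisson_weight (\<mu> * W \<omega>) j \<partial>M)) \<partial>count_space UNIV)"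
    by (simp add: nn_integral_measure_pmf pmf_Dl[symmetric] ennreal_mult'' mult.commute)
  also have "\<dots> = (\<integral>\<^sup>+\<omega>. ennreal (\<mu> * W \<omega>) \<partial>M)"
    using mixture_sum[of real "\<lambda>x. x"] poisson_weight_mean by simp
  also have "\<dots> = ennreal (\<integral>\<omega>. \<mu> * W \<omega> \<partial>M)"
    by (rule nn_integral_eq_integral, use W_integrable in simp, use W_nonneg in eventually_elim) (use mu_nonneg in simp)
  finally have nn: "(\<integral>\<^sup>+ j. ennreal (real j) \<partial>measure_pmf Dl) = ennreal (\<mu> * EW)" by simp
  show "integrable (measure_pmf Dl) real"
    by (rule integrableI_nn_integral_finite[OF _ _ nn]) auto
  show "measure_pmf.expectation Dl real = \<mu> * EW"
    using nn EW_pos mu_nonneg by (subst integral_eq_nn_integral) auto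
qed

lemma pmf_tilde_Dl: "pmf (tilde_pmf Dl) k = real (k + 1) * pmf Dl (k + 1) / (\<mu> * EW)"
  using pmf_tilde[OF mean_Dl(1)] EW_pos mu_pos by (simp add: mean_Dl(2))

lemma pmf_tilde_p: "pmf (tilde_pmf p) k = real (k + 1) * pmf p (k + 1) / \<mu>"
  using pmf_tilde[OF integrable_from_mean[OF size_mean_finite]] mu_pos by (simp add: mean_p)

lemma vertex_factor_poisson:
  assumes "0 \<le> x"
  shows "vertex_factor \<mu> d True x * \<mu> ^ d / fact d = poisson_weight (\<mu> * x) d"
  using assms by (simp add: vertex_factor_def poisson_weight_def power_mult_distrib)

lemma integrable_vertex_factor_inner: "integrable M (\<lambda>\<omega>. vertex_factor \<mu> d True (W \<omega>))"
proof -
  have "integrable M (\<lambda>\<omega>. poisson_weight (\<mu> * W \<omega>) d * (fact d / \<mu> ^ d))"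
    using integrable_poisson_weight by simp
  then show ?thesis
  proof (rule integrable_cong_AE_imp)
    show "(\<lambda>\<omega>. vertex_factor \<mu> d True (W \<omega>)) \<in> borel_measurable M" by (simp add: vertex_factor_def)
    show "AE \<omega> in M. poisson_weight (\<mu> * W \<omega>) d * (fact d / \<mu> ^ d) = vertex_factor \<mu> d True (W \<omega>)"
      using W_nonneg by eventually_elim (use mu_pos in \<open>simp add: vertex_factor_poisson[symmetric]\<close>)
  qed
qed

lemma integral_vertex_factor_inner: "(\<integral>\<omega>. vertex_factor \<mu> d True (W \<omega>) \<partial>M) * \<mu> ^ d / fact d = pmf Dl d"
proof -
  have "(\<integral>\<omega>. vertex_factor \<mu> d True (W \<omega>) \<partial>M) * \<mu> ^ d / fact d = (\<integral>\<omega>. vertex_factor \<mu> d True (W \<omega>) * \<mu> ^ d / fact d \<partial>M)"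
    by simp
  also have "\<dots> = (\<integral>\<omega>. poisson_weight (\<mu> * W \<omega>) d \<partial>M)"
  proof (rule integral_cong_AE)
    show "AE \<omega> in M. vertex_factor \<mu> d True (W \<omega>) * \<mu> ^ d / fact d = poisson_weight (\<mu> * W \<omega>) d"
      using W_nonneg by eventually_elim (rule vertex_factor_poisson)
  qed (simp_all add: vertex_factor_def poisson_weight_def)
  finally show ?thesis by (simp add: pmf_Dl)
qed

text \<open>An individual that is not the root is a member of one more group, that of its parent. The additional
  factor \<open>W\<close> is the size-biasing in the definition of \<open>tilde_pmf\<close>, up to the constant \<open>EW\<close>.\<close>

lemma integral_vertex_factor_inner_child:
  "(\<integral>\<omega>. vertex_factor \<mu> (Suc d) True (W \<omega>) \<partial>M) * \<mu> ^ d / fact d = EW * pmf (tilde_pmf Dl) d"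
proof -
  have "(\<integral>\<omega>. vertex_factor \<mu> (Suc d) True (W \<omega>) \<partial>M) * \<mu> ^ d / fact d =
      (\<integral>\<omega>. vertex_factor \<mu> (Suc d) True (W \<omega>) \<partial>M) * \<mu> ^ Suc d / fact (Suc d) * real (Suc d) / \<mu>"
    using mu_pos by (simp del: of_nat_Suc)
  also have "\<dots> = EW * pmf (tilde_pmf Dl) d"
    unfolding integral_vertex_factor_inner using EW_pos mu_pos by (simp add: pmf_tilde_Dl)
  finally show ?thesis .
qed

lemma vertex_factor_leaf:
  "integrable M (\<lambda>\<omega>. vertex_factor \<mu> 1 False (W \<omega>))" "(\<integral>\<omega>. vertex_factor \<mu> 1 False (W \<omega>) \<partial>M) = EW"
proof -
  have eq: "AE \<omega> in M. vertex_factor \<mu> 1 False (W \<omega>) = W \<omega>"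
    using W_nonneg by eventually_elim (simp add: vertex_factor_def)
  have m: "(\<lambda>\<omega>. vertex_factor \<mu> 1 False (W \<omega>)) \<in> borel_measurable M" by (simp add: vertex_factor_def)
  show "integrable M (\<lambda>\<omega>. vertex_factor \<mu> 1 False (W \<omega>))"
    by (rule integrable_cong_AE_imp[OF W_integrable m], use eq in eventually_elim) simp
  show "(\<integral>\<omega>. vertex_factor \<mu> 1 False (W \<omega>) \<partial>M) = EW"
    by (rule integral_cong_AE[OF m _ eq]) simp
qed

section \<open>The limit weight of a tree\<close>

text \<open>The asymptotic number of vertices of each mark, divided by \<open>n\<close>.\<close>

definition root_density :: "mark \<Rightarrow> real" where
  "root_density t = (case t of LMark \<Rightarrow> 1 | RMark \<Rightarrow> EW)"

lemma card_children_union: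
  assumes "finite V"
  shows "card (\<Union>v\<in>V. (\<lambda>k. v @ [k]) ` {..<\<xi> v :: nat}) = (\<Sum>v\<in>V. \<xi> v)"
proof -
  have "card (\<Union>v\<in>V. (\<lambda>k. v @ [k]) ` {..<\<xi> v}) = (\<Sum>v\<in>V. card ((\<lambda>k. v @ [k]) ` {..<\<xi> v}))"
    using assms by (intro card_UN_disjoint) auto
  also have "\<dots> = (\<Sum>v\<in>V. \<xi> v)" by (intro sum.cong refl) (auto simp: card_image inj_on_def)
  finally show ?thesis .
qed

context
  fixes t \<xi> R
  assumes parity: "even R = (t = LMark)" and R: "1 \<le> R"
    and card2: "\<And>c. c \<in> rnodes t \<xi> R \<Longrightarrow> 2 \<le> card (tree_nbrs \<xi> c)"
begin

lemma lnodes_children: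
  "lnodes t \<xi> R = (if t = LMark then {[]} else {}) \<union> (\<Union>c\<in>rnodes t \<xi> R. (\<lambda>k. c @ [k]) ` {..<\<xi> c})" (is "_ = ?A")
proof (intro equalityI subsetI)
  fix v assume "v \<in> lnodes t \<xi> R"
  then show "v \<in> ?A"
    by (cases v rule: rev_cases) (auto simp: lnodes_def rnodes_def ind_upto_def)
next
  fix v assume "v \<in> ?A"
  then consider "t = LMark" "v = []" | c k where "c \<in> rnodes t \<xi> R" "k < \<xi> c" "v = c @ [k]"
    by (auto split: if_splits)
  then show "v \<in> lnodes t \<xi> R"
  proof cases
    case 2
    then show ?thesis using rnodes_length[OF parity 2(1)] by (auto simp: lnodes_def rnodes_def ind_upto_def)
  qed (auto simp: lnodes_def ind_upto_def)
qed

lemma rnodes_children: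
  "rnodes t \<xi> R = (if t = RMark then {[]} else {}) \<union> (\<Union>v\<in>inner_lnodes t \<xi> R. (\<lambda>k. v @ [k]) ` {..<\<xi> v})" (is "_ = ?A")
proof (intro equalityI subsetI)
  fix v assume "v \<in> rnodes t \<xi> R"
  then show "v \<in> ?A"
    by (cases v rule: rev_cases) (auto simp: lnodes_def rnodes_def inner_lnodes_def ind_upto_def)
next
  fix v assume v: "v \<in> ?A"
  then show "v \<in> rnodes t \<xi> R"
    using R by (auto simp: lnodes_def rnodes_def inner_lnodes_def ind_upto_def split: if_splits)
qed

lemma card_lnodes_children: "card (lnodes t \<xi> R) = (if t = LMark then 1 else 0) + (\<Sum>c\<in>rnodes t \<xi> R. \<xi> c)"
  unfolding lnodes_children by (subst card_Un_disjoint) (auto simp: card_children_union)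

lemma card_rnodes_children: "card (rnodes t \<xi> R) = (if t = RMark then 1 else 0) + (\<Sum>c\<in>inner_lnodes t \<xi> R. \<xi> c)"
  by (subst rnodes_children, subst card_Un_disjoint) (auto simp: card_children_union)

text \<open>Each \<open>l\<close>-individual other than the root is a child of exactly one \<open>r\<close>-individual, and the neighbours
  of \<open>c\<close> are its children and its parent. A root of mark \<open>l\<close> is nobody's child; a root of mark \<open>r\<close> has
  no parent, so all its neighbours are children. In both cases the surplus is one.\<close>

lemma card_lnodes: "card (lnodes t \<xi> R) = 1 + (\<Sum>c\<in>rnodes t \<xi> R. card (tree_nbrs \<xi> c) - 1)"
proof (cases t)
  case LMark
  have "[] \<notin> rnodes t \<xi> R" using LMark by (auto simp: rnodes_def)
  then have "(\<Sum>c\<in>rnodes t \<xi> R. card (tree_nbrs \<xi> c) - 1) = (\<Sum>c\<in>rnodes t \<xi> R. \<xi> c)"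
    by (intro sum.cong) (auto simp: card_tree_nbrs)
  then show ?thesis using card_lnodes_children LMark by simp
next
  case RMark
  have r: "[] \<in> rnodes t \<xi> R" using RMark by (auto simp: rnodes_def ind_upto_def)
  have x: "2 \<le> \<xi> []" using card2[OF r] by (simp add: card_tree_nbrs)
  have "(\<Sum>c\<in>rnodes t \<xi> R. card (tree_nbrs \<xi> c) - 1) = (\<xi> [] - 1) + (\<Sum>c\<in>rnodes t \<xi> R - {[]}. \<xi> c)"
    by (subst sum.remove[OF _ r]) (auto simp: card_tree_nbrs intro!: sum.cong)
  moreover have "(\<Sum>c\<in>rnodes t \<xi> R. \<xi> c) = \<xi> [] + (\<Sum>c\<in>rnodes t \<xi> R - {[]}. \<xi> c)"
    by (rule sum.remove[OF _ r]) auto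
  ultimately show ?thesis using card_lnodes_children RMark x by simp
qed

lemma degree_inner:
  assumes v: "v \<in> inner_lnodes t \<xi> R"
  shows "card {c \<in> rnodes t \<xi> R. v \<in> tree_nbrs \<xi> c} = \<xi> v + (if v = [] then 0 else 1)"
proof -
  have vi: "v \<in> individuals \<xi>" using v by (auto simp: inner_lnodes_def lnodes_def ind_upto_def)
  have "{c \<in> rnodes t \<xi> R. v \<in> tree_nbrs \<xi> c} = tree_nbrs \<xi> v"
    using tree_nbrs_inner_lnodes[OF v] tree_nbrs_sym[OF vi] by (auto simp: rnodes_def ind_upto_def)
  then show ?thesis by (simp add: card_tree_nbrs)
qed

lemma degree_leaf:
  assumes v: "v \<in> lnodes t \<xi> R - inner_lnodes t \<xi> R"
  shows "card {c \<in> rnodes t \<xi> R. v \<in> tree_nbrs \<xi> c} = 1"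
proof -
  have len: "length v = R" and vi: "v \<in> individuals \<xi>"
    using v by (auto simp: inner_lnodes_def lnodes_def ind_upto_def)
  then obtain u k where vu: "v = u @ [k]" using R by (cases v rule: rev_cases) auto
  have u: "u \<in> rnodes t \<xi> R" using v vu by (auto simp: rnodes_def lnodes_def ind_upto_def)
  have "{c \<in> rnodes t \<xi> R. v \<in> tree_nbrs \<xi> c} = {u}"
  proof (intro equalityI subsetI)
    fix c assume c: "c \<in> {c \<in> rnodes t \<xi> R. v \<in> tree_nbrs \<xi> c}"
    then have "length c < R" using rnodes_length[OF parity] by blast
    then have "\<nexists>k. c = v @ [k]" using len by auto
    then show "c \<in> {u}" using c tree_nbrs_cases[of v \<xi> c] vu by auto
  next
    fix c assume "c \<in> {u}"
    then show "c \<in> {c \<in> rnodes t \<xi> R. v \<in> tree_nbrs \<xi> c}" using u vi vu by (auto simp: in_tree_nbrs_iff)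
  qed
  then show ?thesis by simp
qed

lemma integrable_tree_factor:
  assumes "v \<in> lnodes t \<xi> R"
  shows "integrable M (\<lambda>\<omega>. vertex_factor \<mu> (card {c \<in> rnodes t \<xi> R. v \<in> tree_nbrs \<xi> c}) (v \<in> inner_lnodes t \<xi> R) (W \<omega>))"
  using degree_leaf[of v] assms integrable_vertex_factor_inner vertex_factor_leaf(1)
  by (cases "v \<in> inner_lnodes t \<xi> R") auto

abbreviation offspring_prob :: "nat list \<Rightarrow> real" where
  "offspring_prob v \<equiv> pmf (offspring_pmf Dl p t v) (\<xi> v)"

lemma inner_factor:
  assumes v: "v \<in> inner_lnodes t \<xi> R"
  shows "(\<integral>\<omega>. vertex_factor \<mu> (card {c \<in> rnodes t \<xi> R. v \<in> tree_nbrs \<xi> c}) (v \<in> inner_lnodes t \<xi> R) (W \<omega>) \<partial>M) =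
    fact (\<xi> v) * offspring_prob v * (if v = [] then 1 else EW) / \<mu> ^ \<xi> v"
proof -
  have m: "mark_of t v = LMark" using v by (auto simp: inner_lnodes_def lnodes_def)
  show ?thesis
  proof (cases "v = []")
    case True
    then show ?thesis
      using v m integral_vertex_factor_inner[of "\<xi> v"] mu_pos degree_inner[OF v]
      by (simp add: offspring_pmf_def field_simps)
  next
    case False
    then show ?thesis
      using v m integral_vertex_factor_inner_child[of "\<xi> v"] mu_pos degree_inner[OF v]
      by (simp add: offspring_pmf_def field_simps)
  qed
qed

lemma group_factor:
  assumes c: "c \<in> rnodes t \<xi> R"
  shows "size_factor p (card (tree_nbrs \<xi> c)) = fact (\<xi> c) * offspring_prob c * (if c = [] then 1 else \<mu>)"
proof -
  have m: "mark_of t c = RMark" using c by (auto simp: rnodes_def)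
  then show ?thesis using mu_pos
    by (auto simp: size_factor_def card_tree_nbrs offspring_pmf_def pmf_tilde_p)
qed

lemma prod_root_except:
  assumes "finite V" shows "(\<Prod>v\<in>V. if v = [] then 1 else a) = (a::real) ^ card (V - {[]})"
proof -
  have "V \<inter> - {v. v = []} = V - {[]}" by auto
  then show ?thesis using assms by (simp add: prod.If_cases)
qed

text \<open>Every individual contributes its offspring probability and a factorial; the factorials
  form \<open>orderings\<close>. The remaining powers balance: each \<open>r\<close>-individual other than the root yields a
  factor \<open>\<mu>\<close>, which is used by the \<open>l\<close>-individual that is its parent; each \<open>l\<close>-individual other than
  the root yields a factor \<open>EW\<close>, and all but possibly one of these are divided out.\<close>

lemma tree_weight:
  "(\<Prod>c\<in>rnodes t \<xi> R. size_factor p (card (tree_nbrs \<xi> c))) / EW ^ (\<Sum>c\<in>rnodes t \<xi> R. card (tree_nbrs \<xi> c) - 1) *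
   (\<Prod>v\<in>lnodes t \<xi> R. \<integral>\<omega>. vertex_factor \<mu> (card {c \<in> rnodes t \<xi> R. v \<in> tree_nbrs \<xi> c})
      (v \<in> inner_lnodes t \<xi> R) (W \<omega>) \<partial>M)
   = orderings R \<xi> * (root_density t * (\<Prod>v\<in>ind_below \<xi> R. offspring_prob v))"
proof -
  let ?T = "lnodes t \<xi> R" and ?C = "rnodes t \<xi> R" and ?S = "inner_lnodes t \<xi> R"
  let ?I = "\<lambda>v. \<integral>\<omega>. vertex_factor \<mu> (card {c \<in> ?C. v \<in> tree_nbrs \<xi> c}) (v \<in> ?S) (W \<omega>) \<partial>M"
  let ?q = "\<lambda>v. fact (\<xi> v) * offspring_prob v"
  let ?e = "\<Sum>c\<in>?C. card (tree_nbrs \<xi> c) - 1"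
  have ST: "?S \<subseteq> ?T" by (auto simp: inner_lnodes_def)
  have nil: "[] \<in> ?S \<longleftrightarrow> t = LMark" "[] \<in> ?T \<longleftrightarrow> t = LMark" "[] \<in> ?C \<longleftrightarrow> t = RMark"
    using R by (auto simp: inner_lnodes_def lnodes_def rnodes_def ind_upto_def)
  have below: "ind_below \<xi> R = ?S \<union> ?C" "?S \<inter> ?C = {}"
    using rnodes_length[OF parity] by (auto simp: ind_below_def inner_lnodes_def lnodes_def rnodes_def ind_upto_def)
  have C: "(\<Prod>c\<in>?C. size_factor p (card (tree_nbrs \<xi> c))) = (\<Prod>c\<in>?C. ?q c) * \<mu> ^ card (?C - {[]})"
    by (simp add: group_factor prod.distrib prod_root_except cong: prod.cong)
  have cC: "card (?C - {[]}) = (\<Sum>v\<in>?S. \<xi> v)"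
    using card_rnodes_children nil by (cases t) (auto simp: card_Diff_singleton_if)
  have cT: "EW ^ card (?T - {[]}) = EW ^ ?e * root_density t"
    using card_lnodes nil by (cases t) (auto simp: card_Diff_singleton_if root_density_def)
  have leaf: "(if v = [] then 1 else EW) = EW" "?I v = EW" if "v \<in> ?T - ?S" for v
    using degree_leaf[OF that] that vertex_factor_leaf(2) nil by auto
  have "(\<Prod>v\<in>?T. ?I v) = (\<Prod>v\<in>?T - ?S. ?I v) * (\<Prod>v\<in>?S. ?I v)"
    by (rule prod.subset_diff[OF ST]) simp
  also have "(\<Prod>v\<in>?T - ?S. ?I v) = (\<Prod>v\<in>?T - ?S. if v = [] then 1 else EW)"
    using leaf by (intro prod.cong) auto
  also have "(\<Prod>v\<in>?S. ?I v) = (\<Prod>v\<in>?S. ?q v * (if v = [] then 1 else EW) / \<mu> ^ \<xi> v)"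
    by (intro prod.cong refl inner_factor)
  also have "\<dots> = (\<Prod>v\<in>?S. ?q v) * (\<Prod>v\<in>?S. if v = [] then 1 else EW) / \<mu> ^ (\<Sum>v\<in>?S. \<xi> v)"
    by (simp add: prod.distrib prod_dividef power_sum)
  finally have "(\<Prod>v\<in>?T. ?I v) = ((\<Prod>v\<in>?T - ?S. if v = [] then 1 else EW) * (\<Prod>v\<in>?S. if v = [] then 1 else EW)) *
      (\<Prod>v\<in>?S. ?q v) / \<mu> ^ (\<Sum>v\<in>?S. \<xi> v)" by simp
  also have "(\<Prod>v\<in>?T - ?S. if v = [] then 1 else EW) * (\<Prod>v\<in>?S. if v = [] then 1 else EW) = (\<Prod>v\<in>?T. if v = [] then 1 else EW)"
    by (rule prod.subset_diff[OF ST, symmetric]) simp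
  also have "\<dots> = EW ^ ?e * root_density t" by (simp add: prod_root_except cT)
  finally have T: "(\<Prod>v\<in>?T. ?I v) = EW ^ ?e * root_density t * (\<Prod>v\<in>?S. ?q v) / \<mu> ^ (\<Sum>v\<in>?S. \<xi> v)" .
  have "orderings R \<xi> * (\<Prod>v\<in>ind_below \<xi> R. offspring_prob v) = (\<Prod>v\<in>ind_below \<xi> R. ?q v)"
    by (simp add: orderings_def prod.distrib)
  also have "\<dots> = (\<Prod>v\<in>?S. ?q v) * (\<Prod>v\<in>?C. ?q v)"
    unfolding below(1) using below(2) by (intro prod.union_disjoint) auto
  finally have Q: "orderings R \<xi> * (\<Prod>v\<in>ind_below \<xi> R. offspring_prob v) = (\<Prod>v\<in>?S. ?q v) * (\<Prod>v\<in>?C. ?q v)" .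
  have "(\<Prod>c\<in>?C. size_factor p (card (tree_nbrs \<xi> c))) / EW ^ ?e * (\<Prod>v\<in>?T. ?I v) =
      root_density t * ((\<Prod>v\<in>?S. ?q v) * (\<Prod>v\<in>?C. ?q v))"
    unfolding C T cC using mu_pos EW_pos by simp
  then show ?thesis unfolding Q[symmetric] by simp
qed

end

end

section \<open>Pairs of trees\<close>

definition pair_members :: "(nat list \<Rightarrow> nat) \<Rightarrow> (nat list \<Rightarrow> nat) \<Rightarrow> nat list + nat list \<Rightarrow> (nat list + nat list) set" where
  "pair_members \<xi>1 \<xi>2 c = (case c of Inl c \<Rightarrow> Inl ` tree_nbrs \<xi>1 c | Inr c \<Rightarrow> Inr ` tree_nbrs \<xi>2 c)"

lemma pair_members_simps [simp]:
  "pair_members \<xi>1 \<xi>2 (Inl c) = Inl ` tree_nbrs \<xi>1 c" "pair_members \<xi>1 \<xi>2 (Inr c) = Inr ` tree_nbrs \<xi>2 c"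
  by (simp_all add: pair_members_def)

text \<open>\<open>h\<close> and \<open>k\<close> include the members and the groups of one tree in those of a forest. The members of the
  other trees have different labels, so their groups do not meet the explored labels of this tree.\<close>

lemma embedded_from_forest:
  assumes h: "inj h" and T: "h ` lnodes t \<xi> R \<subseteq> T" and S: "h ` inner_lnodes t \<xi> R \<subseteq> S"
    and C: "k ` rnodes t \<xi> R \<subseteq> C" and m: "\<And>c. c \<in> rnodes t \<xi> R \<Longrightarrow> m (k c) = h ` tree_nbrs \<xi> c"
    and other: "\<And>c. c \<in> C - k ` rnodes t \<xi> R \<Longrightarrow> m c \<subseteq> T - h ` lnodes t \<xi> R"
    and parity: "even R = (t = LMark)" and card2: "\<And>c. c \<in> rnodes t \<xi> R \<Longrightarrow> 2 \<le> card (tree_nbrs \<xi> c)"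
    and A: "A \<subseteq> groups n" and \<phi>: "\<phi> \<in> T \<rightarrow>\<^sub>E {1..n}" and inj: "inj_on \<phi> T" and real: "realized A C m S \<phi>"
  shows "embedded n A t \<xi> R (restrict (\<phi> \<circ> h) (lnodes t \<xi> R))"
proof -
  let ?\<psi> = "restrict (\<phi> \<circ> h) (lnodes t \<xi> R)"
  have im: "?\<psi> ` tree_nbrs \<xi> c = \<phi> ` m (k c)" if c: "c \<in> rnodes t \<xi> R" for c
  proof -
    have "?\<psi> ` tree_nbrs \<xi> c = (\<phi> \<circ> h) ` tree_nbrs \<xi> c"
      using tree_nbrs_rnodes[OF parity c] by (intro image_cong) auto
    then show ?thesis using m[OF c] by (simp add: image_comp)
  qed
  have "inj_on ?\<psi> (lnodes t \<xi> R)"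
  proof (rule inj_onI)
    fix u v assume uv: "u \<in> lnodes t \<xi> R" "v \<in> lnodes t \<xi> R" "?\<psi> u = ?\<psi> v"
    then have "h u = h v" using inj T by (auto simp: inj_on_def)
    then show "u = v" using h by (auto simp: inj_def)
  qed
  moreover have "?\<psi> \<in> lnodes t \<xi> R \<rightarrow>\<^sub>E {1..n}" using \<phi> T by (auto simp: PiE_iff)
  moreover have "realized A (rnodes t \<xi> R) (tree_nbrs \<xi>) (inner_lnodes t \<xi> R) ?\<psi>"
    unfolding realized_def
  proof (intro conjI ballI impI)
    fix c assume c: "c \<in> rnodes t \<xi> R"
    then show "?\<psi> ` tree_nbrs \<xi> c \<in> A" using im[OF c] real C by (auto simp: realized_def)
  next
    fix a assume a: "a \<in> A" "a \<inter> ?\<psi> ` inner_lnodes t \<xi> R \<noteq> {}"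
    then obtain s where s: "s \<in> inner_lnodes t \<xi> R" "\<phi> (h s) \<in> a"
      by (auto simp: inner_lnodes_def split: if_splits)
    then have "a \<inter> \<phi> ` S \<noteq> {}" using S by blast
    then obtain c where c: "c \<in> C" "a = \<phi> ` m c" using real a(1) unfolding realized_def by blast
    have "c \<in> k ` rnodes t \<xi> R"
    proof (rule ccontr)
      assume "c \<notin> k ` rnodes t \<xi> R"
      then have mc: "m c \<subseteq> T - h ` lnodes t \<xi> R" using other c(1) by blast
      obtain y where y: "y \<in> m c" "\<phi> (h s) = \<phi> y" using s(2) c(2) by blast
      have hs: "h s \<in> h ` lnodes t \<xi> R" using s(1) by (auto simp: inner_lnodes_def)
      then have "h s = y" using inj y mc T by (auto simp: inj_on_def)
      then show False using y(1) mc hs by blast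
    qed
    then obtain c' where "c' \<in> rnodes t \<xi> R" "c = k c'" by blast
    then show "a \<in> (\<lambda>c. ?\<psi> ` tree_nbrs \<xi> c) ` rnodes t \<xi> R" using c im by auto
  qed
  ultimately show ?thesis using A parity card2 by (simp add: embedded_def)
qed

lemma pair_count_le:
  fixes R1 R2 :: nat and t1 t2 \<xi>1 \<xi>2
  defines "T \<equiv> lnodes t1 \<xi>1 R1 <+> lnodes t2 \<xi>2 R2"
  defines "C \<equiv> rnodes t1 \<xi>1 R1 <+> rnodes t2 \<xi>2 R2"
  defines "S \<equiv> inner_lnodes t1 \<xi>1 R1 <+> inner_lnodes t2 \<xi>2 R2"
  assumes A: "A \<subseteq> groups n"
    and par: "even R1 = (t1 = LMark)" "even R2 = (t2 = LMark)"
    and c2: "\<And>c. c \<in> rnodes t1 \<xi>1 R1 \<Longrightarrow> 2 \<le> card (tree_nbrs \<xi>1 c)" "\<And>c. c \<in> rnodes t2 \<xi>2 R2 \<Longrightarrow> 2 \<le> card (tree_nbrs \<xi>2 c)"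
  shows "card {\<phi> \<in> {\<phi> \<in> T \<rightarrow>\<^sub>E {1..n}. inj_on \<phi> T}. realized A C (pair_members \<xi>1 \<xi>2) S \<phi>}
    \<le> card {\<phi>. embedded n A t1 \<xi>1 R1 \<phi>} * card {\<phi>. embedded n A t2 \<xi>2 R2 \<phi>}"
proof -
  let ?L = "{\<phi> \<in> {\<phi> \<in> T \<rightarrow>\<^sub>E {1..n}. inj_on \<phi> T}. realized A C (pair_members \<xi>1 \<xi>2) S \<phi>}"
  let ?f = "\<lambda>\<phi>. (restrict (\<phi> \<circ> Inl) (lnodes t1 \<xi>1 R1), restrict (\<phi> \<circ> Inr) (lnodes t2 \<xi>2 R2))"
  have "inj_on ?f ?L"
  proof (rule inj_onI)
    fix \<phi> \<psi> assume a: "\<phi> \<in> ?L" "\<psi> \<in> ?L" "?f \<phi> = ?f \<psi>"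
    have 1: "\<phi> (Inl v) = \<psi> (Inl v)" if "v \<in> lnodes t1 \<xi>1 R1" for v
      using a(3) that by (auto simp: restrict_def fun_eq_iff split: if_splits)
    have 2: "\<phi> (Inr v) = \<psi> (Inr v)" if "v \<in> lnodes t2 \<xi>2 R2" for v
      using a(3) that by (auto simp: restrict_def fun_eq_iff split: if_splits)
    have "\<phi> x = \<psi> x" if "x \<in> T" for x using that 1 2 by (auto simp: T_def)
    then show "\<phi> = \<psi>" using a(1,2) by (auto intro: PiE_ext)
  qed
  moreover have "?f ` ?L \<subseteq> {\<phi>. embedded n A t1 \<xi>1 R1 \<phi>} \<times> {\<phi>. embedded n A t2 \<xi>2 R2 \<phi>}"
  proof
    fix z assume "z \<in> ?f ` ?L"
    then obtain \<phi> where \<phi>: "\<phi> \<in> T \<rightarrow>\<^sub>E {1..n}" "inj_on \<phi> T" "realized A C (pair_members \<xi>1 \<xi>2) S \<phi>" and z: "z = ?f \<phi>"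
      by blast
    have "embedded n A t1 \<xi>1 R1 (restrict (\<phi> \<circ> Inl) (lnodes t1 \<xi>1 R1))"
      by (rule embedded_from_forest[OF _ _ _ _ _ _ par(1) c2(1) A \<phi>, where k = Inl])
        (auto simp: T_def C_def S_def dest: subsetD[OF tree_nbrs_rnodes[OF par(2)]])
    moreover have "embedded n A t2 \<xi>2 R2 (restrict (\<phi> \<circ> Inr) (lnodes t2 \<xi>2 R2))"
      by (rule embedded_from_forest[OF _ _ _ _ _ _ par(2) c2(2) A \<phi>, where k = Inr])
        (auto simp: T_def C_def S_def dest: subsetD[OF tree_nbrs_rnodes[OF par(1)]])
    ultimately show "z \<in> {\<phi>. embedded n A t1 \<xi>1 R1 \<phi>} \<times> {\<phi>. embedded n A t2 \<xi>2 R2 \<phi>}" by (simp add: z)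
  qed
  ultimately have "card ?L \<le> card ({\<phi>. embedded n A t1 \<xi>1 R1 \<phi>} \<times> {\<phi>. embedded n A t2 \<xi>2 R2 \<phi>})"
    by (rule card_inj_on_le) simp
  then show ?thesis by (simp add: card_cartesian_product)
qed

lemma sum_prob_eq_expectation_card:
  assumes "finite X"
  shows "(\<Sum>\<phi>\<in>X. measure_pmf.prob (on_groups_pmf p w n) {A. P A \<phi>}) =
    measure_pmf.expectation (on_groups_pmf p w n) (\<lambda>A. real (card {\<phi> \<in> X. P A \<phi>}))"
proof -
  have "(\<Sum>\<phi>\<in>X. measure_pmf.prob (on_groups_pmf p w n) {A. P A \<phi>}) =
      (\<Sum>\<phi>\<in>X. measure_pmf.expectation (on_groups_pmf p w n) (\<lambda>A. of_bool (P A \<phi>)))"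
    by (simp add: expectation_of_bool)
  also have "\<dots> = measure_pmf.expectation (on_groups_pmf p w n) (\<lambda>A. \<Sum>\<phi>\<in>X. of_bool (P A \<phi>))"
    by (rule Bochner_Integration.integral_sum[symmetric]) simp
  also have "(\<lambda>A. \<Sum>\<phi>\<in>X. of_bool (P A \<phi>)) = (\<lambda>A. real (card {\<phi> \<in> X. P A \<phi>}))"
    using assms by (auto simp: fun_eq_iff Int_def)
  finally show ?thesis .
qed

context converging_weights begin

abbreviation tree_prob :: "mark \<Rightarrow> nat \<Rightarrow> (nat list \<Rightarrow> nat) \<Rightarrow> real" where
  "tree_prob t R \<xi> \<equiv> \<Prod>v\<in>ind_below \<xi> R. pmf (offspring_pmf Dl p t v) (\<xi> v)"

definition admissible :: "mark \<Rightarrow> nat \<Rightarrow> (nat list \<Rightarrow> nat) \<Rightarrow> bool" where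
  "admissible t R \<xi> \<longleftrightarrow> (\<forall>c\<in>rnodes t \<xi> R. 2 \<le> card (tree_nbrs \<xi> c))"

lemma pair_count_liminf:
  fixes R1 R2 :: nat
  assumes par: "even R1 = (t1 = LMark)" "even R2 = (t2 = LMark)" and R: "1 \<le> R1" "1 \<le> R2"
    and adm: "admissible t1 R1 \<xi>1" "admissible t2 R2 \<xi>2"
    and x: "x < orderings R1 \<xi>1 * (root_density t1 * tree_prob t1 R1 \<xi>1) * (orderings R2 \<xi>2 * (root_density t2 * tree_prob t2 R2 \<xi>2))"
  shows "eventually (\<lambda>n. x \<le> mean_on n
    (\<lambda>A. real (card {\<phi>. embedded n A t1 \<xi>1 R1 \<phi>}) * real (card {\<phi>. embedded n A t2 \<xi>2 R2 \<phi>})) / (real n)\<^sup>2) sequentially"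
proof -
  define T where "T = lnodes t1 \<xi>1 R1 <+> lnodes t2 \<xi>2 R2"
  define C where "C = rnodes t1 \<xi>1 R1 <+> rnodes t2 \<xi>2 R2"
  define S where "S = inner_lnodes t1 \<xi>1 R1 <+> inner_lnodes t2 \<xi>2 R2"
  let ?m = "pair_members \<xi>1 \<xi>2"
  let ?deg = "\<lambda>t. card {c \<in> C. t \<in> ?m c}"
  let ?e = "\<Sum>c\<in>C. card (?m c) - 1"
  let ?I = "\<lambda>n. {\<phi> \<in> T \<rightarrow>\<^sub>E {1..n}. inj_on \<phi> T}"
  have c2: "2 \<le> card (tree_nbrs \<xi>1 c)" if "c \<in> rnodes t1 \<xi>1 R1" for c using adm(1) that by (simp add: admissible_def)
  have c2': "2 \<le> card (tree_nbrs \<xi>2 c)" if "c \<in> rnodes t2 \<xi>2 R2" for c using adm(2) that by (simp add: admissible_def)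
  have cm: "card (?m (Inl c)) = card (tree_nbrs \<xi>1 c)" "card (?m (Inr c)) = card (tree_nbrs \<xi>2 c)" for c
    by (simp_all add: card_image)
  have e: "?e = (\<Sum>c\<in>rnodes t1 \<xi>1 R1. card (tree_nbrs \<xi>1 c) - 1) + (\<Sum>c\<in>rnodes t2 \<xi>2 R2. card (tree_nbrs \<xi>2 c) - 1)"
    unfolding C_def by (subst sum.Plus) (simp_all add: card_image)
  have deg: "?deg (Inl v) = card {c \<in> rnodes t1 \<xi>1 R1. v \<in> tree_nbrs \<xi>1 c}" "?deg (Inr v) = card {c \<in> rnodes t2 \<xi>2 R2. v \<in> tree_nbrs \<xi>2 c}" for v
  proof -
    have "{c \<in> C. Inl v \<in> ?m c} = Inl ` {c \<in> rnodes t1 \<xi>1 R1. v \<in> tree_nbrs \<xi>1 c}" by (auto simp: C_def)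
    then show "?deg (Inl v) = card {c \<in> rnodes t1 \<xi>1 R1. v \<in> tree_nbrs \<xi>1 c}" by (simp add: card_image)
    have "{c \<in> C. Inr v \<in> ?m c} = Inr ` {c \<in> rnodes t2 \<xi>2 R2. v \<in> tree_nbrs \<xi>2 c}" by (auto simp: C_def)
    then show "?deg (Inr v) = card {c \<in> rnodes t2 \<xi>2 R2. v \<in> tree_nbrs \<xi>2 c}" by (simp add: card_image)
  qed
  have memS: "Inl v \<in> S \<longleftrightarrow> v \<in> inner_lnodes t1 \<xi>1 R1" "Inr u \<in> S \<longleftrightarrow> u \<in> inner_lnodes t2 \<xi>2 R2" for u v
    by (auto simp: S_def)
  have "eventually (\<lambda>n. x \<le> (\<Sum>\<phi>\<in>?I n. prob_on n {A. realized A C ?m S \<phi>}) / real n ^ 2) sequentially"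
  proof (rule embedding_probability_liminf)
    show "finite T" "finite C" "S \<subseteq> T" by (auto simp: T_def C_def S_def inner_lnodes_def)
    show "?m c \<subseteq> T" if "c \<in> C" for c
      using that by (auto simp: C_def T_def dest: subsetD[OF tree_nbrs_rnodes[OF par(1)]] subsetD[OF tree_nbrs_rnodes[OF par(2)]])
    show "2 \<le> card (?m c)" if "c \<in> C" for c
      using that c2 c2' by (auto simp: C_def card_image)
    show "inj_on ?m C"
    proof (rule inj_onI)
      fix c c' assume c: "c \<in> C" "c' \<in> C" "?m c = ?m c'"
      have ne: "tree_nbrs \<xi>1 u \<noteq> {}" if "u \<in> rnodes t1 \<xi>1 R1" for u using c2[OF that] by auto
      have ne': "tree_nbrs \<xi>2 u \<noteq> {}" if "u \<in> rnodes t2 \<xi>2 R2" for u using c2'[OF that] by auto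
      show "c = c'"
      proof (cases c; cases c')
        fix u u' assume u: "c = Inl u" "c' = Inl u'"
        then have "tree_nbrs \<xi>1 u = tree_nbrs \<xi>1 u'" using c(3) by (auto simp: inj_image_eq_iff)
        then show ?thesis using inj_on_tree_nbrs[of \<xi>1] c2 c u by (auto simp: C_def inj_on_def)
      next
        fix u u' assume u: "c = Inr u" "c' = Inr u'"
        then have "tree_nbrs \<xi>2 u = tree_nbrs \<xi>2 u'" using c(3) by (auto simp: inj_image_eq_iff)
        then show ?thesis using inj_on_tree_nbrs[of \<xi>2] c2' c u by (auto simp: C_def inj_on_def)
      next
        fix u u' assume u: "c = Inl u" "c' = Inr u'"
        then show ?thesis using c ne[of u] by (auto simp: C_def)
      next
        fix u u' assume u: "c = Inr u" "c' = Inl u'"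
        then show ?thesis using c ne'[of u] by (auto simp: C_def)
      qed
    qed
    show "card T = 2 + ?e"
      unfolding T_def e using card_lnodes[OF par(1) R(1) c2] card_lnodes[OF par(2) R(2) c2']
      by (simp add: card_Plus)
    show "integrable M (\<lambda>\<omega>. vertex_factor \<mu> (?deg v) (v \<in> S) (W \<omega>))" if "v \<in> T" for v
      using that integrable_tree_factor[OF par(1) R(1) c2] integrable_tree_factor[OF par(2) R(2) c2']
      by (auto simp: T_def deg memS)
    have 1: "(\<Prod>c\<in>C. size_factor p (card (?m c))) =
        (\<Prod>c\<in>rnodes t1 \<xi>1 R1. size_factor p (card (tree_nbrs \<xi>1 c))) * (\<Prod>c\<in>rnodes t2 \<xi>2 R2. size_factor p (card (tree_nbrs \<xi>2 c)))"
      unfolding C_def by (subst prod.Plus) (simp_all add: card_image)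
    have 2: "(\<Prod>v\<in>T. \<integral>\<omega>. vertex_factor \<mu> (?deg v) (v \<in> S) (W \<omega>) \<partial>M) =
       (\<Prod>v\<in>lnodes t1 \<xi>1 R1. \<integral>\<omega>. vertex_factor \<mu> (?deg (Inl v)) (Inl v \<in> S) (W \<omega>) \<partial>M) *
       (\<Prod>v\<in>lnodes t2 \<xi>2 R2. \<integral>\<omega>. vertex_factor \<mu> (?deg (Inr v)) (Inr v \<in> S) (W \<omega>) \<partial>M)"
      unfolding T_def by (subst prod.Plus) simp_all
    have "(\<Prod>c\<in>C. size_factor p (card (?m c))) / EW ^ ?e * (\<Prod>v\<in>T. \<integral>\<omega>. vertex_factor \<mu> (?deg v) (v \<in> S) (W \<omega>) \<partial>M) =
        (\<Prod>c\<in>rnodes t1 \<xi>1 R1. size_factor p (card (tree_nbrs \<xi>1 c))) / EW ^ (\<Sum>c\<in>rnodes t1 \<xi>1 R1. card (tree_nbrs \<xi>1 c) - 1) *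
        (\<Prod>v\<in>lnodes t1 \<xi>1 R1. \<integral>\<omega>. vertex_factor \<mu> (card {c \<in> rnodes t1 \<xi>1 R1. v \<in> tree_nbrs \<xi>1 c}) (v \<in> inner_lnodes t1 \<xi>1 R1) (W \<omega>) \<partial>M) *
        ((\<Prod>c\<in>rnodes t2 \<xi>2 R2. size_factor p (card (tree_nbrs \<xi>2 c))) / EW ^ (\<Sum>c\<in>rnodes t2 \<xi>2 R2. card (tree_nbrs \<xi>2 c) - 1) *
        (\<Prod>v\<in>lnodes t2 \<xi>2 R2. \<integral>\<omega>. vertex_factor \<mu> (card {c \<in> rnodes t2 \<xi>2 R2. v \<in> tree_nbrs \<xi>2 c}) (v \<in> inner_lnodes t2 \<xi>2 R2) (W \<omega>) \<partial>M))"
      unfolding 1 2 deg memS e power_add by simp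
    also have "\<dots> = orderings R1 \<xi>1 * (root_density t1 * tree_prob t1 R1 \<xi>1) * (orderings R2 \<xi>2 * (root_density t2 * tree_prob t2 R2 \<xi>2))"
      by (simp only: tree_weight[OF par(1) R(1) c2] tree_weight[OF par(2) R(2) c2'])
    finally show "x < (\<Prod>c\<in>C. size_factor p (card (?m c))) / EW ^ ?e * (\<Prod>v\<in>T. \<integral>\<omega>. vertex_factor \<mu> (?deg v) (v \<in> S) (W \<omega>) \<partial>M)"
      using x by simp
  qed
  then show ?thesis
  proof eventually_elim
    case (elim n)
    have fI: "finite (?I n)"
      by (rule finite_subset[of _ "T \<rightarrow>\<^sub>E {1..n}"]) (auto simp: T_def intro!: finite_PiE)
    have "(\<Sum>\<phi>\<in>?I n. prob_on n {A. realized A C ?m S \<phi>}) =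
        mean_on n (\<lambda>A. real (card {\<phi> \<in> ?I n. realized A C ?m S \<phi>}))"
      by (rule sum_prob_eq_expectation_card[OF fI])
    also have "\<dots> \<le> mean_on n
        (\<lambda>A. real (card {\<phi>. embedded n A t1 \<xi>1 R1 \<phi>}) * real (card {\<phi>. embedded n A t2 \<xi>2 R2 \<phi>}))"
    proof (intro integral_mono_AE AE_pmfI)
      fix A assume "A \<in> set_pmf (on_groups_pmf p w n)"
      from pair_count_le[OF on_groups_subset[OF this] par c2 c2']
      show "real (card {\<phi> \<in> ?I n. realized A C ?m S \<phi>}) \<le> real (card {\<phi>. embedded n A t1 \<xi>1 R1 \<phi>}) * real (card {\<phi>. embedded n A t2 \<xi>2 R2 \<phi>})"
        unfolding T_def C_def S_def of_nat_mult[symmetric] of_nat_le_iff by blast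
    qed auto
    finally have le: "(\<Sum>\<phi>\<in>?I n. prob_on n {A. realized A C ?m S \<phi>}) \<le>
        mean_on n
        (\<lambda>A. real (card {\<phi>. embedded n A t1 \<xi>1 R1 \<phi>}) * real (card {\<phi>. embedded n A t2 \<xi>2 R2 \<phi>}))" .
    show ?case by (rule order_trans[OF elim divide_right_mono[OF le]]) simp
  qed
qed

end

section \<open>Finite-depth events of the limit tree\<close>

definition trunc :: "nat \<Rightarrow> (nat list \<Rightarrow> nat) \<Rightarrow> nat list \<Rightarrow> nat" where
  "trunc R \<xi> v = (if v \<in> ind_below \<xi> R then \<xi> v else 0)"

lemma agree_trunc: "agree R \<xi> (trunc R \<xi>)"
  by (simp add: agree_def trunc_def)

lemma truncated_trunc: "truncated R (trunc R \<xi>)"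
  using agree_ind_below[OF agree_trunc[of R \<xi>], of R] by (simp add: truncated_def trunc_def)

lemma truncated_agree_unique:
  assumes "truncated R \<tau>" "truncated R \<tau>'" "agree R \<tau> \<xi>" "agree R \<tau>' \<xi>"
  shows "\<tau> = \<tau>'"
proof
  fix v
  have "ind_below \<tau> R = ind_below \<tau>' R"
    using agree_ind_below[OF assms(3), of R] agree_ind_below[OF assms(4), of R] by simp
  then show "\<tau> v = \<tau>' v" using assms by (cases "v \<in> ind_below \<tau> R") (auto simp: truncated_def agree_def)
qed

lemma ind_below_entries:
  assumes "\<And>v. \<xi> v \<le> k" shows "v \<in> individuals \<xi> \<Longrightarrow> set v \<subseteq> {..<k}"
proof (induction v rule: rev_induct)
  case (snoc j v)
  then show ?case using assms[of v] by auto
qed simp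

text \<open>Finite families of trees whose union over \<open>k\<close> contains every tree of depth \<open>R\<close> that satisfies \<open>Q\<close>.\<close>

definition bounded_trees :: "nat \<Rightarrow> ((nat list \<Rightarrow> nat) \<Rightarrow> bool) \<Rightarrow> nat \<Rightarrow> (nat list \<Rightarrow> nat) set" where
  "bounded_trees R Q k = {\<tau>. truncated R \<tau> \<and> (\<forall>v. \<tau> v \<le> k) \<and> Q \<tau>}"

lemma finite_bounded_trees: "finite (bounded_trees R Q k)"
proof (rule finite_subset)
  let ?A = "{xs. set xs \<subseteq> {..<k} \<and> length xs \<le> R}"
  show "bounded_trees R Q k \<subseteq> {f. \<forall>x. (x \<in> ?A \<longrightarrow> f x \<in> {..k}) \<and> (x \<notin> ?A \<longrightarrow> f x = 0)}"
  proof
    fix \<tau> assume \<tau>: "\<tau> \<in> bounded_trees R Q k"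
    have "\<tau> x = 0" if "x \<notin> ?A" for x
    proof -
      have "x \<notin> ind_below \<tau> R"
        using that ind_below_entries[of \<tau> k x] \<tau> by (auto simp: bounded_trees_def ind_below_def)
      then show ?thesis using \<tau> by (simp add: bounded_trees_def truncated_def)
    qed
    then show "\<tau> \<in> {f. \<forall>x. (x \<in> ?A \<longrightarrow> f x \<in> {..k}) \<and> (x \<notin> ?A \<longrightarrow> f x = 0)}"
      using \<tau> by (auto simp: bounded_trees_def)
  qed
  show "finite {f. \<forall>x. (x \<in> ?A \<longrightarrow> f x \<in> {..k}) \<and> (x \<notin> ?A \<longrightarrow> f x = (0::nat))}"
    by (intro finite_set_of_finite_funs finite_lists_length_le) auto
qed

lemma event_as_union:
  assumes inv: "\<And>\<xi> \<xi>'. agree R \<xi> \<xi>' \<Longrightarrow> Q \<xi> \<longleftrightarrow> Q \<xi>'"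
  shows "{\<xi>. Q \<xi>} = (\<Union>k. \<Union>\<tau>\<in>bounded_trees R Q k. {\<xi>. agree R \<tau> \<xi>})"
proof (intro equalityI subsetI)
  fix \<xi> assume "\<xi> \<in> {\<xi>. Q \<xi>}"
  then have Q: "Q (trunc R \<xi>)" using inv[OF agree_trunc] by blast
  let ?k = "Max (insert 0 (\<xi> ` ind_below \<xi> R))"
  have "trunc R \<xi> v \<le> ?k" for v
    by (auto simp: trunc_def intro!: Max_ge)
  then have "trunc R \<xi> \<in> bounded_trees R Q ?k" using Q truncated_trunc by (simp add: bounded_trees_def)
  moreover have "agree R (trunc R \<xi>) \<xi>" by (rule agree_sym[OF agree_trunc])
  ultimately show "\<xi> \<in> (\<Union>k. \<Union>\<tau>\<in>bounded_trees R Q k. {\<xi>. agree R \<tau> \<xi>})" by blast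
next
  fix \<xi> assume "\<xi> \<in> (\<Union>k. \<Union>\<tau>\<in>bounded_trees R Q k. {\<xi>. agree R \<tau> \<xi>})"
  then show "\<xi> \<in> {\<xi>. Q \<xi>}" using inv by (auto simp: bounded_trees_def)
qed

lemma product_prob_space_offspring: "product_prob_space (\<lambda>v. measure_pmf (offspring_pmf D1 D2 t v))"
  by (simp add: product_prob_space_def product_prob_space_axioms_def product_sigma_finite_def
      measure_pmf.prob_space_axioms prob_space_imp_sigma_finite)

lemma prob_space_offspring: "prob_space (offspring_measure D1 D2 t)"
  unfolding offspring_measure_def by (rule prob_space_PiM) (rule measure_pmf.prob_space_axioms)

lemma space_offspring [simp]: "space (offspring_measure D1 D2 t) = UNIV"
  by (simp add: offspring_measure_def space_PiM)

lemma agree_event: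
  "{\<xi>'. agree R \<xi> \<xi>'} \<in> sets (offspring_measure D1 D2 t)"
  "measure (offspring_measure D1 D2 t) {\<xi>'. agree R \<xi> \<xi>'} = (\<Prod>v\<in>ind_below \<xi> R. pmf (offspring_pmf D1 D2 t v) (\<xi> v))"
proof -
  interpret product_prob_space "\<lambda>v. measure_pmf (offspring_pmf D1 D2 t v)" UNIV
    by (rule product_prob_space_offspring)
  let ?N = "\<Pi>\<^sub>M v\<in>UNIV. measure_pmf (offspring_pmf D1 D2 t v)"
  have eq: "{\<xi>'. agree R \<xi> \<xi>'} = {x \<in> space ?N. \<forall>v\<in>ind_below \<xi> R. x v \<in> {\<xi> v}}"
    by (auto simp: agree_def space_PiM)
  have "{x \<in> space ?N. x v \<in> {\<xi> v}} \<in> sets ?N" for v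
  proof -
    have "(\<lambda>x. x v) -` {\<xi> v} \<inter> space ?N \<in> sets ?N"
      by (rule measurable_sets[OF measurable_component_singleton]) auto
    moreover have "(\<lambda>x. x v) -` {\<xi> v} \<inter> space ?N = {x \<in> space ?N. x v \<in> {\<xi> v}}" by auto
    ultimately show ?thesis by metis
  qed
  then have "{x \<in> space ?N. \<forall>v\<in>ind_below \<xi> R. x v \<in> {\<xi> v}} \<in> sets ?N"
    by (intro sets.sets_Collect_finite_All finite_ind_below)
  then show "{\<xi>'. agree R \<xi> \<xi>'} \<in> sets (offspring_measure D1 D2 t)"
    unfolding offspring_measure_def eq .
  have "emeasure ?N {x \<in> space ?N. \<forall>v\<in>ind_below \<xi> R. x v \<in> {\<xi> v}} =
      (\<Prod>v\<in>ind_below \<xi> R. emeasure (measure_pmf (offspring_pmf D1 D2 t v)) {\<xi> v})"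
    by (rule emeasure_PiM_Collect) auto
  also have "\<dots> = ennreal (\<Prod>v\<in>ind_below \<xi> R. pmf (offspring_pmf D1 D2 t v) (\<xi> v))"
    by (simp add: emeasure_pmf_single prod_ennreal)
  finally show "measure (offspring_measure D1 D2 t) {\<xi>'. agree R \<xi> \<xi>'} = (\<Prod>v\<in>ind_below \<xi> R. pmf (offspring_pmf D1 D2 t v) (\<xi> v))"
    unfolding offspring_measure_def eq by (intro measure_eq_emeasure_eq_ennreal prod_nonneg) auto
qed

lemma event_measurable:
  assumes inv: "\<And>\<xi> \<xi>'. agree R \<xi> \<xi>' \<Longrightarrow> Q \<xi> \<longleftrightarrow> Q \<xi>'"
  shows "{\<xi>. Q \<xi>} \<in> sets (offspring_measure D1 D2 t)"
proof -
  have eq: "{\<xi>. Q \<xi>} = (\<Union>k. \<Union>\<tau>\<in>bounded_trees R Q k. {\<xi>. agree R \<tau> \<xi>})"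
    by (rule event_as_union) (rule inv)
  show ?thesis unfolding eq
    by (intro sets.countable_UN'' sets.finite_UN finite_bounded_trees agree_event) auto
qed

lemma bounded_trees_tendsto:
  assumes inv: "\<And>\<xi> \<xi>'. agree R \<xi> \<xi>' \<Longrightarrow> Q \<xi> \<longleftrightarrow> Q \<xi>'"
  shows "(\<lambda>k. \<Sum>\<tau>\<in>bounded_trees R Q k. \<Prod>v\<in>ind_below \<tau> R. pmf (offspring_pmf D1 D2 t v) (\<tau> v))
    \<longlonglongrightarrow> measure (offspring_measure D1 D2 t) {\<xi>. Q \<xi>}"
proof -
  interpret N: prob_space "offspring_measure D1 D2 t" by (rule prob_space_offspring)
  let ?E = "\<lambda>k. \<Union>\<tau>\<in>bounded_trees R Q k. {\<xi>. agree R \<tau> \<xi>}"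
  have "incseq ?E"
  proof (rule incseq_SucI)
    fix k show "?E k \<le> ?E (Suc k)" by (auto simp: bounded_trees_def intro: le_SucI)
  qed
  moreover have "range ?E \<subseteq> sets (offspring_measure D1 D2 t)"
    by (auto intro!: sets.finite_UN finite_bounded_trees agree_event)
  ultimately have "(\<lambda>k. N.prob (?E k)) \<longlonglongrightarrow> N.prob (\<Union>k. ?E k)"
    by (intro N.finite_Lim_measure_incseq)
  moreover have "N.prob (?E k) = (\<Sum>\<tau>\<in>bounded_trees R Q k. \<Prod>v\<in>ind_below \<tau> R. pmf (offspring_pmf D1 D2 t v) (\<tau> v))" for k
  proof -
    have "disjoint_family_on (\<lambda>\<tau>. {\<xi>. agree R \<tau> \<xi>}) (bounded_trees R Q k)"
      using truncated_agree_unique by (fastforce simp: disjoint_family_on_def bounded_trees_def)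
    then have "N.prob (?E k) = (\<Sum>\<tau>\<in>bounded_trees R Q k. N.prob {\<xi>. agree R \<tau> \<xi>})"
      by (intro N.finite_measure_finite_Union finite_bounded_trees) (auto intro: agree_event)
    then show ?thesis by (simp add: agree_event)
  qed
  moreover have "{\<xi>. Q \<xi>} = (\<Union>k. ?E k)" by (rule event_as_union) (rule inv)
  ultimately show ?thesis by simp
qed

context converging_weights begin

abbreviation tree_measure :: "mark \<Rightarrow> (nat list \<Rightarrow> nat) measure" where
  "tree_measure t \<equiv> offspring_measure Dl p t"

text \<open>Groups of fewer than two members are excluded in \<open>embedded\<close>; no probability is lost, because group
  sizes are at least \<open>2\<close> almost surely.\<close>

lemma inadmissible_prob:
  assumes par: "even R = (t = LMark)" and na: "\<not> admissible t R \<xi>"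
  shows "tree_prob t R \<xi> = 0"
proof -
  obtain c where c: "c \<in> rnodes t \<xi> R" "card (tree_nbrs \<xi> c) < 2" using na by (auto simp: admissible_def not_le)
  have p0: "pmf p k = 0" if "k < 2" for k using sizes that by (force simp: pmf_eq_0_set_pmf)
  have "mark_of t c = RMark" using c by (auto simp: rnodes_def)
  then have "pmf (offspring_pmf Dl p t c) (\<xi> c) = 0"
    using c(2) by (auto simp: offspring_pmf_def card_tree_nbrs pmf_tilde_p p0 split: if_splits)
  moreover have "c \<in> ind_below \<xi> R" using rnodes_length[OF par c(1)] c(1)
    by (auto simp: rnodes_def ind_upto_def ind_below_def)
  ultimately show ?thesis by (intro prod_zero) auto
qed

lemma root_density_nonneg: "0 \<le> root_density t"
  using EW_pos by (cases t) (auto simp: root_density_def)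

definition root_count :: "mark \<Rightarrow> (nat \<Rightarrow> nat set set \<Rightarrow> nat + nat set \<Rightarrow> bool) \<Rightarrow> nat \<Rightarrow> nat set set \<Rightarrow> real" where
  "root_count t P n A = real (card {x \<in> roots t n A. P n A x}) / real n"

text \<open>The property \<open>P\<close> of a vertex holds whenever the vertex is the root of an embedded tree with
  property \<open>Q\<close>, and \<open>Q\<close> depends on the first \<open>R\<close> generations only. It is used for a property and
  its negation at the same time, and the two implications together form an equivalence.\<close>

definition witnessed :: "mark \<Rightarrow> nat \<Rightarrow> ((nat list \<Rightarrow> nat) \<Rightarrow> bool) \<Rightarrow> (nat \<Rightarrow> nat set set \<Rightarrow> nat + nat set \<Rightarrow> bool) \<Rightarrow> bool" where
  "witnessed t R Q P \<longleftrightarrow> even R = (t = LMark) \<and> 1 \<le> R \<and>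
     (\<forall>\<xi> \<xi>'. agree R \<xi> \<xi>' \<longrightarrow> Q \<xi> = Q \<xi>') \<and>
     (\<forall>n A \<xi> \<phi>. embedded n A t \<xi> R \<phi> \<and> Q \<xi> \<longrightarrow> P n A (node_map t \<xi> \<phi> []))"

text \<open>Finitely many trees carry almost all of the probability of \<open>Q1\<close> and \<open>Q2\<close>. For each pair of them the
  expected number of joint embeddings is asymptotically at least the product of the tree
  probabilities, and the embeddings counted with their weights do not exceed the numbers of roots.\<close>

lemma pair_roots_liminf:
  assumes W1: "witnessed t1 R1 Q1 P1" and W2: "witnessed t2 R2 Q2 P2" and \<delta>: "0 < \<delta>"
  shows "eventually (\<lambda>n. root_density t1 * measure (tree_measure t1) {\<xi>. Q1 \<xi>} * (root_density t2 * measure (tree_measure t2) {\<xi>. Q2 \<xi>}) - \<delta>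
    \<le> mean_on n (\<lambda>A. root_count t1 P1 n A * root_count t2 P2 n A)) sequentially"
proof -
  have par: "even R1 = (t1 = LMark)" "even R2 = (t2 = LMark)" and R: "1 \<le> R1" "1 \<le> R2"
    and inv1: "\<And>\<xi> \<xi>'. agree R1 \<xi> \<xi>' \<Longrightarrow> Q1 \<xi> = Q1 \<xi>'" and inv2: "\<And>\<xi> \<xi>'. agree R2 \<xi> \<xi>' \<Longrightarrow> Q2 \<xi> = Q2 \<xi>'"
    and P1: "\<And>n A \<xi> \<phi>. embedded n A t1 \<xi> R1 \<phi> \<Longrightarrow> Q1 \<xi> \<Longrightarrow> P1 n A (node_map t1 \<xi> \<phi> [])"
    and P2: "\<And>n A \<xi> \<phi>. embedded n A t2 \<xi> R2 \<phi> \<Longrightarrow> Q2 \<xi> \<Longrightarrow> P2 n A (node_map t2 \<xi> \<phi> [])"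
    using W1 W2 unfolding witnessed_def by blast+
  let ?lim = "root_density t1 * measure (tree_measure t1) {\<xi>. Q1 \<xi>} * (root_density t2 * measure (tree_measure t2) {\<xi>. Q2 \<xi>})"
  let ?F = "\<lambda>R Q k. bounded_trees R Q k"
  have "(\<lambda>k. root_density t1 * (\<Sum>\<tau>\<in>?F R1 Q1 k. tree_prob t1 R1 \<tau>) * (root_density t2 * (\<Sum>\<tau>\<in>?F R2 Q2 k. tree_prob t2 R2 \<tau>))) \<longlonglongrightarrow> ?lim"
    by (intro tendsto_intros bounded_trees_tendsto inv1 inv2)
  then have "eventually (\<lambda>k. ?lim - \<delta> / 2 < root_density t1 * (\<Sum>\<tau>\<in>?F R1 Q1 k. tree_prob t1 R1 \<tau>) * (root_density t2 * (\<Sum>\<tau>\<in>?F R2 Q2 k. tree_prob t2 R2 \<tau>))) sequentially"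
    using \<delta> by (intro order_tendstoD(1)) auto
  then obtain k where k: "?lim - \<delta> / 2 < root_density t1 * (\<Sum>\<tau>\<in>?F R1 Q1 k. tree_prob t1 R1 \<tau>) * (root_density t2 * (\<Sum>\<tau>\<in>?F R2 Q2 k. tree_prob t2 R2 \<tau>))"
    by (meson eventually_sequentially le_refl)
  define F1 where "F1 = ?F R1 Q1 k"
  define F2 where "F2 = ?F R2 Q2 k"
  have fin: "finite F1" "finite F2" by (simp_all add: F1_def F2_def finite_bounded_trees)
  have tr: "truncated R1 \<tau>" "Q1 \<tau>" if "\<tau> \<in> F1" for \<tau> using that by (auto simp: F1_def bounded_trees_def)
  have tr': "truncated R2 \<tau>" "Q2 \<tau>" if "\<tau> \<in> F2" for \<tau> using that by (auto simp: F2_def bounded_trees_def)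
  define v where "v \<tau> \<tau>' = root_density t1 * tree_prob t1 R1 \<tau> * (root_density t2 * tree_prob t2 R2 \<tau>')" for \<tau> \<tau>'
  define N where "N t R \<tau> n A = real (card {\<phi>. embedded n A t \<tau> R \<phi>}) / orderings R \<tau>" for t R \<tau> n A
  (* The error allowed for one pair of trees; the errors of all pairs add up to at most \<delta> / 2. *)
  define \<eta> where "\<eta> = \<delta> / 2 / (real (card F1) * real (card F2) + 1)"
  have \<eta>: "0 < \<eta>" using \<delta> by (simp add: \<eta>_def divide_pos_pos add_nonneg_pos)
  have \<eta>le: "real (card F1) * real (card F2) * \<eta> \<le> \<delta> / 2"
  proof -
    define c where "c = real (card F1) * real (card F2)"
    have "c \<ge> 0" by (simp add: c_def)
    then have "c * (\<delta> / 2 / (c + 1)) \<le> (c + 1) * (\<delta> / 2 / (c + 1))" using \<delta> by (intro mult_right_mono) auto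
    also have "\<dots> = \<delta> / 2"
    proof -
      have ne: "c + 1 \<noteq> 0" using \<open>c \<ge> 0\<close> by simp
      have "z * (x / z) = x" if "z \<noteq> 0" for x z :: real using that by simp
      from this[OF ne] show ?thesis .
    qed
    finally show ?thesis by (simp add: \<eta>_def c_def)
  qed
  let ?E = "\<lambda>n f. mean_on n f"
  have "eventually (\<lambda>n. v \<tau> \<tau>' - \<eta> \<le> ?E n (\<lambda>A. N t1 R1 \<tau> n A * N t2 R2 \<tau>' n A / (real n)\<^sup>2)) sequentially"
    if "\<tau> \<in> F1" "\<tau>' \<in> F2" for \<tau> \<tau>'
  proof (cases "admissible t1 R1 \<tau> \<and> admissible t2 R2 \<tau>'")
    case True
    let ?o = "orderings R1 \<tau> * orderings R2 \<tau>'"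
    have o: "0 < ?o" by simp
    have "eventually (\<lambda>n. ?o * (v \<tau> \<tau>' - \<eta>) \<le> ?E n
      (\<lambda>A. real (card {\<phi>. embedded n A t1 \<tau> R1 \<phi>}) * real (card {\<phi>. embedded n A t2 \<tau>' R2 \<phi>})) / (real n)\<^sup>2) sequentially"
    proof (rule pair_count_liminf[OF par R])
      show "?o * (v \<tau> \<tau>' - \<eta>) < orderings R1 \<tau> * (root_density t1 * tree_prob t1 R1 \<tau>) * (orderings R2 \<tau>' * (root_density t2 * tree_prob t2 R2 \<tau>'))"
        using mult_pos_pos[OF o \<eta>] by (simp add: v_def algebra_simps)
    qed (use True in auto)
    then show ?thesis
    proof eventually_elim
      case (elim n)
      have "v \<tau> \<tau>' - \<eta> \<le> ?E n (\<lambda>A. real (card {\<phi>. embedded n A t1 \<tau> R1 \<phi>}) * real (card {\<phi>. embedded n A t2 \<tau>' R2 \<phi>})) / (real n)\<^sup>2 / ?o"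
        using elim o by (simp only: pos_le_divide_eq mult.commute)
      also have "\<dots> = ?E n (\<lambda>A. N t1 R1 \<tau> n A * N t2 R2 \<tau>' n A / (real n)\<^sup>2)"
        by (simp add: N_def mult_ac)
      finally show ?case .
    qed
  next
    case False
    then have "v \<tau> \<tau>' = 0" using inadmissible_prob[OF par(1)] inadmissible_prob[OF par(2)] by (auto simp: v_def)
    moreover have ge: "0 \<le> ?E n (\<lambda>A. N t1 R1 \<tau> n A * N t2 R2 \<tau>' n A / (real n)\<^sup>2)" for n
      by (intro integral_nonneg_AE AE_I2) (auto simp: N_def intro!: divide_nonneg_nonneg mult_nonneg_nonneg less_imp_le[OF orderings_pos])
    ultimately have "v \<tau> \<tau>' - \<eta> \<le> ?E n (\<lambda>A. N t1 R1 \<tau> n A * N t2 R2 \<tau>' n A / (real n)\<^sup>2)" for n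
      using \<eta> ge[of n] by linarith
    then show ?thesis by (intro always_eventually allI)
  qed
  then have "eventually (\<lambda>n. \<forall>\<tau>\<in>F1. \<forall>\<tau>'\<in>F2. v \<tau> \<tau>' - \<eta> \<le> ?E n (\<lambda>A. N t1 R1 \<tau> n A * N t2 R2 \<tau>' n A / (real n)\<^sup>2)) sequentially"
    using fin by (simp add: eventually_ball_finite)
  then show ?thesis
  proof eventually_elim
    case (elim n)
    have "?lim - \<delta> \<le> (\<Sum>\<tau>\<in>F1. \<Sum>\<tau>'\<in>F2. v \<tau> \<tau>') - real (card F1) * real (card F2) * \<eta>"
    proof -
      have "(\<Sum>\<tau>\<in>F1. \<Sum>\<tau>'\<in>F2. v \<tau> \<tau>') = (\<Sum>\<tau>\<in>F1. root_density t1 * tree_prob t1 R1 \<tau>) * (\<Sum>\<tau>\<in>F2. root_density t2 * tree_prob t2 R2 \<tau>)"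
        by (simp only: v_def sum_product)
      also have "\<dots> = root_density t1 * (\<Sum>\<tau>\<in>F1. tree_prob t1 R1 \<tau>) * (root_density t2 * (\<Sum>\<tau>\<in>F2. tree_prob t2 R2 \<tau>))"
        by (simp only: sum_distrib_left)
      finally have "(\<Sum>\<tau>\<in>F1. \<Sum>\<tau>'\<in>F2. v \<tau> \<tau>') = root_density t1 * (\<Sum>\<tau>\<in>F1. tree_prob t1 R1 \<tau>) * (root_density t2 * (\<Sum>\<tau>\<in>F2. tree_prob t2 R2 \<tau>))" .
      then show ?thesis using k \<eta>le by (simp add: F1_def F2_def)
    qed
    also have "\<dots> = (\<Sum>\<tau>\<in>F1. \<Sum>\<tau>'\<in>F2. v \<tau> \<tau>' - \<eta>)"
      by (simp add: sum_subtractf)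
    also have "\<dots> \<le> (\<Sum>\<tau>\<in>F1. \<Sum>\<tau>'\<in>F2. ?E n (\<lambda>A. N t1 R1 \<tau> n A * N t2 R2 \<tau>' n A / (real n)\<^sup>2))"
      using elim by (intro sum_mono) auto
    also have "\<dots> = ?E n (\<lambda>A. \<Sum>\<tau>\<in>F1. \<Sum>\<tau>'\<in>F2. N t1 R1 \<tau> n A * N t2 R2 \<tau>' n A / (real n)\<^sup>2)"
    proof -
      have 1: "(\<Sum>\<tau>'\<in>F2. ?E n (\<lambda>A. N t1 R1 \<tau> n A * N t2 R2 \<tau>' n A / (real n)\<^sup>2)) =
          ?E n (\<lambda>A. \<Sum>\<tau>'\<in>F2. N t1 R1 \<tau> n A * N t2 R2 \<tau>' n A / (real n)\<^sup>2)" for \<tau>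
        by (rule Bochner_Integration.integral_sum[symmetric]) (rule integrable_on_groups)
      show ?thesis unfolding 1
        by (rule Bochner_Integration.integral_sum[symmetric]) (rule integrable_on_groups)
    qed
    also have "\<dots> \<le> ?E n (\<lambda>A. root_count t1 P1 n A * root_count t2 P2 n A)"
    proof (intro integral_mono_AE AE_pmfI integrable_on_groups)
      fix A assume "A \<in> set_pmf (on_groups_pmf p w n)"
      then have A: "A \<subseteq> groups n" by (rule on_groups_subset)
      have 1: "(\<Sum>\<tau>\<in>F1. N t1 R1 \<tau> n A) \<le> real (card {x \<in> roots t1 n A. P1 n A x})"
        unfolding N_def by (rule embedded_count_bound[OF A fin(1) tr(1)]) (use P1 tr in auto)
      have 2: "(\<Sum>\<tau>\<in>F2. N t2 R2 \<tau> n A) \<le> real (card {x \<in> roots t2 n A. P2 n A x})"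
        unfolding N_def by (rule embedded_count_bound[OF A fin(2) tr'(1)]) (use P2 tr' in auto)
      have "(\<Sum>\<tau>\<in>F1. \<Sum>\<tau>'\<in>F2. N t1 R1 \<tau> n A * N t2 R2 \<tau>' n A / (real n)\<^sup>2) =
          (\<Sum>\<tau>\<in>F1. N t1 R1 \<tau> n A) * (\<Sum>\<tau>\<in>F2. N t2 R2 \<tau> n A) / (real n)\<^sup>2"
        by (simp add: sum_product sum_divide_distrib)
      also have "\<dots> \<le> real (card {x \<in> roots t1 n A. P1 n A x}) * real (card {x \<in> roots t2 n A. P2 n A x}) / (real n)\<^sup>2"
        using 1 2 by (intro divide_right_mono mult_mono sum_nonneg) (auto simp: N_def less_imp_le[OF orderings_pos])
      also have "\<dots> = root_count t1 P1 n A * root_count t2 P2 n A"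
        by (simp add: root_count_def power2_eq_square)
      finally show "(\<Sum>\<tau>\<in>F1. \<Sum>\<tau>'\<in>F2. N t1 R1 \<tau> n A * N t2 R2 \<tau>' n A / (real n)\<^sup>2) \<le> root_count t1 P1 n A * root_count t2 P2 n A" .
    qed
    finally show ?case .
  qed
qed

end

section \<open>From second moments to convergence in probability\<close>

text \<open>By the upper bound on the second moment of \<open>a + b\<close>, the three lower bounds are asymptotically sharp.
  So the second moment of \<open>\<beta> a - \<alpha> b\<close> tends to \<open>0\<close>, and this random variable controls the ratio because
  \<open>a + b\<close> is at least \<open>1\<close>.\<close>

lemma ratio_convergence:
  fixes q :: "nat \<Rightarrow> 's pmf" and a b f :: "nat \<Rightarrow> 's \<Rightarrow> real"
  assumes fin: "\<And>n. finite (set_pmf (q n))"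
    and nonneg: "\<And>n s. 0 \<le> a n s" "\<And>n s. 0 \<le> b n s"
    and ge1: "\<And>n s. 1 \<le> n \<Longrightarrow> s \<in> set_pmf (q n) \<Longrightarrow> 1 \<le> a n s + b n s"
    and f: "\<And>n s. 1 \<le> n \<Longrightarrow> s \<in> set_pmf (q n) \<Longrightarrow> f n s = a n s / (a n s + b n s)"
    and lim: "0 \<le> \<alpha>" "0 \<le> \<beta>" "0 < \<alpha> + \<beta>"
    and aa: "\<And>\<delta>. 0 < \<delta> \<Longrightarrow> eventually (\<lambda>n. \<alpha> * \<alpha> - \<delta> \<le> measure_pmf.expectation (q n) (\<lambda>s. a n s * a n s)) sequentially"
    and ab: "\<And>\<delta>. 0 < \<delta> \<Longrightarrow> eventually (\<lambda>n. \<alpha> * \<beta> - \<delta> \<le> measure_pmf.expectation (q n) (\<lambda>s. a n s * b n s)) sequentially"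
    and bb: "\<And>\<delta>. 0 < \<delta> \<Longrightarrow> eventually (\<lambda>n. \<beta> * \<beta> - \<delta> \<le> measure_pmf.expectation (q n) (\<lambda>s. b n s * b n s)) sequentially"
    and tot: "\<And>\<delta>. 0 < \<delta> \<Longrightarrow> eventually (\<lambda>n. measure_pmf.expectation (q n) (\<lambda>s. (a n s + b n s)\<^sup>2) \<le> (\<alpha> + \<beta>)\<^sup>2 + \<delta>) sequentially"
    and \<epsilon>: "0 < \<epsilon>"
  shows "(\<lambda>n. measure_pmf.prob (q n) {s. \<bar>f n s - \<alpha> / (\<alpha> + \<beta>)\<bar> > \<epsilon>}) \<longlonglongrightarrow> 0"
proof (rule tendstoI)
  fix e :: real assume e: "0 < e"
  define c where "c = (\<epsilon> * (\<alpha> + \<beta>))\<^sup>2"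
  define K where "K = 4 * \<beta>\<^sup>2 + 2 * (\<alpha> * \<beta>) + 4 * \<alpha>\<^sup>2 + 1"
  (* If the four assumed bounds hold with error \<delta>, the second moment of \<beta> a - \<alpha> b is at most
     (K - 1) \<delta>, and Chebyshev's inequality divides by c. *)
  define \<delta> where "\<delta> = e * c / (2 * K)"
  have c: "0 < c" using \<epsilon> lim by (simp add: c_def)
  have "0 \<le> 4 * \<beta>\<^sup>2 + 2 * (\<alpha> * \<beta>) + 4 * \<alpha>\<^sup>2" using lim by (intro add_nonneg_nonneg mult_nonneg_nonneg) auto
  then have K: "0 < K" by (simp add: K_def)
  have \<delta>: "0 < \<delta>" using e c K by (simp add: \<delta>_def)
  have int: "integrable (measure_pmf (q n)) g" for n and g :: "'s \<Rightarrow> real"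
    by (rule integrable_measure_pmf_finite[OF fin])
  have "eventually (\<lambda>n. measure_pmf.prob (q n) {s. \<bar>f n s - \<alpha> / (\<alpha> + \<beta>)\<bar> > \<epsilon>} < e) sequentially"
    using aa[OF \<delta>] ab[OF \<delta>] bb[OF \<delta>] tot[OF \<delta>] eventually_ge_at_top[of 1]
  proof eventually_elim
    case (elim n)
    let ?E = "measure_pmf.expectation (q n)"
    let ?aa = "?E (\<lambda>s. a n s * a n s)" and ?ab = "?E (\<lambda>s. a n s * b n s)" and ?bb = "?E (\<lambda>s. b n s * b n s)"
    let ?Z = "\<lambda>s. (\<beta> * a n s - \<alpha> * b n s)\<^sup>2"
    have "?E (\<lambda>s. (a n s + b n s)\<^sup>2) = ?E (\<lambda>s. a n s * a n s + 2 * (a n s * b n s) + b n s * b n s)"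
      by (simp add: power2_eq_square algebra_simps)
    also have "\<dots> = ?aa + 2 * ?ab + ?bb" using int by simp
    finally have tot': "?aa + 2 * ?ab + ?bb \<le> (\<alpha> + \<beta>)\<^sup>2 + \<delta>" using elim by simp
    have sq: "(\<alpha> + \<beta>)\<^sup>2 = \<alpha> * \<alpha> + 2 * (\<alpha> * \<beta>) + \<beta> * \<beta>" by (simp add: power2_eq_square algebra_simps)
    have up: "?aa \<le> \<alpha> * \<alpha> + 4 * \<delta>" "?bb \<le> \<beta> * \<beta> + 4 * \<delta>" using tot' sq elim by linarith+
    have "?E ?Z = ?E (\<lambda>s. \<beta>\<^sup>2 * (a n s * a n s) - 2 * (\<alpha> * \<beta>) * (a n s * b n s) + \<alpha>\<^sup>2 * (b n s * b n s))"
      by (simp add: power2_eq_square algebra_simps)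
    also have "\<dots> = \<beta>\<^sup>2 * ?aa - 2 * (\<alpha> * \<beta>) * ?ab + \<alpha>\<^sup>2 * ?bb" using int by simp
    also have "\<dots> \<le> \<beta>\<^sup>2 * (\<alpha> * \<alpha> + 4 * \<delta>) - 2 * (\<alpha> * \<beta>) * (\<alpha> * \<beta> - \<delta>) + \<alpha>\<^sup>2 * (\<beta> * \<beta> + 4 * \<delta>)"
      using up elim lim by (intro add_mono diff_mono mult_left_mono) auto
    also have "\<dots> = \<delta> * (K - 1)" by (simp add: K_def power2_eq_square algebra_simps)
    also have "\<dots> < \<delta> * K" using \<delta> by simp
    finally have Z: "?E ?Z < e * c / 2" using K by (simp add: \<delta>_def)
    have "measure_pmf.prob (q n) {s. \<bar>f n s - \<alpha> / (\<alpha> + \<beta>)\<bar> > \<epsilon>} = ?E (\<lambda>s. of_bool (\<bar>f n s - \<alpha> / (\<alpha> + \<beta>)\<bar> > \<epsilon>))"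
      by (simp only: expectation_of_bool)
    also have "\<dots> \<le> ?E (\<lambda>s. ?Z s / c)"
    proof (intro integral_mono_AE AE_pmfI int)
      fix s assume s: "s \<in> set_pmf (q n)"
      show "of_bool (\<bar>f n s - \<alpha> / (\<alpha> + \<beta>)\<bar> > \<epsilon>) \<le> ?Z s / c"
      proof (cases "\<bar>f n s - \<alpha> / (\<alpha> + \<beta>)\<bar> > \<epsilon>")
        case True
        have g: "1 \<le> a n s + b n s" by (rule ge1) (use elim s in auto)
        have "f n s - \<alpha> / (\<alpha> + \<beta>) = a n s / (a n s + b n s) - \<alpha> / (\<alpha> + \<beta>)" using f[OF _ s] elim by simp
        also have "\<dots> = (\<beta> * a n s - \<alpha> * b n s) / ((a n s + b n s) * (\<alpha> + \<beta>))"
          using g lim by (simp add: diff_frac_eq) (simp add: algebra_simps)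
        finally have "\<bar>f n s - \<alpha> / (\<alpha> + \<beta>)\<bar> = \<bar>\<beta> * a n s - \<alpha> * b n s\<bar> / ((a n s + b n s) * (\<alpha> + \<beta>))"
          using g lim by (simp add: abs_mult)
        also have "\<dots> \<le> \<bar>\<beta> * a n s - \<alpha> * b n s\<bar> / (1 * (\<alpha> + \<beta>))"
          using g lim by (intro divide_left_mono mult_right_mono) auto
        finally have "\<epsilon> < \<bar>\<beta> * a n s - \<alpha> * b n s\<bar> / (\<alpha> + \<beta>)" using True by simp
        then have "\<epsilon> * (\<alpha> + \<beta>) \<le> \<bar>\<beta> * a n s - \<alpha> * b n s\<bar>"
          using lim by (simp add: pos_less_divide_eq less_imp_le)
        then have "c \<le> \<bar>\<beta> * a n s - \<alpha> * b n s\<bar>\<^sup>2"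
          unfolding c_def using \<epsilon> lim by (intro power_mono) auto
        then show ?thesis using True c by simp
      qed (use c in simp)
    qed
    also have "\<dots> = ?E ?Z / c" by simp
    also have "\<dots> < e" using Z c mult_pos_pos[OF c e] by (simp add: field_simps)
    finally show ?case .
  qed
  then show "eventually (\<lambda>n. dist (measure_pmf.prob (q n) {s. \<bar>f n s - \<alpha> / (\<alpha> + \<beta>)\<bar> > \<epsilon>}) 0 < e) sequentially"
    by simp
qed

section \<open>The random graphs and the limit graphs\<close>

lemma mgraph_bgrg: "A \<subseteq> groups n \<Longrightarrow> mgraph (bgrg_graph n A)"
  by (auto simp: mgraph_def bgrg_graph_def groups_def)

lemma mgraph_drig:
  assumes "A \<subseteq> groups n" shows "mgraph (drig_graph n A)"
proof -
  have "i \<in> {1..n} \<and> j \<in> {1..n}" if "0 < card {a \<in> A. i \<in> a \<and> j \<in> a}" for i j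
  proof -
    have "{a \<in> A. i \<in> a \<and> j \<in> a} \<noteq> {}" using that by force
    then obtain a where "a \<in> A" "i \<in> a" "j \<in> a" by blast
    then show ?thesis using assms unfolding groups_def by blast
  qed
  then show ?thesis by (auto simp: mgraph_def drig_graph_def conj_commute split: if_splits)
qed

lemma rooted_mgraph_bp_tree: "rooted_mgraph (bp_tree \<xi>) []"
  by (auto simp: rooted_mgraph_def mgraph_def bp_tree_def)

lemma rooted_mgraph_cp_graph: "rooted_mgraph (cp_graph \<xi>) []"
  by (auto simp: rooted_mgraph_def mgraph_def cp_graph_def Let_def)

lemma finite_roots: "A \<subseteq> groups n \<Longrightarrow> finite (roots t n A)"
  using finite_subset[OF _ finite_groups] by (cases t) (auto simp: roots_def)

lemma vertices_bgrg_roots: "vertices (bgrg_graph n A) = roots LMark n A \<union> roots RMark n A"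
  by (simp add: bgrg_graph_def roots_def)

lemma card_vertices_bgrg:
  assumes "A \<subseteq> groups n"
  shows "card (vertices (bgrg_graph n A)) = n + card A"
proof -
  have "finite A" using finite_subset[OF assms finite_groups] .
  then show ?thesis unfolding bgrg_graph_def by simp (subst card_Un_disjoint; auto simp: card_image)
qed

lemma card_filter_compl:
  assumes "finite X"
  shows "real (card {x \<in> X. P x}) + real (card {x \<in> X. \<not> P x}) = real (card X)"
proof -
  have "card X = card ({x \<in> X. P x} \<union> {x \<in> X. \<not> P x})" by (rule arg_cong[where f = card]) auto
  also have "\<dots> = card {x \<in> X. P x} + card {x \<in> X. \<not> P x}" using assms by (intro card_Un_disjoint) auto
  finally show ?thesis by simp
qed

lemma card_filter_vertices_bgrg:
  assumes "A \<subseteq> groups n"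
  shows "real (card {x \<in> vertices (bgrg_graph n A). P x}) =
    real (card {x \<in> roots LMark n A. P x}) + real (card {x \<in> roots RMark n A. P x})"
proof -
  have "{x \<in> vertices (bgrg_graph n A). P x} = {x \<in> roots LMark n A. P x} \<union> {x \<in> roots RMark n A. P x}"
    by (auto simp: vertices_bgrg_roots)
  moreover have "{x \<in> roots LMark n A. P x} \<inter> {x \<in> roots RMark n A. P x} = {}" by (auto simp: roots_def)
  ultimately show ?thesis using finite_roots[OF assms] by (simp add: card_Un_disjoint)
qed

lemma nbhd_fraction_card:
  assumes "finite (vertices G)"
  shows "nbhd_fraction G r H y = real (card {x \<in> vertices G. rooted_iso (nbhd G x r) x H y}) / real (card (vertices G))"
  using assms by (simp add: nbhd_fraction_def Int_def)

lemma measure_pair_Times: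
  assumes "prob_space M2" "A \<in> sets M1" "B \<in> sets M2"
  shows "measure (M1 \<Otimes>\<^sub>M M2) (A \<times> B) = measure M1 A * measure M2 B"
proof -
  interpret prob_space M2 by fact
  show ?thesis using assms by (simp add: measure_def emeasure_pair_measure_Times enn2real_mult)
qed

context converging_weights begin

text \<open>The mark is independent of the trees, and its law is proportional to \<open>root_density\<close>.\<close>

lemma bp_gamma_event:
  assumes Ql: "{\<xi>. Q \<xi>} \<in> sets (tree_measure LMark)" and Qr: "{\<xi>. Q \<xi>} \<in> sets (tree_measure RMark)"
  defines "N \<equiv> bp_gamma_measure EW Dl p"
  defines "X \<equiv> {\<omega> \<in> space N. case \<omega> of (g, \<xi>l, \<xi>r) \<Rightarrow> (case g of LMark \<Rightarrow> Q \<xi>l | RMark \<Rightarrow> Q \<xi>r)}"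
  shows "prob_space N" "X \<in> sets N"
    "measure N X = (root_density LMark * measure (tree_measure LMark) {\<xi>. Q \<xi>} + root_density RMark * measure (tree_measure RMark) {\<xi>. Q \<xi>}) / (1 + EW)"
proof -
  let ?L = "tree_measure LMark" and ?R = "tree_measure RMark" and ?g = "measure_pmf (gamma_pmf EW)"
  interpret L: prob_space ?L by (rule prob_space_offspring)
  interpret R: prob_space ?R by (rule prob_space_offspring)
  interpret LR: pair_prob_space ?L ?R ..
  have LRp: "prob_space (?L \<Otimes>\<^sub>M ?R)" by (rule LR.prob_space_axioms)
  interpret G: pair_prob_space ?g "?L \<Otimes>\<^sub>M ?R"
    by (simp add: pair_prob_space_def pair_sigma_finite_def LRp measure_pmf.prob_space_axioms prob_space_imp_sigma_finite)
  have N: "N = ?g \<Otimes>\<^sub>M (?L \<Otimes>\<^sub>M ?R)" by (simp add: N_def bp_gamma_measure_def)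
  show "prob_space N" unfolding N by (rule G.prob_space_axioms)
  let ?QL = "{\<xi>. Q \<xi>} \<times> (UNIV :: (nat list \<Rightarrow> nat) set)" and ?QR = "(UNIV :: (nat list \<Rightarrow> nat) set) \<times> {\<xi>. Q \<xi>}"
  have UL: "UNIV \<in> sets ?L" using sets.top[of ?L] by simp
  have UR: "UNIV \<in> sets ?R" using sets.top[of ?R] by simp
  have sQ: "?QL \<in> sets (?L \<Otimes>\<^sub>M ?R)" "?QR \<in> sets (?L \<Otimes>\<^sub>M ?R)" using Ql Qr UL UR by auto
  have X: "X = {LMark} \<times> ?QL \<union> {RMark} \<times> ?QR"
    by (auto simp: X_def N space_pair_measure split: mark.splits)
  have s: "{LMark} \<times> ?QL \<in> sets N" "{RMark} \<times> ?QR \<in> sets N" unfolding N using sQ by auto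
  then show "X \<in> sets N" unfolding X by auto
  have m: "measure (?L \<Otimes>\<^sub>M ?R) ?QL = measure ?L {\<xi>. Q \<xi>}" "measure (?L \<Otimes>\<^sub>M ?R) ?QR = measure ?R {\<xi>. Q \<xi>}"
    using measure_pair_Times[OF prob_space_offspring Ql UR] measure_pair_Times[OF prob_space_offspring UL Qr]
      L.prob_space R.prob_space by simp_all
  have g: "pmf (gamma_pmf EW) LMark = 1 / (1 + EW)" "pmf (gamma_pmf EW) RMark = EW / (1 + EW)"
  proof -
    have v: "(\<lambda>b. if b then LMark else RMark) -` {LMark} = {True}" "(\<lambda>b. if b then LMark else RMark) -` {RMark} = {False}"
      by (auto split: if_splits)
    show "pmf (gamma_pmf EW) LMark = 1 / (1 + EW)"
      using EW_pos by (simp add: gamma_pmf_def pmf_map v measure_pmf_single)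
    show "pmf (gamma_pmf EW) RMark = EW / (1 + EW)"
      using EW_pos by (simp add: gamma_pmf_def pmf_map v measure_pmf_single field_simps)
  qed
  have "measure N X = measure N ({LMark} \<times> ?QL) + measure N ({RMark} \<times> ?QR)"
    unfolding X using s N by (intro G.finite_measure_Union[folded N]) auto
  also have "\<dots> = 1 / (1 + EW) * measure ?L {\<xi>. Q \<xi>} + EW / (1 + EW) * measure ?R {\<xi>. Q \<xi>}"
    unfolding N using measure_pair_Times[OF LRp _ sQ(1), of "{LMark}" ?g] measure_pair_Times[OF LRp _ sQ(2), of "{RMark}" ?g]
    by (simp add: m g measure_pmf_single)
  finally show "measure N X = (root_density LMark * measure ?L {\<xi>. Q \<xi>} + root_density RMark * measure ?R {\<xi>. Q \<xi>}) / (1 + EW)"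
    by (simp add: root_density_def add_divide_distrib)
qed

lemma witnessed_bgrg:
  assumes "even R = (t = LMark)" "1 \<le> R" "r \<le> R"
  shows "witnessed t R (\<lambda>\<xi>. rooted_iso (nbhd (bp_tree \<xi>) [] r) [] H y)
      (\<lambda>n A x. rooted_iso (nbhd (bgrg_graph n A) x r) x H y)"
    "witnessed t R (\<lambda>\<xi>. \<not> rooted_iso (nbhd (bp_tree \<xi>) [] r) [] H y)
      (\<lambda>n A x. \<not> rooted_iso (nbhd (bgrg_graph n A) x r) x H y)"
proof -
  have root: "[] \<in> vertices (nbhd (bp_tree \<xi>) [] r)" for \<xi> by (rule root_in_nbhd) simp
  have 1: "rooted_iso (nbhd (bp_tree \<xi>) [] r) [] H y = rooted_iso (nbhd (bp_tree \<xi>') [] r) [] H y" if "agree R \<xi> \<xi>'" for \<xi> \<xi>'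
    using rooted_iso_cong[OF bp_tree_ball_agree[OF that assms(3)] root] .
  have 2: "rooted_iso (nbhd (bp_tree \<xi>) [] r) [] H y =
      rooted_iso (nbhd (bgrg_graph n A) (node_map t \<xi> \<phi> []) r) (node_map t \<xi> \<phi> []) H y" if "embedded n A t \<xi> R \<phi>" for n A \<xi> \<phi>
    using rooted_iso_cong[OF bgrg_ball_iso[OF that assms(3)] root] .
  show "witnessed t R (\<lambda>\<xi>. rooted_iso (nbhd (bp_tree \<xi>) [] r) [] H y)
      (\<lambda>n A x. rooted_iso (nbhd (bgrg_graph n A) x r) x H y)"
    "witnessed t R (\<lambda>\<xi>. \<not> rooted_iso (nbhd (bp_tree \<xi>) [] r) [] H y)
      (\<lambda>n A x. \<not> rooted_iso (nbhd (bgrg_graph n A) x r) x H y)"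
    using assms(1,2) 1 2 unfolding witnessed_def by blast+
qed

lemma witnessed_drig:
  assumes "even R" "2 * r + 1 \<le> R"
  shows "witnessed LMark R (\<lambda>\<xi>. rooted_iso (nbhd (cp_graph \<xi>) [] r) [] H y)
      (\<lambda>n A x. rooted_iso (nbhd (drig_graph n A) (projl x) r) (projl x) H y)"
    "witnessed LMark R (\<lambda>\<xi>. \<not> rooted_iso (nbhd (cp_graph \<xi>) [] r) [] H y)
      (\<lambda>n A x. \<not> rooted_iso (nbhd (drig_graph n A) (projl x) r) (projl x) H y)"
proof -
  have root: "[] \<in> vertices (nbhd (cp_graph \<xi>) [] r)" for \<xi> by (rule root_in_nbhd) (simp add: vertices_cp_graph)
  have 1: "rooted_iso (nbhd (cp_graph \<xi>) [] r) [] H y = rooted_iso (nbhd (cp_graph \<xi>') [] r) [] H y" if "agree R \<xi> \<xi>'" for \<xi> \<xi>'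
    using rooted_iso_cong[OF cp_graph_ball_agree[OF that assms(2)] root] .
  have 2: "rooted_iso (nbhd (cp_graph \<xi>) [] r) [] H y =
      rooted_iso (nbhd (drig_graph n A) (projl (node_map LMark \<xi> \<phi> [])) r) (projl (node_map LMark \<xi> \<phi> [])) H y"
    if "embedded n A LMark \<xi> R \<phi>" for n A \<xi> \<phi>
    using rooted_iso_cong[OF drig_ball_iso[OF that refl assms(2)] root] by (simp add: node_map_def)
  show "witnessed LMark R (\<lambda>\<xi>. rooted_iso (nbhd (cp_graph \<xi>) [] r) [] H y)
      (\<lambda>n A x. rooted_iso (nbhd (drig_graph n A) (projl x) r) (projl x) H y)"
    "witnessed LMark R (\<lambda>\<xi>. \<not> rooted_iso (nbhd (cp_graph \<xi>) [] r) [] H y)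
      (\<lambda>n A x. \<not> rooted_iso (nbhd (drig_graph n A) (projl x) r) (projl x) H y)"
    using assms 1 2 unfolding witnessed_def by auto
qed

lemma measure_compl_tree:
  assumes "{\<xi>. Q \<xi>} \<in> sets (tree_measure t)"
  shows "measure (tree_measure t) {\<xi>. \<not> Q \<xi>} = 1 - measure (tree_measure t) {\<xi>. Q \<xi>}"
proof -
  interpret prob_space "tree_measure t" by (rule prob_space_offspring)
  have "{\<xi>. \<not> Q \<xi>} = space (tree_measure t) - {\<xi>. Q \<xi>}" by auto
  then show ?thesis using prob_compl[OF assms] by simp
qed

text \<open>The normalized number of vertices of the bipartite graph is \<open>1 + card A / n\<close>.\<close>

lemma total_second_moment:
  assumes \<delta>: "0 < \<delta>"
  shows "eventually (\<lambda>n. mean_on n (\<lambda>A. (1 + real (card A) / real n)\<^sup>2) \<le> (1 + EW)\<^sup>2 + \<delta>) sequentially"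
proof -
  let ?l = "\<lambda>n. total_weight w n / real n"
  have "(\<lambda>n. 1 / real n) \<longlonglongrightarrow> 0" by (rule lim_1_over_n)
  then have "(\<lambda>n. 1 + 2 * ?l n + (?l n * ?l n + ?l n * (1 / real n))) \<longlonglongrightarrow> 1 + 2 * EW + (EW * EW + EW * 0)"
    by (intro tendsto_intros total_weight_ratio)
  then have "eventually (\<lambda>n. 1 + 2 * ?l n + (?l n * ?l n + ?l n * (1 / real n)) < (1 + EW)\<^sup>2 + \<delta>) sequentially"
    by (rule order_tendstoD(2)) (use \<delta> in \<open>simp add: power2_eq_square algebra_simps\<close>)
  then show ?thesis using eventually_ge_at_top[of 1]
  proof eventually_elim
    case (elim n)
    let ?E = "mean_on n"
    have n: "0 < real n" using elim by simp
    have sm: "?E (\<lambda>A. real (card A)) \<le> total_weight w n" "?E (\<lambda>A. (real (card A))\<^sup>2) \<le> (total_weight w n)\<^sup>2 + total_weight w n"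
      by (rule second_moment_groups[OF weights_nonneg total_weight_pos]; use elim in simp)+
    have "?E (\<lambda>A. (1 + real (card A) / real n)\<^sup>2) = ?E (\<lambda>A. 1 + 2 / real n * real (card A) + 1 / (real n)\<^sup>2 * (real (card A))\<^sup>2)"
      by (simp add: power2_eq_square algebra_simps)
    also have "\<dots> = 1 + 2 / real n * ?E (\<lambda>A. real (card A)) + 1 / (real n)\<^sup>2 * ?E (\<lambda>A. (real (card A))\<^sup>2)"
      by (simp add: integrable_on_groups)
    also have "\<dots> \<le> 1 + 2 / real n * total_weight w n + 1 / (real n)\<^sup>2 * ((total_weight w n)\<^sup>2 + total_weight w n)"
      by (intro add_mono mult_left_mono sm order_refl) auto
    also have "\<dots> = 1 + 2 * ?l n + (?l n * ?l n + ?l n * (1 / real n))"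
      using n by (simp add: power2_eq_square field_simps)
    finally show ?case using elim by simp
  qed
qed

lemma root_count_nonneg: "0 \<le> root_count t P n A" by (simp add: root_count_def)

lemma root_count_compl:
  assumes "A \<subseteq> groups n"
  shows "root_count t P n A + root_count t (\<lambda>n A x. \<not> P n A x) n A = real (card (roots t n A)) / real n"
  using card_filter_compl[OF finite_roots[OF assms, of t], of "P n A"]
  by (simp add: root_count_def add_divide_distrib[symmetric])

lemma card_roots: "card (roots LMark n A) = n" "card (roots RMark n A) = card A"
  by (simp_all add: roots_def card_image)

lemma pair_roots_liminf_sum:
  assumes W: "\<And>t. witnessed t (R t) (Q t) P" "\<And>t. witnessed t (R t) (Q' t) P'" and \<delta>: "0 < \<delta>"
  shows "eventually (\<lambda>n. (\<Sum>t\<in>{LMark, RMark}. root_density t * measure (tree_measure t) {\<xi>. Q t \<xi>}) *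
      (\<Sum>t\<in>{LMark, RMark}. root_density t * measure (tree_measure t) {\<xi>. Q' t \<xi>}) - \<delta>
    \<le> mean_on n (\<lambda>A. (\<Sum>t\<in>{LMark, RMark}. root_count t P n A) * (\<Sum>t\<in>{LMark, RMark}. root_count t P' n A))) sequentially"
proof -
  have \<delta>4: "0 < \<delta> / 4" using \<delta> by simp
  note L = pair_roots_liminf[OF W(1) W(2) \<delta>4]
  show ?thesis
    using L[of LMark LMark] L[of LMark RMark] L[of RMark LMark] L[of RMark RMark]
  proof eventually_elim
    case (elim n)
    have "mean_on n (\<lambda>A. (\<Sum>t\<in>{LMark, RMark}. root_count t P n A) * (\<Sum>t\<in>{LMark, RMark}. root_count t P' n A))
     = mean_on n (\<lambda>A. root_count LMark P n A * root_count LMark P' n A + root_count LMark P n A * root_count RMark P' n A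
       + root_count RMark P n A * root_count LMark P' n A + root_count RMark P n A * root_count RMark P' n A)"
      by (simp add: algebra_simps)
    then show ?case using elim by (simp add: integrable_on_groups algebra_simps)
  qed
qed

theorem bgrg_converges:
  "converges_locally_in_probability (BGRG p w) (bp_gamma_measure EW Dl p) bp_gamma_tree (\<lambda>_. [])"
  unfolding converges_locally_in_probability_def
proof (intro conjI allI impI ballI)
  fix n g assume "g \<in> set_pmf (BGRG p w n)"
  then obtain A where "g = bgrg_graph n A" "A \<subseteq> groups n"
    unfolding BGRG_def using on_groups_subset by auto
  then show "mgraph g" "finite (vertices g)" using mgraph_bgrg finite_vertices_bgrg by auto
next
  fix K :: nat
  have "eventually (\<lambda>n. measure_pmf.prob (BGRG p w n) {g. card (vertices g) \<le> K} = 0) sequentially"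
  proof (rule eventually_sequentiallyI[of "Suc K"])
    fix n assume n: "Suc K \<le> n"
    have "card (vertices g) > K" if "g \<in> set_pmf (BGRG p w n)" for g
    proof -
      obtain A where "g = bgrg_graph n A" "A \<subseteq> groups n"
        using \<open>g \<in> set_pmf (BGRG p w n)\<close> on_groups_subset unfolding BGRG_def by auto
      then show ?thesis using n by (simp add: card_vertices_bgrg)
    qed
    then show "measure_pmf.prob (BGRG p w n) {g. card (vertices g) \<le> K} = 0"
      by (force simp: measure_pmf_zero_iff)
  qed
  then show "(\<lambda>n. measure_pmf.prob (BGRG p w n) {g. card (vertices g) \<le> K}) \<longlonglongrightarrow> 0"
    by (rule tendsto_eventually)
next
  show "prob_space (bp_gamma_measure EW Dl p)"
    by (rule bp_gamma_event(1)[of "\<lambda>_. True"]) (use sets.top[of "tree_measure _"] in auto)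
next
  fix \<omega> :: "mark \<times> (nat list \<Rightarrow> nat) \<times> (nat list \<Rightarrow> nat)"
  show "rooted_mgraph (bp_gamma_tree \<omega>) []"
    by (cases \<omega>; cases "fst \<omega>") (auto simp: bp_gamma_tree_def rooted_mgraph_bp_tree)
next
  fix H :: "nat mgraph" and y r
  let ?Q = "\<lambda>\<xi>. rooted_iso (nbhd (bp_tree \<xi>) [] r) [] H y"
  let ?P = "\<lambda>n A x. rooted_iso (nbhd (bgrg_graph n A) x r) x H y"
  (* Depths of at least r for which the last generation has mark l. *)
  let ?R = "\<lambda>t. if t = LMark then 2 * r + 2 else 2 * r + 1"
  let ?N = "bp_gamma_measure EW Dl p"
  have wit: "witnessed t (?R t) ?Q ?P" "witnessed t (?R t) (\<lambda>\<xi>. \<not> ?Q \<xi>) (\<lambda>n A x. \<not> ?P n A x)" for t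
    by (rule witnessed_bgrg; cases t; simp)+
  have meas: "{\<xi>. ?Q \<xi>} \<in> sets (tree_measure t)" for t
    by (rule event_measurable[of "?R t"]) (use wit(1)[of t] in \<open>auto simp: witnessed_def\<close>)
  have X: "{\<omega> \<in> space ?N. rooted_iso (nbhd (bp_gamma_tree \<omega>) [] r) [] H y} =
      {\<omega> \<in> space ?N. case \<omega> of (g, \<xi>l, \<xi>r) \<Rightarrow> (case g of LMark \<Rightarrow> ?Q \<xi>l | RMark \<Rightarrow> ?Q \<xi>r)}"
    by (auto simp: bp_gamma_tree_def split: mark.splits)
  show "{\<omega> \<in> space ?N. rooted_iso (nbhd (bp_gamma_tree \<omega>) [] r) [] H y} \<in> sets ?N"
    unfolding X by (rule bp_gamma_event(2)[OF meas meas])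
  fix \<epsilon> :: real assume \<epsilon>: "0 < \<epsilon>"
  define \<alpha> where "\<alpha> = (\<Sum>t\<in>{LMark, RMark}. root_density t * measure (tree_measure t) {\<xi>. ?Q \<xi>})"
  define \<beta> where "\<beta> = (\<Sum>t\<in>{LMark, RMark}. root_density t * measure (tree_measure t) {\<xi>. \<not> ?Q \<xi>})"
  have sum: "\<alpha> + \<beta> = 1 + EW"
    by (simp add: \<alpha>_def \<beta>_def measure_compl_tree[OF meas] root_density_def algebra_simps)
  have nn: "0 \<le> \<alpha>" "0 \<le> \<beta>" unfolding \<alpha>_def \<beta>_def by (intro sum_nonneg mult_nonneg_nonneg root_density_nonneg; simp)+
  define a where "a n A = (\<Sum>t\<in>{LMark, RMark}. root_count t ?P n A)" for n A
  define b where "b n A = (\<Sum>t\<in>{LMark, RMark}. root_count t (\<lambda>n A x. \<not> ?P n A x) n A)" for n A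
  have ab: "a n A + b n A = 1 + real (card A) / real n" if "1 \<le> n" "A \<in> set_pmf (on_groups_pmf p w n)" for n A
  proof -
    have A: "A \<subseteq> groups n" using that(2) by (rule on_groups_subset)
    show ?thesis
      using root_count_compl[OF A, of LMark ?P] root_count_compl[OF A, of RMark ?P] that(1)
      by (simp add: a_def b_def card_roots)
  qed
  have "(\<lambda>n. prob_on n {A. \<bar>nbhd_fraction (bgrg_graph n A) r H y - \<alpha> / (\<alpha> + \<beta>)\<bar> > \<epsilon>}) \<longlonglongrightarrow> 0"
  proof (rule ratio_convergence[where a = a and b = b])
    show "finite (set_pmf (on_groups_pmf p w n))" for n by (rule finite_set_on_groups)
    show "0 \<le> a n A" "0 \<le> b n A" for n A by (auto simp: a_def b_def root_count_nonneg)
    show "1 \<le> a n A + b n A" if "1 \<le> n" "A \<in> set_pmf (on_groups_pmf p w n)" for n A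
      using ab[OF that] by simp
    show "nbhd_fraction (bgrg_graph n A) r H y = a n A / (a n A + b n A)"
      if n: "1 \<le> n" "A \<in> set_pmf (on_groups_pmf p w n)" for n A
    proof -
      have A: "A \<subseteq> groups n" using n(2) by (rule on_groups_subset)
      have an: "a n A = real (card {x \<in> vertices (bgrg_graph n A). ?P n A x}) / real n"
        by (simp add: a_def root_count_def card_filter_vertices_bgrg[OF A] add_divide_distrib)
      have "nbhd_fraction (bgrg_graph n A) r H y = (real n * a n A) / (real n + real (card A))"
        using n(1) by (simp add: nbhd_fraction_card[OF finite_vertices_bgrg[OF A]] card_vertices_bgrg[OF A] an)
      also have "real n + real (card A) = real n * (a n A + b n A)"
        using n(1) by (simp add: ab[OF n] field_simps)
      also have "real n * a n A / (real n * (a n A + b n A)) = a n A / (a n A + b n A)"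
        using n(1) by simp
      finally show ?thesis .
    qed
    show "eventually (\<lambda>n. \<alpha> * \<alpha> - \<delta> \<le> mean_on n (\<lambda>A. a n A * a n A)) sequentially" if "0 < \<delta>" for \<delta>
      unfolding \<alpha>_def a_def by (rule pair_roots_liminf_sum[OF wit(1) wit(1) that])
    show "eventually (\<lambda>n. \<alpha> * \<beta> - \<delta> \<le> mean_on n (\<lambda>A. a n A * b n A)) sequentially" if "0 < \<delta>" for \<delta>
      unfolding \<alpha>_def \<beta>_def a_def b_def by (rule pair_roots_liminf_sum[OF wit(1) wit(2) that])
    show "eventually (\<lambda>n. \<beta> * \<beta> - \<delta> \<le> mean_on n (\<lambda>A. b n A * b n A)) sequentially" if "0 < \<delta>" for \<delta>
      unfolding \<beta>_def b_def by (rule pair_roots_liminf_sum[OF wit(2) wit(2) that])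
    show "eventually (\<lambda>n. mean_on n (\<lambda>A. (a n A + b n A)\<^sup>2) \<le> (\<alpha> + \<beta>)\<^sup>2 + \<delta>) sequentially"
      if "0 < \<delta>" for \<delta>
      using total_second_moment[OF that] eventually_ge_at_top[of 1]
    proof eventually_elim
      case (elim n)
      have "mean_on n (\<lambda>A. (a n A + b n A)\<^sup>2) =
          mean_on n (\<lambda>A. (1 + real (card A) / real n)\<^sup>2)"
        using ab[OF elim(2)] by (intro integral_cong_AE AE_pmfI) auto
      then show ?case using elim by (simp add: sum)
    qed
  qed (use nn sum EW_pos \<epsilon> in auto)
  moreover have "measure ?N {\<omega> \<in> space ?N. rooted_iso (nbhd (bp_gamma_tree \<omega>) [] r) [] H y} = \<alpha> / (\<alpha> + \<beta>)"
    unfolding X bp_gamma_event(3)[OF meas meas] sum by (simp add: \<alpha>_def)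
  ultimately show "(\<lambda>n. measure_pmf.prob (BGRG p w n)
      {g. \<bar>nbhd_fraction g r H y - measure ?N {\<omega> \<in> space ?N. rooted_iso (nbhd (bp_gamma_tree \<omega>) [] r) [] H y}\<bar> > \<epsilon>}) \<longlonglongrightarrow> 0"
    by (simp add: BGRG_def vimage_def)
qed

theorem drig_converges:
  "converges_locally_in_probability (DRIG p w) (tree_measure LMark) cp_graph (\<lambda>_. [])"
  unfolding converges_locally_in_probability_def
proof (intro conjI allI impI ballI)
  fix n g assume "g \<in> set_pmf (DRIG p w n)"
  then obtain A where "g = drig_graph n A" "A \<subseteq> groups n"
    unfolding DRIG_def using on_groups_subset by auto
  then show "mgraph g" "finite (vertices g)" using mgraph_drig by (auto simp: drig_graph_def)
next
  fix K :: nat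
  have "eventually (\<lambda>n. measure_pmf.prob (DRIG p w n) {g. card (vertices g) \<le> K} = 0) sequentially"
  proof (rule eventually_sequentiallyI[of "Suc K"])
    fix n assume n: "Suc K \<le> n"
    have "card (vertices g) > K" if "g \<in> set_pmf (DRIG p w n)" for g
      using that n by (auto simp: DRIG_def drig_graph_def)
    then show "measure_pmf.prob (DRIG p w n) {g. card (vertices g) \<le> K} = 0"
      by (force simp: measure_pmf_zero_iff)
  qed
  then show "(\<lambda>n. measure_pmf.prob (DRIG p w n) {g. card (vertices g) \<le> K}) \<longlonglongrightarrow> 0"
    by (rule tendsto_eventually)
next
  show "prob_space (tree_measure LMark)" by (rule prob_space_offspring)
next
  fix \<xi> show "rooted_mgraph (cp_graph \<xi>) []" by (rule rooted_mgraph_cp_graph)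
next
  fix H :: "nat mgraph" and y r
  let ?Q = "\<lambda>\<xi>. rooted_iso (nbhd (cp_graph \<xi>) [] r) [] H y"
  let ?P = "\<lambda>n A x. rooted_iso (nbhd (drig_graph n A) (projl x) r) (projl x) H y"
  let ?P' = "\<lambda>n A x. \<not> ?P n A x"
  let ?N = "tree_measure LMark"
  (* The least even depth allowed by drig_ball_iso. *)
  have "even (2 * r + 2)" "2 * r + 1 \<le> 2 * r + 2" by simp_all
  note wit = witnessed_drig[OF this, of H y]
  have meas: "{\<xi>. ?Q \<xi>} \<in> sets ?N"
    by (rule event_measurable[of "2 * r + 2"]) (use wit(1) in \<open>auto simp: witnessed_def\<close>)
  have X: "{\<omega> \<in> space ?N. ?Q \<omega>} = {\<xi>. ?Q \<xi>}" by simp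
  show "{\<omega> \<in> space ?N. ?Q \<omega>} \<in> sets ?N" unfolding X by (rule meas)
  fix \<epsilon> :: real assume \<epsilon>: "0 < \<epsilon>"
  define \<alpha> where "\<alpha> = measure ?N {\<xi>. ?Q \<xi>}"
  define \<beta> where "\<beta> = measure ?N {\<xi>. \<not> ?Q \<xi>}"
  have sum: "\<alpha> + \<beta> = 1" by (simp add: \<alpha>_def \<beta>_def measure_compl_tree[OF meas])
  have lim: "\<alpha> = root_density LMark * \<alpha>" "\<beta> = root_density LMark * \<beta>" by (simp_all add: root_density_def)
  have ab: "root_count LMark ?P n A + root_count LMark ?P' n A = 1" if "1 \<le> n" "A \<in> set_pmf (on_groups_pmf p w n)" for n A
    using root_count_compl[OF on_groups_subset[OF that(2)], of LMark ?P] that(1) by (simp add: card_roots)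
  have "(\<lambda>n. prob_on n {A. \<bar>nbhd_fraction (drig_graph n A) r H y - \<alpha> / (\<alpha> + \<beta>)\<bar> > \<epsilon>}) \<longlonglongrightarrow> 0"
  proof (rule ratio_convergence[where a = "root_count LMark ?P" and b = "root_count LMark ?P'"])
    show "finite (set_pmf (on_groups_pmf p w n))" for n by (rule finite_set_on_groups)
    show "nbhd_fraction (drig_graph n A) r H y = root_count LMark ?P n A / (root_count LMark ?P n A + root_count LMark ?P' n A)"
      if n: "1 \<le> n" "A \<in> set_pmf (on_groups_pmf p w n)" for n A
    proof -
      have "{x \<in> roots LMark n A. ?P n A x} = Inl ` {i \<in> {1..n}. rooted_iso (nbhd (drig_graph n A) i r) i H y}"
        by (auto simp: roots_def)
      then have "card {x \<in> roots LMark n A. ?P n A x} = card {i \<in> {1..n}. rooted_iso (nbhd (drig_graph n A) i r) i H y}"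
        by (simp add: card_image)
      then show ?thesis unfolding ab[OF n] by (simp add: nbhd_fraction_card root_count_def drig_graph_def)
    qed
    show "eventually (\<lambda>n. \<alpha> * \<alpha> - \<delta> \<le> mean_on n (\<lambda>A. root_count LMark ?P n A * root_count LMark ?P n A)) sequentially" if "0 < \<delta>" for \<delta>
      using pair_roots_liminf[OF wit(1) wit(1) that] by (simp add: \<alpha>_def root_density_def)
    show "eventually (\<lambda>n. \<alpha> * \<beta> - \<delta> \<le> mean_on n (\<lambda>A. root_count LMark ?P n A * root_count LMark ?P' n A)) sequentially" if "0 < \<delta>" for \<delta>
      using pair_roots_liminf[OF wit(1) wit(2) that] by (simp add: \<alpha>_def \<beta>_def root_density_def)
    show "eventually (\<lambda>n. \<beta> * \<beta> - \<delta> \<le> mean_on n (\<lambda>A. root_count LMark ?P' n A * root_count LMark ?P' n A)) sequentially" if "0 < \<delta>" for \<delta>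
      using pair_roots_liminf[OF wit(2) wit(2) that] by (simp add: \<beta>_def root_density_def)
    show "eventually (\<lambda>n. mean_on n (\<lambda>A. (root_count LMark ?P n A + root_count LMark ?P' n A)\<^sup>2) \<le> (\<alpha> + \<beta>)\<^sup>2 + \<delta>) sequentially"
      if "0 < \<delta>" for \<delta>
      using eventually_ge_at_top[of 1]
    proof eventually_elim
      case (elim n)
      have "mean_on n (\<lambda>A. (root_count LMark ?P n A + root_count LMark ?P' n A)\<^sup>2) =
          mean_on n (\<lambda>A. 1)"
        using ab[OF elim] by (intro integral_cong_AE AE_pmfI) auto
      then show ?case using \<open>0 < \<delta>\<close> by (simp add: sum)
    qed
  qed (use ab sum \<epsilon> in \<open>auto simp: \<alpha>_def \<beta>_def root_count_nonneg\<close>)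
  then show "(\<lambda>n. measure_pmf.prob (DRIG p w n)
      {g. \<bar>nbhd_fraction g r H y - measure ?N {\<omega> \<in> space ?N. ?Q \<omega>}\<bar> > \<epsilon>}) \<longlonglongrightarrow> 0"
    unfolding sum X by (simp add: DRIG_def vimage_def \<alpha>_def)
qed

end

theorem theorem1p4:
  fixes w :: "nat \<Rightarrow> nat \<Rightarrow> real" and p :: "nat pmf"
    and M :: "'a measure" and W :: "'a \<Rightarrow> real"
  assumes weights_nonneg: "\<And>n i. i \<in> {1..n} \<Longrightarrow> w n i \<ge> 0"
    and total_weight_pos: "\<And>n. n \<ge> 1 \<Longrightarrow> total_weight w n > 0"
    and sizes: "set_pmf p \<subseteq> {2..}"
    and size_mean_finite: "summable (\<lambda>k. real k * pmf p k)"
    and size_second_moment_finite: "summable (\<lambda>k. (real k)\<^sup>2 * pmf p k)"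
    and W: "prob_space M" "W \<in> borel_measurable M"
    and W_first_moment: "integrable M W" "(\<integral>\<omega>. W \<omega> \<partial>M) > 0"
    and W_second_moment: "integrable M (\<lambda>\<omega>. (W \<omega>)\<^sup>2)"
    and Wn_conv_distr:
      "weak_conv_m (\<lambda>n. distr (measure_pmf (pmf_of_set {1..n})) borel (w n)) (distr M borel W)"
    and Wn_first_moment_conv:
      "(\<lambda>n. measure_pmf.expectation (pmf_of_set {1..n}) (w n)) \<longlonglongrightarrow> (\<integral>\<omega>. W \<omega> \<partial>M)"
    and Wn_second_moment_conv:
      "(\<lambda>n. measure_pmf.expectation (pmf_of_set {1..n}) (\<lambda>i. (w n i)\<^sup>2)) \<longlonglongrightarrow> (\<integral>\<omega>. (W \<omega>)\<^sup>2 \<partial>M)"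
  shows "converges_locally_in_probability (BGRG p w)
           (bp_gamma_measure (\<integral>\<omega>. W \<omega> \<partial>M) (mixed_poisson_pmf (size_mean p) M W) p)
           bp_gamma_tree (\<lambda>_. []) \<and>
         converges_locally_in_probability (DRIG p w)
           (offspring_measure (mixed_poisson_pmf (size_mean p) M W) p LMark)
           cp_graph (\<lambda>_. [])"
proof -
  interpret converging_weights w p M W
    by (intro converging_weights.intro assms)
  show ?thesis using bgrg_converges drig_converges by blast
qed

end
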